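(* Let $T$ be a self-adjoint diagonal operator on $E_c$, commuting with $A$, such that $0\le T\le2I$, where $I$ is the identity operator of $E_c$. Let $C$ and $D$ be two bounded, self-adjoint, diagonal operators on $E_c$, of operator norm at most $1$, commuting with $A$, such that $$(I-C^2)(I-D^2)\ \ge\ (T-I)^2C^2D^2 .$$ That is, $Te_n=t_ne_n$, $Ce_n=\alpha_ne_n$, $De_n=\beta_ne_n$ for real sequences with $0\le t_n\le2$, $-1\le\alpha_n\le1$, $-1\le\beta_n\le1$ and $(1-\alpha_n^2)(1-\beta_n^2)\ge(t_n-1)^2\alpha_n^2\beta_n^2$ for all $n\ge0$. Let $P,Q,R,S$ be any bounded, self-adjoint, diagonal operators commuting with $A$ such that $$P^2+Q^2=I-C^2,\qquad R^2+S^2=I-D^2,\qquad PR+QS=(T-I)CD .$$ Then for all $\varphi,\psi\in Exp$, $$(\Gamma(C)\varphi\diamond_T\Gamma(D)\psi)(x)=\int_{\mathcal{E}'}\int_{\mathcal{E}'}\varphi(C^*x+P^*y+Q^*z)\,\psi(D^*x+R^*y+S^*z)\,d\mu(z)\,d\mu(y),$$ and moreover $$(\Gamma(C)\varphi\diamond_T\Gamma(D)\psi)(x)=\lim_{n\to\infty}\int_{E_n}\int_{E_n}E[\varphi\mid\mathcal{F}_n](Cx+Py+Qz)\,E[\psi\mid\mathcal{F}_n](Dx+Ry+Sz)\,d\mu_n(z)\,d\mu_n(y),$$ where the limit is in $L^p(\mathcal{E}',\mu)$ for all $1\le p<\infty$.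
   Context: Setting. $E$ is a real separable Hilbert space with norm $|\cdot|_0$. $A$ is a self-adjoint operator on $E$ with an orthonormal basis $\{e_n\}_{n\ge0}$ of eigenvectors, $Ae_n=\lambda_ne_n$, $1<\lambda_0<\lambda_1<\cdots$, and $A^{-1}$ Hilbert--Schmidt. For $k\ge0$, $|f|_k=|A^kf|_0$, $\mathcal{E}_k=\{f\in E:|f|_k<\infty\}$, $\mathcal{E}=\bigcap_{k\ge0}\mathcal{E}_k$ with the topology given by these norms; $\mathcal{E}'$ is its dual. $\mu$ is the unique probability measure on $\mathcal{E}'$ with $\int_{\mathcal{E}'}e^{i\langle x,\xi\rangle}d\mu(x)=e^{-|\xi|_0^2/2}$ for $\xi\in\mathcal{E}$. For $f\in E$, $\langle\cdot,f\rangle$ is the $L^2(\mu)$-limit of $\langle\cdot,\xi_n\rangle$, $\xi_n\in\mathcal{E}$, $\xi_n\to f$ in $E$. The subscript $c$ denotes complexification; $\langle\cdot,\cdot\rangle$ also denotes the complex-bilinear extension of the inner product to $E_c$. Diagonal operators are of the form $e_n\mapsto b_ne_n$ with real eigenvalues $b_n$ (complex-linearly extended); inequalities between them are eigenvalue by eigenvalue. Such bounded operators map $\mathcal{E}$ continuously to $\mathcal{E}$, and $C^*,D^*,P^*,Q^*,R^*,S^*:\mathcal{E}'\to\mathcal{E}'$ denote the dual operators. Second quantization. Every $\varphi\in L^2(\mathcal{E}',\mu)$ (complex-valued) has a unique Wiener--It\^o expansion $\varphi(x)=\sum_n\langle:x^{\otimes n}:,f_n\rangle$, $f_n\in E_c^{\hat\otimes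 n}$, where $:x^{\otimes n}:$ is the Wick tensor; $\Gamma(B)\varphi(x)=\sum_n\langle:x^{\otimes n}:,B^{\otimes n}f_n\rangle$. Exponential functions. For $\xi\in E_c$, $\varphi_\xi(x)=e^{\langle x,\xi\rangle-\frac12\langle\xi,\xi\rangle}=\sum_n\frac1{n!}\langle:x^{\otimes n}:,\xi^{\otimes n}\rangle$. $Exp$ is the complex linear span of $\{\varphi_\xi:\xi\in\mathcal{E}_c\}$ (for these $\xi$ the pointwise formula is taken for every $x\in\mathcal{E}'$). $T$-Wick product. For bounded diagonal $T>0$ and $\varphi,\psi$ in the span of exponential functions, $\varphi\diamond_T\psi=\Gamma(1/\sqrt T)[\Gamma(\sqrt T)\varphi\cdot\Gamma(\sqrt T)\psi]$ (pointwise product inside the brackets). For $T\ge0$, $\varphi\diamond_T\psi=\lim_{\epsilon\to0^+}\varphi\diamond_{T_\epsilon}\psi$ with $T_\epsilon=T+\epsilon P_{\mathrm{Ker}(T)}$, $P_{\mathrm{Ker}(T)}$ the orthogonal projection onto $\mathrm{Ker}(T)$. Finite-dimensional notation. For $n\ge1$, $\mathcal{F}_n$ is the smallest sigma-algebra for which $\langle\cdot,e_0\rangle,\dots,\langle\cdot,e_{n-1}\rangle$ are measurable, $E_n=\mathbb{R}e_0\oplus\cdots\oplus\mathbb{R}e_{n-1}\equiv\mathbb{R}^n$, and $\mu_n$ is the standard Gaussian probability measure on $E_n$. $E[\varphi\mid\mathcal{F}_n]$ is the conditional expectation under $\mu$, regarded as a function on $E_n$ through the coordinates $\langle\cdot,e_0\rangle,\dots,\langle\cdot,e_{n-1}\rangle$;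 in $E[\varphi\mid\mathcal{F}_n](Cx+Py+Qz)$ the point $x\in\mathcal{E}'$ enters through $\sum_{k=0}^{n-1}\langle x,e_k\rangle e_k\in E_n$. *)

theory Defs
  imports "HOL-Probability.Probability" "HOL-Library.Function_Algebras"
begin

definition in_Lp :: "real \<Rightarrow> 'a measure \<Rightarrow> ('a \<Rightarrow> complex) \<Rightarrow> bool" where
  "in_Lp p M f \<longleftrightarrow> f \<in> borel_measurable M \<and> integrable M (\<lambda>x. norm (f x) powr p)"

definition Lp_tendsto ::
    "real \<Rightarrow> 'a measure \<Rightarrow> ('b \<Rightarrow> 'a \<Rightarrow> complex) \<Rightarrow> ('a \<Rightarrow> complex) \<Rightarrow> 'b filter \<Rightarrow> bool" where
  "Lp_tendsto p M F f flt \<longleftrightarrow>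
     in_Lp p M f \<and> (\<forall>\<^sub>F i in flt. in_Lp p M (F i)) \<and>
     ((\<lambda>i. \<integral>x. norm (F i x - f x) powr p \<partial>M) \<longlongrightarrow> 0) flt"

text \<open>
  The Hilbert space $E$ is a type of class \<open>{real_inner, polish_space}\<close>, that is, a real inner
  product space that is complete and separable. The unbounded operator $A$ is a domain
  together with a function that is only meaningful on this domain.
\<close>

record 'e white_noise =
  domA :: "'e set"
  opA :: "'e \<Rightarrow> 'e"
  basis :: "nat \<Rightarrow> 'e"
  eigval :: "nat \<Rightarrow> real"
  gauss :: "('e \<Rightarrow> real) measure"

text \<open>The last conjunct says that the graphs of $A$ and of its adjoint coincide.\<close>

definition self_adjoint :: "'e::real_inner set \<Rightarrow> ('e \<Rightarrow> 'e) \<Rightarrow> bool" where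
  "self_adjoint D A \<longleftrightarrow>
     subspace D \<and> closure D = UNIV \<and>
     (\<forall>f\<in>D. \<forall>g\<in>D. A (f + g) = A f + A g) \<and>
     (\<forall>c. \<forall>f\<in>D. A (c *\<^sub>R f) = c *\<^sub>R A f) \<and>
     (\<forall>g h. (\<forall>f\<in>D. inner (A f) g = inner f h) \<longleftrightarrow> g \<in> D \<and> A g = h)"

definition orthonormal_basis :: "(nat \<Rightarrow> 'e::real_inner) \<Rightarrow> bool" where
  "orthonormal_basis e \<longleftrightarrow>
     (\<forall>m n. inner (e m) (e n) = (if m = n then 1 else 0)) \<and> closure (span (range e)) = UNIV"

text \<open>The domain of $A^k$ is the space on which $|f|_k = |A^k f|_0$ is finite.\<close>

definition E_k :: "('e, 'm) white_noise_scheme \<Rightarrow> nat \<Rightarrow> 'e set" where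
  "E_k W k = {f. \<forall>j<k. (opA W ^^ j) f \<in> domA W}"

definition norm_k :: "('e::real_normed_vector, 'm) white_noise_scheme \<Rightarrow> nat \<Rightarrow> 'e \<Rightarrow> real" where
  "norm_k W k f = norm ((opA W ^^ k) f)"

definition test_space :: "('e, 'm) white_noise_scheme \<Rightarrow> 'e set" where
  "test_space W = (\<Inter>k. E_k W k)"

definition test_topology :: "('e::real_normed_vector, 'm) white_noise_scheme \<Rightarrow> 'e topology" where
  "test_topology W =
     topology_generated_by
       {{g \<in> test_space W. norm_k W k (g - f) < r} | f k r. f \<in> test_space W \<and> 0 < r}"

text \<open>
  A functional on the test space is encoded as a function on the whole of $E$ that vanishes
  outside the test space, so that sums of functionals are pointwise sums.
\<close>

definition dual_space :: "('e::real_normed_vector, 'm) white_noise_scheme \<Rightarrow> ('e \<Rightarrow> real) set" where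
  "dual_space W = {x.
     (\<forall>f. f \<notin> test_space W \<longrightarrow> x f = 0) \<and>
     (\<forall>f\<in>test_space W. \<forall>g\<in>test_space W. x (f + g) = x f + x g) \<and>
     (\<forall>c. \<forall>f\<in>test_space W. x (c *\<^sub>R f) = c * x f) \<and>
     continuous_map (test_topology W) euclideanreal x}"

definition dual_op ::
    "('e, 'm) white_noise_scheme \<Rightarrow> ('e \<Rightarrow> 'e) \<Rightarrow> ('e \<Rightarrow> real) \<Rightarrow> 'e \<Rightarrow> real" where
  "dual_op W B x = (\<lambda>f. if f \<in> test_space W then x (B f) else 0)"

definition cylinder_algebra ::
    "('e::real_normed_vector, 'm) white_noise_scheme \<Rightarrow> ('e \<Rightarrow> real) measure" where
  "cylinder_algebra W =
     sigma (dual_space W)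
       {{x \<in> dual_space W. x f \<in> B} | f B. f \<in> test_space W \<and> B \<in> sets borel}"

definition white_noise_space ::
    "('e::{real_inner, polish_space}, 'm) white_noise_scheme \<Rightarrow> bool" where
  "white_noise_space W \<longleftrightarrow>
     self_adjoint (domA W) (opA W) \<and>
     orthonormal_basis (basis W) \<and>
     (\<forall>n. basis W n \<in> domA W \<and> opA W (basis W n) = eigval W n *\<^sub>R basis W n) \<and>
     1 < eigval W 0 \<and> strict_mono (eigval W) \<and>
     \<comment> \<open>the inverse of $A$ is Hilbert-Schmidt\<close>
     summable (\<lambda>n. (norm (inv_into (domA W) (opA W) (basis W n)))\<^sup>2) \<and>
     prob_space (gauss W) \<and> sets (gauss W) = sets (cylinder_algebra W) \<and>
     (\<forall>f\<in>test_space W.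
        (\<integral>x. exp (\<i> * complex_of_real (x f)) \<partial>gauss W) =
        complex_of_real (exp (- (norm f)\<^sup>2 / 2)))"

text \<open>
  Since the eigenvalues are real, a diagonal operator on the complexification is determined by
  its restriction to $E$. Self-adjointness and commutation with $A$ are automatic.
\<close>

definition diagonal_op ::
    "('e::real_normed_vector, 'm) white_noise_scheme \<Rightarrow> ('e \<Rightarrow> 'e) \<Rightarrow> (nat \<Rightarrow> real) \<Rightarrow> bool" where
  "diagonal_op W B b \<longleftrightarrow>
     bounded_linear B \<and> (\<forall>n. B (basis W n) = b n *\<^sub>R basis W n)"

text \<open>An element $f + ig$ of the complexification of $E$ is the pair \<open>(f, g)\<close>.\<close>

definition cpairing :: "('e \<Rightarrow> real) \<Rightarrow> 'e \<times> 'e \<Rightarrow> complex" where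
  "cpairing x \<xi> = complex_of_real (x (fst \<xi>)) + \<i> * complex_of_real (x (snd \<xi>))"

definition cbilinear :: "'e::real_inner \<times> 'e \<Rightarrow> 'e \<times> 'e \<Rightarrow> complex" where
  "cbilinear \<xi> \<eta> =
     complex_of_real (inner (fst \<xi>) (fst \<eta>) - inner (snd \<xi>) (snd \<eta>)) +
     \<i> * complex_of_real (inner (fst \<xi>) (snd \<eta>) + inner (snd \<xi>) (fst \<eta>))"

definition exp_fun :: "'e::real_inner \<times> 'e \<Rightarrow> ('e \<Rightarrow> real) \<Rightarrow> complex" where
  "exp_fun \<xi> x = exp (cpairing x \<xi> - cbilinear \<xi> \<xi> / 2)"

definition Exp :: "('e::real_inner, 'm) white_noise_scheme \<Rightarrow> (('e \<Rightarrow> real) \<Rightarrow> complex) set" where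
  "Exp W = {\<lambda>x. \<Sum>\<xi>\<in>F. c \<xi> * exp_fun \<xi> x | F c.
              finite F \<and> F \<subseteq> test_space W \<times> test_space W}"

text \<open>
  \<open>wick x [f\<^sub>1, \<dots>, f\<^sub>n]\<close> is the pairing of the Wick tensor $:x^{\otimes n}:$ with
  $f_1 \otimes \dots \otimes f_n$. The equations express
  $:x^{\otimes(n+1)}: = x \hat\otimes :x^{\otimes n}: - n\,\tau \hat\otimes :x^{\otimes(n-1)}:$,
  where $\tau$ is the trace, $\langle\tau, f \otimes g\rangle = \langle f, g\rangle$.
\<close>

function wick :: "('e::real_inner \<Rightarrow> real) \<Rightarrow> 'e list \<Rightarrow> real" where
  "wick x [] = 1"
| "wick x (f # fs) =
     x f * wick x fs -
     (\<Sum>j<length fs. inner f (fs ! j) * wick x (take j fs @ drop (Suc j) fs))"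
  by pat_completeness auto
termination
  by (relation "Wellfounded.measure (\<lambda>(x, fs). length fs)") auto

text \<open>
  An element of the $n$-th symmetric Hilbert tensor power of the complexification of $E$ is given
  by its coefficients with respect to the orthonormal basis
  $e_{i_1} \otimes \dots \otimes e_{i_n}$ of the full tensor power.
\<close>

definition sym_tensor :: "nat \<Rightarrow> (nat list \<Rightarrow> complex) \<Rightarrow> bool" where
  "sym_tensor n f \<longleftrightarrow>
     (\<forall>is js. length is = n \<and> mset is = mset js \<longrightarrow> f is = f js) \<and>
     (\<lambda>is. (norm (f is))\<^sup>2) summable_on {is. length is = n}"

text \<open>
  For a general symmetric tensor the pairing with $:x^{\otimes n}:$, here \<open>X n\<close>, exists only as a
  limit in $L^2(\mu)$.
\<close>

definition wiener_ito ::
    "('e::real_inner, 'm) white_noise_scheme \<Rightarrow>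
     (('e \<Rightarrow> real) \<Rightarrow> complex) \<Rightarrow> (nat \<Rightarrow> nat list \<Rightarrow> complex) \<Rightarrow> bool" where
  "wiener_ito W \<phi> f \<longleftrightarrow>
     (\<exists>X. (\<forall>n. sym_tensor n (f n) \<and>
               Lp_tendsto 2 (gauss W)
                 (\<lambda>N x. \<Sum>is | length is = n \<and> set is \<subseteq> {..<N}.
                           f n is * complex_of_real (wick x (map (basis W) is)))
                 (X n) sequentially) \<and>
          Lp_tendsto 2 (gauss W) (\<lambda>N x. \<Sum>n<N. X n x) \<phi> sequentially)"

text \<open>
  An element of $L^2(\mu)$, given by the property \<open>P\<close> of its representatives, is evaluated at points
  through its representative in \<open>Exp\<close>, if there is one (it is then unique).
\<close>

definition representative ::
    "('e::real_inner, 'm) white_noise_scheme \<Rightarrow>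
     ((('e \<Rightarrow> real) \<Rightarrow> complex) \<Rightarrow> bool) \<Rightarrow> ('e \<Rightarrow> real) \<Rightarrow> complex" where
  "representative W P = (SOME \<phi>. P \<phi> \<and> ((\<exists>\<psi>\<in>Exp W. P \<psi>) \<longrightarrow> \<phi> \<in> Exp W))"

text \<open>
  \<open>Gamma_op W b\<close> is the second quantization of the possibly unbounded diagonal operator with
  eigenvalues \<open>b\<close>, on its natural domain in $L^2(\mu)$.
\<close>

definition Gamma_op ::
    "('e::real_inner, 'm) white_noise_scheme \<Rightarrow> (nat \<Rightarrow> real) \<Rightarrow>
     (('e \<Rightarrow> real) \<Rightarrow> complex) \<Rightarrow> ('e \<Rightarrow> real) \<Rightarrow> complex" where
  "Gamma_op W b \<phi> =
     representative W (\<lambda>\<psi>. \<exists>f. wiener_ito W \<phi> f \<and>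
       wiener_ito W \<psi> (\<lambda>n is. complex_of_real (\<Prod>i\<leftarrow>is. b i) * f n is))"

definition T_wick_pos ::
    "('e::real_inner, 'm) white_noise_scheme \<Rightarrow> (nat \<Rightarrow> real) \<Rightarrow>
     (('e \<Rightarrow> real) \<Rightarrow> complex) \<Rightarrow> (('e \<Rightarrow> real) \<Rightarrow> complex) \<Rightarrow> ('e \<Rightarrow> real) \<Rightarrow> complex" where
  "T_wick_pos W t \<phi> \<psi> =
     Gamma_op W (\<lambda>n. 1 / sqrt (t n))
       (\<lambda>x. Gamma_op W (\<lambda>n. sqrt (t n)) \<phi> x * Gamma_op W (\<lambda>n. sqrt (t n)) \<psi> x)"

text \<open>
  The projection onto the kernel of $T$ has eigenvalue 1 on those basis vectors whose
  $T$-eigenvalue is 0, and 0 on the others. The limit is taken in $L^2(\mu)$.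
\<close>

definition T_wick ::
    "('e::real_inner, 'm) white_noise_scheme \<Rightarrow> (nat \<Rightarrow> real) \<Rightarrow>
     (('e \<Rightarrow> real) \<Rightarrow> complex) \<Rightarrow> (('e \<Rightarrow> real) \<Rightarrow> complex) \<Rightarrow> ('e \<Rightarrow> real) \<Rightarrow> complex" where
  "T_wick W t \<phi> \<psi> =
     (if \<forall>n. 0 < t n then T_wick_pos W t \<phi> \<psi>
      else representative W (\<lambda>\<rho>. Lp_tendsto 2 (gauss W)
             (\<lambda>\<epsilon>. T_wick_pos W (\<lambda>n. t n + \<epsilon> * (if t n = 0 then 1 else 0)) \<phi> \<psi>)
             \<rho> (at_right 0)))"

definition E_fin :: "('e::real_vector, 'm) white_noise_scheme \<Rightarrow> nat \<Rightarrow> 'e set" where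
  "E_fin W n = span (basis W ` {..<n})"

definition proj_fin ::
    "('e::real_vector, 'm) white_noise_scheme \<Rightarrow> nat \<Rightarrow> ('e \<Rightarrow> real) \<Rightarrow> 'e" where
  "proj_fin W n x = (\<Sum>k<n. x (basis W k) *\<^sub>R basis W k)"

definition gauss_fin ::
    "('e::real_normed_vector, 'm) white_noise_scheme \<Rightarrow> nat \<Rightarrow> 'e measure" where
  "gauss_fin W n =
     distr (PiM {..<n} (\<lambda>_. density lborel (\<lambda>u. ennreal (std_normal_density u))))
       (restrict_space borel (E_fin W n)) (\<lambda>v. \<Sum>k<n. v k *\<^sub>R basis W k)"

definition filtration ::
    "('e::real_normed_vector, 'm) white_noise_scheme \<Rightarrow> nat \<Rightarrow> ('e \<Rightarrow> real) measure" where
  "filtration W n =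
     sigma (dual_space W)
       {{x \<in> dual_space W. x (basis W k) \<in> B} | k B. k < n \<and> B \<in> sets borel}"

definition complex_cond_exp ::
    "'a measure \<Rightarrow> 'a measure \<Rightarrow> ('a \<Rightarrow> complex) \<Rightarrow> 'a \<Rightarrow> complex" where
  "complex_cond_exp M F \<phi> x =
     Complex (real_cond_exp M F (\<lambda>x. Re (\<phi> x)) x) (real_cond_exp M F (\<lambda>x. Im (\<phi> x)) x)"

text \<open>
  The conditional expectation given \<open>filtration W n\<close> as a function of the coordinates, determined
  up to null sets of \<open>gauss_fin W n\<close>.
\<close>

definition cond_exp_fin ::
    "('e::real_normed_vector, 'm) white_noise_scheme \<Rightarrow> nat \<Rightarrow>
     (('e \<Rightarrow> real) \<Rightarrow> complex) \<Rightarrow> 'e \<Rightarrow> complex" where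
  "cond_exp_fin W n \<phi> =
     (SOME g. g \<in> borel_measurable (restrict_space borel (E_fin W n)) \<and>
        (AE x in gauss W. g (proj_fin W n x) = complex_cond_exp (gauss W) (filtration W n) \<phi> x))"

end

theory Submission
  imports Defs "HOL-Complex_Analysis.Complex_Analysis"
begin

text \<open>
  Everything reduces to exponential functions. All operations map sums of exponential functions to
  such sums: $\Gamma(C)\varphi_\xi = \varphi_{C\xi}$, and
  $\varphi_\xi \diamond_T \varphi_\eta = e^{\langle T\xi,\eta\rangle} \varphi_{\xi+\eta}$ because
  $\varphi_\xi \varphi_\eta = e^{\langle\xi,\eta\rangle} \varphi_{\xi+\eta}$. The representatives
  in the definitions of $\Gamma$ and $\diamond_T$ are pinned down by the S-transform
  $a \mapsto \int \varphi\,\varphi_a\,d\mu$: it can be read off the Wiener--Ito coefficients, and it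
  separates sums of exponential functions since distinct characters are linearly independent.
  Both integral formulas then follow from
  $\int e^{\langle y,\zeta\rangle}\,d\mu(y) = e^{\langle\zeta,\zeta\rangle/2}$ for complex $\zeta$
  and the identity
  $(p X + r Y)^2 + (q X + s Y)^2 + (\alpha X + \beta Y)^2 = X^2 + Y^2 + 2 t \alpha \beta X Y$.
  For the second formula, $E[\varphi_\xi \mid \mathcal{F}_n] = \varphi_{\xi_n}$ with $\xi_n$ the
  projection of $\xi$, and $\varphi_{\xi_n} \to \varphi_\xi$ in every $L^p$.
\<close>

section \<open>Uniqueness theorems for characteristic functions\<close>

text \<open>The objects of the statement are defined by choice: \<open>Gamma_op\<close> and
  \<open>T_wick\<close> select a representative of a class in L2, \<open>cond_exp_fin\<close>
  selects a version of a conditional expectation. The two kinds of choice need different remedies. A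
  representative is evaluated at points, so an equation almost everywhere is too weak; the value is
  exact because a candidate in \<open>Exp\<close> exists and elements of \<open>Exp\<close> with
  equal S-transforms are the same function. The S-transform is compared only at vectors
  \<open>a\<close> with finitely many nonzero coordinates: each degree of the chaos then contributes
  a finite sum, and eigenvalues like \<open>1 / sqrt (t n)\<close>, which may be unbounded, can be
  moved from the coefficients to \<open>a\<close>. A version is known only up to null sets of
  \<mu>_n, yet it is evaluated at Cx + Py + Qz; this is harmless because
  \<open>\<alpha>\<^sup>2 + p\<^sup>2 + q\<^sup>2 = 1\<close> gives that point the law \<mu>_n.
  Since \<mu> is specified only by its characteristic function on real test functions, all moments,
  complex Gaussian integrals and equalities of laws must be derived from it.\<close>

lemma integrable_mult_iexp:
  fixes h :: "'a \<Rightarrow> complex"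
  assumes "integrable M h" "Y \<in> borel_measurable M"
  shows "integrable M (\<lambda>x. h x * iexp (Y x))"
proof (rule Bochner_Integration.integrable_bound[OF assms(1)])
  have [measurable]: "h \<in> borel_measurable M" "Y \<in> borel_measurable M" using assms by auto
  show "(\<lambda>x. h x * iexp (Y x)) \<in> borel_measurable M" by measurable
qed (simp add: norm_mult)

text \<open>The hypothesis at \<open>t = 0\<close> gives the positive and the negative part of
  \<open>h\<close> the same mass \<open>m\<close>. Divided by \<open>m\<close> they are probability
  densities whose image laws under \<open>Y\<close> share their characteristic function, so Levy's
  theorem equates these laws.\<close>

lemma integral_indicator_eq_0_of_char_real:
  fixes h :: "'a \<Rightarrow> real"
  assumes h: "integrable M h" and Y[measurable]: "Y \<in> borel_measurable M"
    and z: "\<And>t. (\<integral>x. of_real (h x) * iexp (t * Y x) \<partial>M) = 0"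
    and B[measurable]: "B \<in> sets borel"
  shows "(\<integral>x. h x * indicator B (Y x) \<partial>M) = 0"
proof -
  have [measurable]: "h \<in> borel_measurable M" using h by auto
  \<comment> \<open>\<open>g True\<close> and \<open>g False\<close> are the positive and the
    negative part; the boolean index lets each fact be proved for both at once.\<close>
  define g where "g b x = max 0 (if b then h x else - h x)" for b x
  have [measurable]: "g b \<in> borel_measurable M" for b unfolding g_def by (cases b) simp_all
  have g_nonneg: "0 \<le> g b x" for b x by (simp add: g_def)
  have g_int: "integrable M (g b)" for b
    by (rule Bochner_Integration.integrable_bound[OF h]) (auto simp: g_def)
  have h_eq: "h x = g True x - g False x" for x by (auto simp: g_def)
  have g_iexp: "integrable M (\<lambda>x. of_real (g b x) * iexp (t * Y x))" for b t
    by (rule integrable_mult_iexp) (auto simp: g_int)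
  have eq_iexp: "(\<integral>x. of_real (g True x) * iexp (t * Y x) \<partial>M)
      = (\<integral>x. of_real (g False x) * iexp (t * Y x) \<partial>M)" for t
    using z[of t] Bochner_Integration.integral_diff[OF g_iexp[of True t] g_iexp[of False t]]
    by (simp add: h_eq left_diff_distrib del: of_real_mult)
  define m where "m = (\<integral>x. g True x \<partial>M)"
  have m: "(\<integral>x. g b x \<partial>M) = m" for b
    using eq_iexp[of 0] by (cases b) (simp_all add: m_def)
  have m_nonneg: "0 \<le> m" unfolding m_def by (rule integral_nonneg_AE) (simp add: g_nonneg)
  have g_ind: "integrable M (\<lambda>x. g b x * indicator B (Y x))" for b
    by (rule Bochner_Integration.integrable_bound[OF g_int[of b]]) (auto simp: indicator_def)
  show ?thesis
  proof (cases "m = 0")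
    \<comment> \<open>Normalisation is impossible here, but both parts, hence \<open>h\<close>,
      vanish almost everywhere.\<close>
    case True
    have "AE x in M. g b x = 0" for b
      using integral_nonneg_eq_0_iff_AE[OF g_int[of b]] m[of b] True g_nonneg by simp
    from this[of True] this[of False] have "AE x in M. h x = 0"
      by eventually_elim (simp add: h_eq)
    then have "AE x in M. h x * indicator B (Y x) = 0" by auto
    then show ?thesis by (simp add: integral_eq_zero_AE)
  next
    case False
    then have m_pos: "0 < m" using m_nonneg by simp
    define N where "N b = distr (density M (\<lambda>x. ennreal (g b x / m))) borel Y" for b
    have prob: "prob_space (N b)" for b
    proof -
      have "prob_space (density M (\<lambda>x. ennreal (g b x / m)))"
      proof (rule prob_spaceI)
        have "integrable M (\<lambda>x. g b x / m)" using g_int[of b] by simp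
        then have "(\<integral>\<^sup>+ x. ennreal (g b x / m) \<partial>M) = ennreal (\<integral>x. g b x / m \<partial>M)"
          using g_nonneg m_pos by (intro nn_integral_eq_integral) auto
        also have "(\<integral>x. g b x / m \<partial>M) = 1" using m[of b] m_pos by simp
        finally have "(\<integral>\<^sup>+ x. ennreal (g b x / m) \<partial>M) = 1" by simp
        then show "emeasure (density M (\<lambda>x. ennreal (g b x / m)))
            (space (density M (\<lambda>x. ennreal (g b x / m)))) = 1"
          by (simp add: emeasure_density cong: nn_integral_cong)
      qed
      then show ?thesis unfolding N_def by (rule prob_space.prob_space_distr) simp
    qed
    have rd: "real_distribution (N b)" for b
      using prob[of b] by (simp add: real_distribution_def real_distribution_axioms_def N_def)
    have "char (N b) t = (\<integral>x. of_real (g b x) * iexp (t * Y x) \<partial>M) / of_real m" for b t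
      unfolding char_def N_def
      using m_pos g_nonneg
      by (simp add: integral_distr integral_density scaleR_conv_of_real del: of_real_mult)
    then have "char (N True) = char (N False)" by (simp add: eq_iexp fun_eq_iff del: of_real_mult)
    then have N: "N True = N False" using rd Levy_uniqueness by blast
    have "measure (N b) B = (\<integral>x. g b x * indicator B (Y x) \<partial>M) / m" for b
    proof -
      have "measure (N b) B = (\<integral>y. indicator B y \<partial>N b)"
        by (simp add: N_def)
      also have "\<dots> = (\<integral>x. g b x * indicator B (Y x) \<partial>M) / m"
        unfolding N_def using m_pos g_nonneg
        by (subst integral_distr, simp, simp, subst integral_density) simp_all
      finally show ?thesis .
    qed
    then have "(\<integral>x. g True x * indicator B (Y x) \<partial>M) = (\<integral>x. g False x * indicator B (Y x) \<partial>M)"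
      using N m_pos by (metis divide_cancel_right less_irrefl)
    then show ?thesis
      using Bochner_Integration.integral_diff[OF g_ind[of True] g_ind[of False]]
      by (simp add: h_eq left_diff_distrib)
  qed
qed

text \<open>The character in the hypothesis is complex, so real parts cannot be taken inside it.
  Instead, the transform of \<open>cnj h\<close> at \<open>t\<close> is the conjugate of that of
  \<open>h\<close> at \<open>- t\<close> and vanishes too; \<open>Re (h x)\<close> and
  \<open>Im (h x)\<close> are combinations of \<open>h x\<close> and
  \<open>cnj (h x)\<close>.\<close>

lemma integral_indicator_eq_0_of_char:
  fixes h :: "'a \<Rightarrow> complex"
  assumes h: "integrable M h" and Y[measurable]: "Y \<in> borel_measurable M"
    and z: "\<And>t. (\<integral>x. h x * iexp (t * Y x) \<partial>M) = 0"
    and B[measurable]: "B \<in> sets borel"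
  shows "(\<integral>x. h x * indicator B (Y x) \<partial>M) = 0"
proof -
  have [measurable]: "h \<in> borel_measurable M" using h by auto
  have i1: "integrable M (\<lambda>x. h x * iexp (t * Y x))" for t
    by (rule integrable_mult_iexp) (auto simp: h)
  have i2: "integrable M (\<lambda>x. cnj (h x) * iexp (t * Y x))" for t
    by (rule integrable_mult_iexp) (auto simp: h)
  have z': "(\<integral>x. cnj (h x) * iexp (t * Y x) \<partial>M) = 0" for t
  proof -
    have "(\<integral>x. cnj (h x) * iexp (t * Y x) \<partial>M) = (\<integral>x. cnj (h x * iexp ((- t) * Y x)) \<partial>M)"
      by (intro Bochner_Integration.integral_cong) (auto simp: exp_cnj)
    also have "\<dots> = cnj (\<integral>x. h x * iexp ((- t) * Y x) \<partial>M)" by (rule Bochner_Integration.integral_cnj)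
    finally show ?thesis using z[of "- t"] by simp
  qed
  have re: "(\<integral>x. Re (h x) * indicator B (Y x) \<partial>M) = 0"
  proof (rule integral_indicator_eq_0_of_char_real)
    fix t
    have "(\<integral>x. of_real (Re (h x)) * iexp (t * Y x) \<partial>M)
      = (\<integral>x. (h x * iexp (t * Y x) + cnj (h x) * iexp (t * Y x)) / 2 \<partial>M)"
      by (intro Bochner_Integration.integral_cong refl)
         (simp add: complex_add_cnj distrib_right[symmetric])
    also have "\<dots> = 0" using i1[of t] i2[of t] z z' by simp
    finally show "(\<integral>x. of_real (Re (h x)) * iexp (t * Y x) \<partial>M) = 0" .
  qed (use h in auto)
  have im_eq: "of_real (Im w) = (w - cnj w) / (2 * \<i>)" for w
    by (simp add: complex_eq_iff)
  have im: "(\<integral>x. Im (h x) * indicator B (Y x) \<partial>M) = 0"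
  proof (rule integral_indicator_eq_0_of_char_real)
    fix t
    have "(\<integral>x. of_real (Im (h x)) * iexp (t * Y x) \<partial>M)
      = (\<integral>x. (h x * iexp (t * Y x) - cnj (h x) * iexp (t * Y x)) / (2 * \<i>) \<partial>M)"
      by (intro Bochner_Integration.integral_cong refl)
         (simp add: im_eq diff_divide_distrib left_diff_distrib)
    also have "\<dots> = 0" using i1[of t] i2[of t] z z' by simp
    finally show "(\<integral>x. of_real (Im (h x)) * iexp (t * Y x) \<partial>M) = 0" .
  qed (use h in auto)
  have "integrable M (\<lambda>x. h x * indicator B (Y x))"
    by (rule Bochner_Integration.integrable_bound[OF h]) (auto simp: indicator_def)
  then have "Re (\<integral>x. h x * indicator B (Y x) \<partial>M) = (\<integral>x. Re (h x) * indicator B (Y x) \<partial>M)"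
    "Im (\<integral>x. h x * indicator B (Y x) \<partial>M) = (\<integral>x. Im (h x) * indicator B (Y x) \<partial>M)"
    by (auto simp flip: integral_Re integral_Im intro!: Bochner_Integration.integral_cong
        simp: indicator_def)
  then show ?thesis using re im by (simp add: complex_eq_iff)
qed

text \<open>The one-dimensional case is used for one coordinate after the other, the weight being
  multiplied with the indicators and exponentials of all the other coordinates.\<close>

lemma integral_rectangle_eq_0_of_char:
  fixes h :: "'a \<Rightarrow> complex" and Y :: "nat \<Rightarrow> 'a \<Rightarrow> real"
  assumes h: "integrable M h" and Y: "\<And>k. k < n \<Longrightarrow> Y k \<in> borel_measurable M"
    and z: "\<And>t. (\<integral>x. h x * iexp (\<Sum>k<n. t k * Y k x) \<partial>M) = 0"
    and B: "\<And>k. k < n \<Longrightarrow> B k \<in> sets borel"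
  shows "(\<integral>x. h x * (\<Prod>k<n. indicator (B k) (Y k x)) \<partial>M) = 0"
proof -
  have [measurable]: "h \<in> borel_measurable M" using h by auto
  have "(\<integral>x. h x * (\<Prod>k<j. indicator (B k) (Y k x)) * iexp (\<Sum>k=j..<n. t k * Y k x) \<partial>M) = 0"
    if "j \<le> n" for j t
    using that
  proof (induction j arbitrary: t)
    case 0
    then show ?case using z[of t] by (simp add: lessThan_atLeast0)
  next
    case (Suc j)
    have [measurable]: "(\<lambda>x. indicator (B k) (Y k x) :: complex) \<in> borel_measurable M" if "k < n" for k
    proof -
      note [measurable] = Y[OF that] B[OF that]
      show ?thesis by measurable
    qed
    have [measurable]: "(\<lambda>x. \<Prod>k<j. indicator (B k) (Y k x) :: complex) \<in> borel_measurable M"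
      using Suc.prems by (intro borel_measurable_prod) auto
    have [measurable]: "(\<lambda>x. \<Sum>k=Suc j..<n. t k * Y k x) \<in> borel_measurable M" for t :: "nat \<Rightarrow> real"
      using Y by (intro borel_measurable_sum) auto
    have b: "norm (\<Prod>k<j. indicator (B k) (Y k x) :: complex) \<le> 1" for x
      by (auto simp: prod_norm[symmetric] indicator_def intro!: prod_le_1)
    have i: "integrable M (\<lambda>x. h x * (\<Prod>k<j. indicator (B k) (Y k x)) * iexp (\<Sum>k=Suc j..<n. t k * Y k x))"
      by (rule Bochner_Integration.integrable_bound[OF h])
         (auto simp: norm_mult simp del: of_real_sum intro!: mult_left_le b)
    have "(\<integral>x. (h x * (\<Prod>k<j. indicator (B k) (Y k x)) * iexp (\<Sum>k=Suc j..<n. t k * Y k x))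
        * indicator (B j) (Y j x) \<partial>M) = 0"
    proof (rule integral_indicator_eq_0_of_char[OF i])
      fix s
      \<comment> \<open>The induction hypothesis covers all frequency vectors, so the new frequency
        \<open>s\<close> can be placed in slot \<open>j\<close>.\<close>
      have eq: "h x * (\<Prod>k<j. indicator (B k) (Y k x)) * iexp (\<Sum>k=Suc j..<n. t k * Y k x) * iexp (s * Y j x)
        = h x * (\<Prod>k<j. indicator (B k) (Y k x)) * iexp (\<Sum>k=j..<n. (t(j := s)) k * Y k x)" for x
      proof -
        have "(\<Sum>k=j..<n. (t(j := s)) k * Y k x) = s * Y j x + (\<Sum>k=Suc j..<n. t k * Y k x)"
          using Suc.prems by (subst sum.atLeast_Suc_lessThan) auto
        then show ?thesis by (simp add: exp_add distrib_left mult_ac)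
      qed
      show "(\<integral>x. h x * (\<Prod>k<j. indicator (B k) (Y k x)) * iexp (\<Sum>k=Suc j..<n. t k * Y k x)
          * iexp (s * Y j x) \<partial>M) = 0"
        using Suc.IH[of "t(j := s)"] Suc.prems by (simp only: eq Suc_leD)
    qed (use Y B Suc.prems in auto)
    then show ?case by (simp add: mult_ac)
  qed
  from this[of n] show ?thesis by simp
qed

text \<open>A difference of integrals over two unrelated spaces becomes one integral over a common
  space. A criterion for the vanishing of an integral can thus prove that two laws agree.\<close>

lemma integral_bernoulli_pair:
  fixes f :: "'a \<Rightarrow> complex" and g :: "'b \<Rightarrow> complex"
  assumes "prob_space M1" "prob_space M2"
    and f: "f \<in> borel_measurable M1" "\<And>x. norm (f x) \<le> 1"
    and g: "g \<in> borel_measurable M2" "\<And>x. norm (g x) \<le> 1"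
  shows "(\<integral>w. (if fst w then f (fst (snd w)) else - g (snd (snd w)))
      \<partial>(measure_pmf (bernoulli_pmf (1 / 2)) \<Otimes>\<^sub>M (M1 \<Otimes>\<^sub>M M2))) =
    ((\<integral>x. f x \<partial>M1) - (\<integral>x. g x \<partial>M2)) / 2"
proof -
  interpret M1: prob_space M1 by fact
  interpret M2: prob_space M2 by fact
  interpret P: pair_prob_space M1 M2 ..
  interpret B: prob_space "measure_pmf (bernoulli_pmf (1 / 2))" by (rule measure_pmf.prob_space_axioms)
  interpret Q: pair_prob_space "measure_pmf (bernoulli_pmf (1 / 2))" "M1 \<Otimes>\<^sub>M M2" ..
  note [measurable] = f(1) g(1)
  let ?N = "measure_pmf (bernoulli_pmf (1 / 2)) \<Otimes>\<^sub>M (M1 \<Otimes>\<^sub>M M2)"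
  have "integrable ?N (\<lambda>w. if fst w then f (fst (snd w)) else - g (snd (snd w)))"
    by (rule Q.P.integrable_const_bound[where B = 1]) (auto simp: f g)
  then have "(\<integral>w. (if fst w then f (fst (snd w)) else - g (snd (snd w))) \<partial>?N) =
      (\<integral>b. \<integral>v. (if b then f (fst v) else - g (snd v)) \<partial>(M1 \<Otimes>\<^sub>M M2) \<partial>(measure_pmf (bernoulli_pmf (1 / 2))))"
    using Q.integral_fst'[of "\<lambda>w. if fst w then f (fst (snd w)) else - g (snd (snd w))"]
    by (simp cong: if_cong)
  also have "\<dots> = ((\<integral>v. f (fst v) \<partial>(M1 \<Otimes>\<^sub>M M2)) - (\<integral>v. g (snd v) \<partial>(M1 \<Otimes>\<^sub>M M2))) / 2"
    by (subst integral_measure_pmf[where A = UNIV]) (auto simp: UNIV_bool scaleR_conv_of_real field_simps)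
  also have "(\<integral>v. f (fst v) \<partial>(M1 \<Otimes>\<^sub>M M2)) = (\<integral>x. f x \<partial>M1)"
  proof -
    have "integrable (M1 \<Otimes>\<^sub>M M2) (\<lambda>v. f (fst v))"
      by (rule P.P.integrable_const_bound[where B = 1]) (auto simp: f)
    from P.integral_fst'[OF this] show ?thesis by (simp add: M2.prob_space)
  qed
  also have "(\<integral>v. g (snd v) \<partial>(M1 \<Otimes>\<^sub>M M2)) = (\<integral>x. g x \<partial>M2)"
  proof -
    have "integrable (M1 \<Otimes>\<^sub>M M2) (\<lambda>v. g (snd v))"
      by (rule P.P.integrable_const_bound[where B = 1]) (auto simp: g)
    from P.integral_fst'[OF this] show ?thesis by (simp add: M1.prob_space)
  qed
  finally show ?thesis .
qed

text \<open>A fair coin chooses between the two spaces; the weight is the sign of the choice.\<close>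

lemma distr_PiM_eq_of_char:
  fixes Y1 :: "nat \<Rightarrow> 'a \<Rightarrow> real" and Y2 :: "nat \<Rightarrow> 'b \<Rightarrow> real"
  assumes "prob_space M1" "prob_space M2"
    and Y1: "\<And>k. k < n \<Longrightarrow> Y1 k \<in> borel_measurable M1"
    and Y2: "\<And>k. k < n \<Longrightarrow> Y2 k \<in> borel_measurable M2"
    and char: "\<And>t. (\<integral>x. iexp (\<Sum>k<n. t k * Y1 k x) \<partial>M1) = (\<integral>x. iexp (\<Sum>k<n. t k * Y2 k x) \<partial>M2)"
  shows "distr M1 (PiM {..<n} (\<lambda>_. borel)) (\<lambda>x. \<lambda>k\<in>{..<n}. Y1 k x) =
    distr M2 (PiM {..<n} (\<lambda>_. borel)) (\<lambda>x. \<lambda>k\<in>{..<n}. Y2 k x)" (is "?D1 = ?D2")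
proof -
  interpret M1: prob_space M1 by fact
  interpret M2: prob_space M2 by fact
  interpret P: pair_prob_space M1 M2 ..
  interpret B: prob_space "measure_pmf (bernoulli_pmf (1 / 2))" by (rule measure_pmf.prob_space_axioms)
  interpret Q: pair_prob_space "measure_pmf (bernoulli_pmf (1 / 2))" "M1 \<Otimes>\<^sub>M M2" ..
  let ?N = "measure_pmf (bernoulli_pmf (1 / 2)) \<Otimes>\<^sub>M (M1 \<Otimes>\<^sub>M M2)"
  define h :: "bool \<times> 'a \<times> 'b \<Rightarrow> complex" where "h w = (if fst w then 1 else - 1)" for w
  define Y where "Y k w = (if fst w then Y1 k (fst (snd w)) else Y2 k (snd (snd w)))"
    for k and w :: "bool \<times> 'a \<times> 'b"
  have [measurable]: "h \<in> borel_measurable ?N" unfolding h_def by measurable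
  have h_int: "integrable ?N h"
    by (rule Q.P.integrable_const_bound[where B = 1]) (auto simp: h_def)
  have Y_meas: "Y k \<in> borel_measurable ?N" if "k < n" for k
  proof -
    note [measurable] = Y1[OF that] Y2[OF that]
    show ?thesis unfolding Y_def by measurable
  qed
  have m1: "(\<lambda>x. \<Sum>k<n. t k * Y1 k x) \<in> borel_measurable M1"
    "(\<lambda>x. \<Sum>k<n. t k * Y2 k x) \<in> borel_measurable M2" for t :: "nat \<Rightarrow> real"
    using Y1 Y2 by (auto intro!: borel_measurable_sum)
  have char0: "(\<integral>w. h w * iexp (\<Sum>k<n. t k * Y k w) \<partial>?N) = 0" for t
  proof -
    note [measurable] = m1[of t]
    have "(\<integral>w. h w * iexp (\<Sum>k<n. t k * Y k w) \<partial>?N) =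
      (\<integral>w. (if fst w then iexp (\<Sum>k<n. t k * Y1 k (fst (snd w)))
         else - iexp (\<Sum>k<n. t k * Y2 k (snd (snd w)))) \<partial>?N)"
      by (intro Bochner_Integration.integral_cong) (auto simp: h_def Y_def)
    also have "\<dots> = 0"
    proof (subst integral_bernoulli_pair[OF assms(1,2)])
      show "(\<lambda>x. iexp (\<Sum>k<n. t k * Y1 k x)) \<in> borel_measurable M1"
        "(\<lambda>x. iexp (\<Sum>k<n. t k * Y2 k x)) \<in> borel_measurable M2" by measurable
    qed (simp_all add: char del: of_real_sum)
    finally show ?thesis .
  qed
  show ?thesis
  proof (rule measure_eqI_PiM_finite)
    have d1: "(\<lambda>x. \<lambda>k\<in>{..<n}. Y1 k x) \<in> M1 \<rightarrow>\<^sub>M PiM {..<n} (\<lambda>_. borel)"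
      "(\<lambda>x. \<lambda>k\<in>{..<n}. Y2 k x) \<in> M2 \<rightarrow>\<^sub>M PiM {..<n} (\<lambda>_. borel)"
      using Y1 Y2 by (auto intro!: measurable_restrict)
    show "range (\<lambda>_::nat. \<Pi>\<^sub>E k\<in>{..<n}. UNIV) \<subseteq> prod_algebra {..<n} (\<lambda>_. borel :: real measure)"
      by (auto intro!: prod_algebraI_finite)
    show "?D1 (\<Pi>\<^sub>E k\<in>{..<n}. UNIV) \<noteq> \<infinity>" for i :: nat
      using d1 by (simp add: emeasure_distr)
    fix B :: "nat \<Rightarrow> real set" assume "\<And>k. k \<in> {..<n} \<Longrightarrow> B k \<in> sets borel"
    then have B: "\<And>k. k < n \<Longrightarrow> B k \<in> sets borel" by simp
    let ?i1 = "\<lambda>x. \<Prod>k<n. indicator (B k) (Y1 k x) :: complex"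
    let ?i2 = "\<lambda>x. \<Prod>k<n. indicator (B k) (Y2 k x) :: complex"
    have i1: "?i1 \<in> borel_measurable M1"
      using Y1 B by (intro borel_measurable_prod) (auto intro!: measurable_compose[OF Y1])
    have i2: "?i2 \<in> borel_measurable M2"
      using Y2 B by (intro borel_measurable_prod) (auto intro!: measurable_compose[OF Y2])
    have b: "norm (\<Prod>k<n. indicator (B k) (f k) :: complex) \<le> 1" for f
      by (auto simp: prod_norm[symmetric] indicator_def intro!: prod_le_1)
    have "0 = (\<integral>w. h w * (\<Prod>k<n. indicator (B k) (Y k w)) \<partial>?N)"
      by (rule sym, rule integral_rectangle_eq_0_of_char[OF h_int Y_meas char0 B])
    also have "\<dots> = (\<integral>w. (if fst w then ?i1 (fst (snd w)) else - ?i2 (snd (snd w))) \<partial>?N)"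
      by (intro Bochner_Integration.integral_cong) (auto simp: h_def Y_def)
    also have "\<dots> = ((\<integral>x. ?i1 x \<partial>M1) - (\<integral>x. ?i2 x \<partial>M2)) / 2"
      by (rule integral_bernoulli_pair[OF assms(1,2) i1 b i2 b])
    finally have eq: "(\<integral>x. ?i1 x \<partial>M1) = (\<integral>x. ?i2 x \<partial>M2)" by simp
    let ?R = "\<Pi>\<^sub>E k\<in>{..<n}. B k"
    have R: "?R \<in> sets (PiM {..<n} (\<lambda>_. borel))" using B by (intro sets_PiM_I_finite) auto
    have "(\<integral>x. ?i1 x \<partial>M1) = of_real (measure ?D1 ?R)"
    proof -
      have "?i1 x = of_real (indicator ((\<lambda>x. \<lambda>k\<in>{..<n}. Y1 k x) -` ?R) x)" for x
        by (auto simp: indicator_def Pi_iff intro!: prod.neutral)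
      then show ?thesis using d1 R by (simp add: measure_distr)
    qed
    moreover have "(\<integral>x. ?i2 x \<partial>M2) = of_real (measure ?D2 ?R)"
    proof -
      have "?i2 x = of_real (indicator ((\<lambda>x. \<lambda>k\<in>{..<n}. Y2 k x) -` ?R) x)" for x
        by (auto simp: indicator_def Pi_iff intro!: prod.neutral)
      then show ?thesis using d1 R by (simp add: measure_distr)
    qed
    moreover have "finite_measure ?D1" "finite_measure ?D2"
      using d1 by (auto intro!: prob_space.finite_measure M1.prob_space_distr M2.prob_space_distr)
    ultimately show "emeasure ?D1 ?R = emeasure ?D2 ?R"
      using eq by (simp add: finite_measure.emeasure_eq_measure)
  qed (auto simp: space_PiM)
qed

text \<open>Both sides are entire functions of \<open>z\<close> that agree on the imaginary axis.\<close>

lemma integral_exp_of_char: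
  fixes h :: "'a \<Rightarrow> complex" and Y :: "'a \<Rightarrow> real" and F :: "complex \<Rightarrow> complex"
  assumes [measurable]: "h \<in> borel_measurable M" "Y \<in> borel_measurable M"
    and int: "\<And>c. integrable M (\<lambda>x. norm (h x) * exp (c * \<bar>Y x\<bar>))"
    and F: "F holomorphic_on UNIV"
    and char: "\<And>t. (\<integral>x. h x * iexp (t * Y x) \<partial>M) = F (\<i> * of_real t)"
  shows "(\<integral>x. h x * exp (z * of_real (Y x)) \<partial>M) = F z"
proof -
  define G where "G z = (\<integral>x. h x * exp (z * of_real (Y x)) \<partial>M)" for z
  \<comment> \<open>These are the Taylor coefficients of \<open>G\<close> at 0. Since
    \<open>int\<close> holds for every constant, dominated convergence makes the series represent
    \<open>G\<close> on the whole plane.\<close>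
  define c where "c n = (\<integral>x. h x * (of_real (Y x) ^ n / fact n) \<partial>M)" for n
  have bound: "norm (\<Sum>k<n. w ^ k / fact k :: complex) \<le> exp (norm w)" for n and w :: complex
  proof -
    have "norm (\<Sum>k<n. w ^ k / fact k :: complex) \<le> (\<Sum>k<n. norm w ^ k / fact k)"
      by (intro sum_norm_le) (simp add: norm_divide norm_power)
    also have "\<dots> \<le> (\<Sum>k. norm w ^ k / fact k)"
      using summable_exp_generic[of "norm w"]
      by (intro sum_le_suminf) (auto simp: scaleR_conv_of_real field_simps)
    also have "\<dots> = exp (norm w)" by (simp add: exp_def scaleR_conv_of_real field_simps)
    finally show ?thesis .
  qed
  have term_int: "integrable M (\<lambda>x. h x * (of_real (Y x) ^ n / fact n))" for n
  proof (rule Bochner_Integration.integrable_bound[OF int[of 1]])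
    have "\<bar>Y x\<bar> ^ n / fact n \<le> exp \<bar>Y x\<bar>" for x
    proof -
      have "\<bar>Y x\<bar> ^ n / fact n \<le> (\<Sum>k. \<bar>Y x\<bar> ^ k / fact k)"
        using summable_exp_generic[of "\<bar>Y x\<bar>"] sum_le_suminf[of "\<lambda>k. \<bar>Y x\<bar> ^ k / fact k" "{n}"]
        by (auto simp: scaleR_conv_of_real field_simps)
      also have "\<dots> = exp \<bar>Y x\<bar>" by (simp add: exp_def scaleR_conv_of_real field_simps)
      finally show ?thesis .
    qed
    then have "norm (h x) * (\<bar>Y x\<bar> ^ n / fact n) \<le> norm (h x) * exp \<bar>Y x\<bar>" for x
      by (intro mult_left_mono) auto
    then show "AE x in M. norm (h x * (of_real (Y x) ^ n / fact n)) \<le> norm (norm (h x) * exp (1 * \<bar>Y x\<bar>))"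
      by (auto simp: norm_mult norm_divide norm_power)
  qed simp
  have sums: "(\<lambda>n. c n * z ^ n) sums G z" for z
    unfolding sums_def
  proof -
    have "(\<lambda>n. \<integral>x. h x * (\<Sum>k<n. (z * of_real (Y x)) ^ k / fact k) \<partial>M) \<longlonglongrightarrow> G z"
      unfolding G_def
    proof (rule integral_dominated_convergence[OF _ _ int[of "norm z"]])
      have "(\<lambda>n. \<Sum>k<n. w ^ k / fact k) \<longlonglongrightarrow> exp w" for w :: complex
        using exp_converges[of w] by (simp add: sums_def scaleR_conv_of_real field_simps)
      then show "AE x in M. (\<lambda>n. h x * (\<Sum>k<n. (z * of_real (Y x)) ^ k / fact k)) \<longlonglongrightarrow>
          h x * exp (z * of_real (Y x))"
        by (auto intro!: tendsto_mult_left)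
      show "AE x in M. norm (h x * (\<Sum>k<n. (z * of_real (Y x)) ^ k / fact k))
          \<le> norm (h x) * exp (norm z * \<bar>Y x\<bar>)" for n
        using bound[of "z * of_real (Y _)" n]
        by (auto simp: norm_mult intro!: mult_left_mono)
    qed measurable
    also have "(\<lambda>n. \<integral>x. h x * (\<Sum>k<n. (z * of_real (Y x)) ^ k / fact k) \<partial>M) = (\<lambda>n. \<Sum>k<n. c k * z ^ k)"
    proof
      fix n
      have "(\<integral>x. h x * (\<Sum>k<n. (z * of_real (Y x)) ^ k / fact k) \<partial>M) =
        (\<integral>x. (\<Sum>k<n. h x * (of_real (Y x) ^ k / fact k) * z ^ k) \<partial>M)"
        by (intro Bochner_Integration.integral_cong)
           (auto simp: sum_distrib_left power_mult_distrib intro!: sum.cong)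
      also have "\<dots> = (\<Sum>k<n. c k * z ^ k)"
        unfolding c_def by (subst Bochner_Integration.integral_sum[OF integrable_mult_left[OF term_int]]) simp
      finally show "(\<integral>x. h x * (\<Sum>k<n. (z * of_real (Y x)) ^ k / fact k) \<partial>M) = (\<Sum>k<n. c k * z ^ k)" .
    qed
    finally show "(\<lambda>n. \<Sum>k<n. c k * z ^ k) \<longlonglongrightarrow> G z" .
  qed
  have "G holomorphic_on UNIV"
  proof (subst holomorphic_on_open, simp, intro ballI)
    \<comment> \<open>A power series is known to be holomorphic on balls, so a ball around 0 that
      contains \<open>z\<close> is chosen.\<close>
    fix z :: complex
    have "G holomorphic_on ball 0 (norm z + 1)"
      using sums by (intro power_series_holomorphic[where a = c]) simp
    then show "\<exists>f'. (G has_field_derivative f') (at z)"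
      by (subst (asm) holomorphic_on_open) auto
  qed
  then have "(\<lambda>z. G z - F z) holomorphic_on UNIV" by (intro holomorphic_intros F)
  then have "G z - F z = 0"
  proof (rule analytic_continuation)
    show "(0::complex) islimpt range (\<lambda>t. \<i> * of_real t)"
      unfolding islimpt_approachable
    proof (intro allI impI)
      fix e :: real assume "0 < e"
      then show "\<exists>x'\<in>range (\<lambda>t. \<i> * of_real t). x' \<noteq> 0 \<and> dist x' 0 < e"
        by (intro bexI[OF _ rangeI[of _ "e / 2"]]) (auto simp: norm_mult)
    qed
    show "G w - F w = 0" if "w \<in> range (\<lambda>t. \<i> * of_real t)" for w
      using that char by (auto simp: G_def mult.assoc)
  qed auto
  then show ?thesis by (simp add: G_def)
qed

section \<open>Convergence in \<open>L\<^sup>p\<close>\<close>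

text \<open>Replacing both summands by the larger one avoids convexity and therefore covers
  exponents below 1 as well.\<close>

lemma powr_add_le:
  fixes a b p :: real
  assumes "0 \<le> a" "0 \<le> b" "0 < p"
  shows "(a + b) powr p \<le> 2 powr p * (a powr p + b powr p)"
proof -
  have "(a + b) powr p \<le> (2 * max a b) powr p"
    using assms by (intro powr_mono2) auto
  also have "\<dots> = 2 powr p * max a b powr p" using assms by (simp add: powr_mult)
  also have "\<dots> \<le> 2 powr p * (a powr p + b powr p)"
    by (intro mult_left_mono) (auto simp: max_def)
  finally show ?thesis .
qed

lemma norm_powr_mult: "norm (a * b :: complex) powr p = norm a powr p * norm b powr p"
  by (simp add: norm_mult powr_mult)

lemma in_Lp_scale: "in_Lp p M f \<Longrightarrow> in_Lp p M (\<lambda>x. c * f x)"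
  by (auto simp: in_Lp_def norm_powr_mult)

lemma in_Lp_add:
  assumes "0 < p" "in_Lp p M f" "in_Lp p M g"
  shows "in_Lp p M (\<lambda>x. f x + g x)"
proof -
  have [measurable]: "f \<in> borel_measurable M" "g \<in> borel_measurable M"
    using assms by (auto simp: in_Lp_def)
  have "integrable M (\<lambda>x. norm (f x + g x) powr p)"
  proof (rule Bochner_Integration.integrable_bound)
    show "integrable M (\<lambda>x. 2 powr p * (norm (f x) powr p + norm (g x) powr p))"
      using assms by (auto simp: in_Lp_def)
    have "norm (f x + g x) powr p \<le> 2 powr p * (norm (f x) powr p + norm (g x) powr p)" for x
      using norm_triangle_ineq[of "f x" "g x"] powr_add_le[of "norm (f x)" "norm (g x)" p] assms(1)
      by (meson norm_ge_zero order_trans powr_mono2 less_imp_le)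
    then show "AE x in M. norm (norm (f x + g x) powr p)
        \<le> norm (2 powr p * (norm (f x) powr p + norm (g x) powr p))" by simp
  qed measurable
  then show ?thesis by (simp add: in_Lp_def)
qed

lemma in_Lp_diff:
  assumes "0 < p" "in_Lp p M f" "in_Lp p M g"
  shows "in_Lp p M (\<lambda>x. f x - g x)"
  using in_Lp_add[OF assms(1,2) in_Lp_scale[OF assms(3), of "- 1"]] by simp

lemma in_Lp_cong:
  assumes "\<And>x. x \<in> space M \<Longrightarrow> f x = g x"
  shows "in_Lp p M f \<longleftrightarrow> in_Lp p M g"
  unfolding in_Lp_def using assms
  by (intro conj_cong measurable_cong Bochner_Integration.integrable_cong) auto

lemma Lp_tendsto_cong:
  assumes "\<And>i x. x \<in> space M \<Longrightarrow> F i x = G i x" "\<And>x. x \<in> space M \<Longrightarrow> f x = g x"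
  shows "Lp_tendsto p M F f flt \<longleftrightarrow> Lp_tendsto p M G g flt"
proof -
  have "in_Lp p M f = in_Lp p M g" "in_Lp p M (F i) = in_Lp p M (G i)" for i
    using assms by (auto intro!: in_Lp_cong)
  moreover have "(\<integral>x. norm (F i x - f x) powr p \<partial>M) = (\<integral>x. norm (G i x - g x) powr p \<partial>M)" for i
    using assms by (intro Bochner_Integration.integral_cong) auto
  ultimately show ?thesis by (simp add: Lp_tendsto_def)
qed

lemma Lp_tendsto_boundedI:
  assumes "in_Lp p M f" "\<forall>\<^sub>F i in flt. in_Lp p M (F i)"
    and "\<forall>\<^sub>F i in flt. (\<integral>x. norm (F i x - f x) powr p \<partial>M) \<le> b i"
    and "(b \<longlongrightarrow> 0) flt"
  shows "Lp_tendsto p M F f flt"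
  unfolding Lp_tendsto_def
proof (intro conjI assms)
  show "((\<lambda>i. \<integral>x. norm (F i x - f x) powr p \<partial>M) \<longlongrightarrow> 0) flt"
    by (rule tendsto_sandwich[OF _ assms(3) tendsto_const assms(4)]) simp
qed

lemma Lp_tendsto_add:
  assumes p: "0 < p" and F: "Lp_tendsto p M F f flt" and G: "Lp_tendsto p M G g flt"
  shows "Lp_tendsto p M (\<lambda>i x. F i x + G i x) (\<lambda>x. f x + g x) flt"
proof (rule Lp_tendsto_boundedI)
  show "in_Lp p M (\<lambda>x. f x + g x)" using assms by (auto simp: Lp_tendsto_def intro: in_Lp_add)
  have ev: "\<forall>\<^sub>F i in flt. in_Lp p M (F i) \<and> in_Lp p M (G i)"
    using F G by (auto simp: Lp_tendsto_def eventually_conj)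
  then show "\<forall>\<^sub>F i in flt. in_Lp p M (\<lambda>x. F i x + G i x)"
    by eventually_elim (auto intro: in_Lp_add p)
  show "\<forall>\<^sub>F i in flt. (\<integral>x. norm (F i x + G i x - (f x + g x)) powr p \<partial>M) \<le>
    2 powr p * ((\<integral>x. norm (F i x - f x) powr p \<partial>M) + (\<integral>x. norm (G i x - g x) powr p \<partial>M))"
    using ev
  proof eventually_elim
    case (elim i)
    have d: "in_Lp p M (\<lambda>x. F i x - f x)" "in_Lp p M (\<lambda>x. G i x - g x)"
      using elim F G p by (auto simp: Lp_tendsto_def intro!: in_Lp_diff)
    have e: "F i x + G i x - (f x + g x) = (F i x - f x) + (G i x - g x)" for x by simp
    have "(\<integral>x. norm (F i x + G i x - (f x + g x)) powr p \<partial>M) \<le>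
      (\<integral>x. 2 powr p * (norm (F i x - f x) powr p + norm (G i x - g x) powr p) \<partial>M)"
      unfolding e
    proof (rule integral_mono)
      show "integrable M (\<lambda>x. norm ((F i x - f x) + (G i x - g x)) powr p)"
        using in_Lp_add[OF p d] by (simp add: in_Lp_def)
      show "integrable M (\<lambda>x. 2 powr p * (norm (F i x - f x) powr p + norm (G i x - g x) powr p))"
        using d by (auto simp: in_Lp_def)
      show "norm ((F i x - f x) + (G i x - g x)) powr p
        \<le> 2 powr p * (norm (F i x - f x) powr p + norm (G i x - g x) powr p)" for x
        using powr_add_le[of "norm (F i x - f x)" "norm (G i x - g x)" p] p
          norm_triangle_ineq[of "F i x - f x" "G i x - g x"]
        by (meson norm_ge_zero order_trans powr_mono2 less_imp_le)
    qed
    also have "\<dots> = 2 powr p * ((\<integral>x. norm (F i x - f x) powr p \<partial>M) + (\<integral>x. norm (G i x - g x) powr p \<partial>M))"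
      using d by (simp add: in_Lp_def)
    finally show ?case .
  qed
  show "((\<lambda>i. 2 powr p * ((\<integral>x. norm (F i x - f x) powr p \<partial>M) + (\<integral>x. norm (G i x - g x) powr p \<partial>M))) \<longlongrightarrow> 0) flt"
    using F G by (auto simp: Lp_tendsto_def intro!: tendsto_eq_intros)
qed

lemma Lp_tendsto_const:
  assumes "in_Lp p M f"
  shows "Lp_tendsto p M (\<lambda>i. f) f flt"
  using assms by (simp add: Lp_tendsto_def)

lemma Lp_tendsto_mult_const:
  assumes F: "Lp_tendsto p M F f flt"
  shows "Lp_tendsto p M (\<lambda>i x. c * F i x) (\<lambda>x. c * f x) flt"
  unfolding Lp_tendsto_def
proof (intro conjI)
  show "in_Lp p M (\<lambda>x. c * f x)" using F by (auto simp: Lp_tendsto_def intro: in_Lp_scale)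
  show "\<forall>\<^sub>F i in flt. in_Lp p M (\<lambda>x. c * F i x)"
    using F by (auto simp: Lp_tendsto_def intro: in_Lp_scale elim: eventually_mono)
  have "c * F i x - c * f x = c * (F i x - f x)" for i x by (simp add: algebra_simps)
  then have "(\<integral>x. norm (c * F i x - c * f x) powr p \<partial>M) =
      norm c powr p * (\<integral>x. norm (F i x - f x) powr p \<partial>M)" for i
    by (simp add: norm_powr_mult)
  then show "((\<lambda>i. \<integral>x. norm (c * F i x - c * f x) powr p \<partial>M) \<longlongrightarrow> 0) flt"
    using F by (auto simp: Lp_tendsto_def intro!: tendsto_eq_intros)
qed

text \<open>The coefficient may vary with the index. This serves exponentials of partial sums of the
  bilinear form as well as the \<epsilon>-dependent coefficients of the regularised product.\<close>

lemma Lp_tendsto_mult_coeff: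
  assumes p: "0 < p" and F: "Lp_tendsto p M F f flt" and a: "(a \<longlongrightarrow> c) flt"
  shows "Lp_tendsto p M (\<lambda>i x. a i * F i x) (\<lambda>x. c * f x) flt"
proof (rule Lp_tendsto_boundedI)
  show "in_Lp p M (\<lambda>x. c * f x)" using F by (auto simp: Lp_tendsto_def intro: in_Lp_scale)
  show ev: "\<forall>\<^sub>F i in flt. in_Lp p M (\<lambda>x. a i * F i x)"
    using F by (auto simp: Lp_tendsto_def intro: in_Lp_scale elim: eventually_mono)
  have ev: "\<forall>\<^sub>F i in flt. in_Lp p M (F i)" using F by (simp add: Lp_tendsto_def)
  have f: "in_Lp p M f" using F by (simp add: Lp_tendsto_def)
  let ?b = "\<lambda>i. 2 powr p * (norm (a i) powr p * (\<integral>x. norm (F i x - f x) powr p \<partial>M)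
      + norm (a i - c) powr p * (\<integral>x. norm (f x) powr p \<partial>M))"
  show "\<forall>\<^sub>F i in flt. (\<integral>x. norm (a i * F i x - c * f x) powr p \<partial>M) \<le> ?b i"
    using ev
  proof eventually_elim
    case (elim i)
    have d: "in_Lp p M (\<lambda>x. a i * (F i x - f x))" "in_Lp p M (\<lambda>x. (a i - c) * f x)"
      using elim f p by (auto intro!: in_Lp_diff in_Lp_scale)
    have e: "a i * F i x - c * f x = a i * (F i x - f x) + (a i - c) * f x" for x
      by (simp add: algebra_simps)
    have "(\<integral>x. norm (a i * F i x - c * f x) powr p \<partial>M) \<le>
      (\<integral>x. 2 powr p * (norm (a i * (F i x - f x)) powr p + norm ((a i - c) * f x) powr p) \<partial>M)"
      unfolding e
    proof (rule integral_mono)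
      show "integrable M (\<lambda>x. norm (a i * (F i x - f x) + (a i - c) * f x) powr p)"
        using in_Lp_add[OF p d] by (simp add: in_Lp_def)
      show "integrable M (\<lambda>x. 2 powr p * (norm (a i * (F i x - f x)) powr p + norm ((a i - c) * f x) powr p))"
        using d by (auto simp: in_Lp_def)
      show "norm (a i * (F i x - f x) + (a i - c) * f x) powr p
        \<le> 2 powr p * (norm (a i * (F i x - f x)) powr p + norm ((a i - c) * f x) powr p)" for x
        using powr_add_le[of "norm (a i * (F i x - f x))" "norm ((a i - c) * f x)" p] p
          norm_triangle_ineq[of "a i * (F i x - f x)" "(a i - c) * f x"]
        by (meson norm_ge_zero order_trans powr_mono2 less_imp_le)
    qed
    also have "\<dots> = 2 powr p * ((\<integral>x. norm (a i * (F i x - f x)) powr p \<partial>M) +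
        (\<integral>x. norm ((a i - c) * f x) powr p \<partial>M))"
      using d by (simp add: in_Lp_def)
    also have "\<dots> = ?b i" by (simp add: norm_powr_mult)
    finally show ?case .
  qed
  have "((\<lambda>i. norm (a i - c) powr p) \<longlongrightarrow> 0) flt"
    using tendsto_zero_powrI[OF tendsto_norm_zero[OF LIM_zero[OF a]] tendsto_const[of p]] p by simp
  moreover have "((\<lambda>i. norm (a i) powr p) \<longlongrightarrow> norm c powr p) flt"
    using p by (intro tendsto_powr' tendsto_norm a tendsto_const) auto
  moreover have "((\<lambda>i. \<integral>x. norm (F i x - f x) powr p \<partial>M) \<longlongrightarrow> 0) flt"
    using F by (simp add: Lp_tendsto_def)
  ultimately have "(?b \<longlongrightarrow> 2 powr p * (norm c powr p * 0 + 0 * (\<integral>x. norm (f x) powr p \<partial>M))) flt"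
    by (intro tendsto_mult tendsto_add tendsto_const)
  then show "(?b \<longlongrightarrow> 0) flt" by simp
qed

lemma Lp_tendsto_sum:
  assumes p: "0 < p" and "finite I" and F: "\<And>j. j \<in> I \<Longrightarrow> Lp_tendsto p M (F j) (f j) flt"
  shows "Lp_tendsto p M (\<lambda>i x. \<Sum>j\<in>I. F j i x) (\<lambda>x. \<Sum>j\<in>I. f j x) flt"
  using assms(2) F
proof (induction I rule: finite_induct)
  case empty
  then show ?case using p by (simp add: Lp_tendsto_def in_Lp_def)
next
  case (insert j I)
  then show ?case by (simp add: Lp_tendsto_add p)
qed

lemma in_L2_iff: "in_Lp 2 M f \<longleftrightarrow> f \<in> borel_measurable M \<and> integrable M (\<lambda>x. (norm (f x))\<^sup>2)"
  by (simp add: in_Lp_def powr_numeral)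

lemma integrable_mult_L2:
  assumes f: "in_Lp 2 M f" and g: "in_Lp 2 M g"
  shows "integrable M (\<lambda>x. f x * g x)"
proof (rule Bochner_Integration.integrable_bound)
  have [measurable]: "f \<in> borel_measurable M" "g \<in> borel_measurable M"
    using f g by (auto simp: in_L2_iff)
  show "integrable M (\<lambda>x. (norm (f x))\<^sup>2 + (norm (g x))\<^sup>2)" using f g by (auto simp: in_L2_iff)
  show "(\<lambda>x. f x * g x) \<in> borel_measurable M" by measurable
  have "a * b \<le> a\<^sup>2 + b\<^sup>2" if "0 \<le> a" "0 \<le> b" for a b :: real
    using sum_squares_bound[of a b] that mult_nonneg_nonneg[OF that] by linarith
  then show "AE x in M. norm (f x * g x) \<le> norm ((norm (f x))\<^sup>2 + (norm (g x))\<^sup>2)"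
    by (auto simp: norm_mult)
qed

text \<open>Strong convergence in L2 implies weak convergence. The weighted inequality
  \<open>a * b \<le> (a\<^sup>2 / d + d * b\<^sup>2) / 2\<close> takes the place of
  Cauchy-Schwarz.\<close>

lemma Lp_tendsto_integral_mult:
  assumes F: "Lp_tendsto 2 M F f flt" and g: "in_Lp 2 M g"
  shows "((\<lambda>i. \<integral>x. F i x * g x \<partial>M) \<longlongrightarrow> (\<integral>x. f x * g x \<partial>M)) flt"
proof (rule tendstoI)
  fix e :: real assume e: "0 < e"
  have f: "in_Lp 2 M f" using F by (simp add: Lp_tendsto_def)
  define G where "G = (\<integral>x. (norm (g x))\<^sup>2 \<partial>M)"
  have G: "0 \<le> G" by (simp add: G_def)
  \<comment> \<open>This weight gives \<open>d * G < e\<close> even for \<open>G = 0\<close>. A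
    squared distance below \<open>d * e\<close> then makes both summands of the bound smaller than
    \<open>e\<close>.\<close>
  define d where "d = e / (G + 1)"
  have d: "0 < d" using e G by (simp add: d_def)
  have dG: "d * G < e"
    using e G by (simp add: d_def field_simps)
  have "((\<lambda>i. \<integral>x. norm (F i x - f x) powr 2 \<partial>M) \<longlongrightarrow> 0) flt" using F by (simp add: Lp_tendsto_def)
  then have "\<forall>\<^sub>F i in flt. (\<integral>x. norm (F i x - f x) powr 2 \<partial>M) < d * e"
    by (rule order_tendstoD) (use d e in simp)
  moreover have "\<forall>\<^sub>F i in flt. in_Lp 2 M (F i)" using F by (simp add: Lp_tendsto_def)
  ultimately show "\<forall>\<^sub>F i in flt. dist (\<integral>x. F i x * g x \<partial>M) (\<integral>x. f x * g x \<partial>M) < e"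
  proof eventually_elim
    case (elim i)
    have D: "in_Lp 2 M (\<lambda>x. F i x - f x)" using elim f by (intro in_Lp_diff) auto
    have "(\<integral>x. F i x * g x \<partial>M) - (\<integral>x. f x * g x \<partial>M) = (\<integral>x. (F i x - f x) * g x \<partial>M)"
      using integrable_mult_L2[OF f g] integrable_mult_L2[OF elim(2) g] by (simp add: left_diff_distrib)
    then have "dist (\<integral>x. F i x * g x \<partial>M) (\<integral>x. f x * g x \<partial>M) \<le> (\<integral>x. norm ((F i x - f x) * g x) \<partial>M)"
      by (simp add: dist_norm)
    also have "\<dots> \<le> (\<integral>x. ((norm (F i x - f x))\<^sup>2 / d + d * (norm (g x))\<^sup>2) / 2 \<partial>M)"
    proof (rule integral_mono)
      show "integrable M (\<lambda>x. norm ((F i x - f x) * g x))" using integrable_mult_L2[OF D g] by simp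
      show "integrable M (\<lambda>x. ((norm (F i x - f x))\<^sup>2 / d + d * (norm (g x))\<^sup>2) / 2)"
        using D g by (auto simp: in_L2_iff)
      have "a * b \<le> (a\<^sup>2 / d + d * b\<^sup>2) / 2" for a b
      proof -
        have "0 \<le> (a - d * b)\<^sup>2 / (2 * d)" using d by simp
        also have "\<dots> = (a\<^sup>2 / d + d * b\<^sup>2) / 2 - a * b"
          using d by (simp add: power2_eq_square field_simps)
        finally show ?thesis by simp
      qed
      then show "norm ((F i x - f x) * g x) \<le> ((norm (F i x - f x))\<^sup>2 / d + d * (norm (g x))\<^sup>2) / 2" for x
        by (simp add: norm_mult)
    qed
    also have "\<dots> = ((\<integral>x. (norm (F i x - f x))\<^sup>2 \<partial>M) / d + d * G) / 2"
      using D g by (simp add: in_L2_iff G_def)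
    also have "\<dots> < (e + e) / 2"
      using elim(1) dG d by (intro divide_strict_right_mono add_strict_mono)
        (auto simp: powr_numeral field_simps)
    finally show ?case by simp
  qed
qed

section \<open>Diagonal operators and the test space\<close>

locale white_noise_setup =
  fixes W :: "'e::{real_inner, polish_space} white_noise"
  assumes white_noise: "white_noise_space W"
begin

abbreviation "e \<equiv> basis W"
abbreviation "D \<equiv> domA W"
abbreviation "A \<equiv> opA W"
abbreviation "lev \<equiv> eigval W"
abbreviation "\<E> \<equiv> test_space W"
abbreviation "\<mu> \<equiv> gauss W"

lemma inner_basis: "inner (e m) (e n) = (if m = n then 1 else 0)"
  using white_noise by (simp add: white_noise_space_def orthonormal_basis_def)

lemma closure_span_basis: "closure (span (range e)) = UNIV"
  using white_noise by (simp add: white_noise_space_def orthonormal_basis_def)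

definition proj :: "nat \<Rightarrow> 'e \<Rightarrow> 'e" where
  "proj N f = (\<Sum>n<N. inner f (e n) *\<^sub>R e n)"

lemma inner_sum_basis: "finite I \<Longrightarrow> inner (\<Sum>k\<in>I. c k *\<^sub>R e k) (e n) = (if n \<in> I then c n else 0)"
  by (simp add: inner_sum_left inner_basis if_distrib[of "\<lambda>x. _ * x"] cong: if_cong)

lemma norm_sum_basis: "finite I \<Longrightarrow> (norm (\<Sum>k\<in>I. c k *\<^sub>R e k))\<^sup>2 = (\<Sum>k\<in>I. (c k)\<^sup>2)"
  unfolding power2_norm_eq_inner by (simp add: inner_sum_right inner_sum_basis power2_eq_square)

lemma inner_proj_basis: "inner (proj N f) (e n) = (if n < N then inner f (e n) else 0)"
  by (simp add: proj_def inner_sum_basis)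

lemma inner_proj: "inner (proj N f) g = (\<Sum>n<N. inner f (e n) * inner g (e n))"
  by (simp add: proj_def inner_sum_left inner_commute[of g])

lemma linear_proj: "linear (proj N)"
  by (rule linearI)
     (simp_all add: proj_def inner_add_left scaleR_add_left sum.distrib scaleR_sum_right)

lemma norm_diff_proj_le: "norm (f - proj N f) \<le> norm f"
proof -
  have "inner (proj N f) (proj N f) = inner (proj N f) f"
    by (simp add: inner_proj[of N f f] inner_proj[of N f "proj N f"] inner_proj_basis)
  then have "(norm (f - proj N f))\<^sup>2 = (norm f)\<^sup>2 - (norm (proj N f))\<^sup>2"
    by (simp add: power2_norm_eq_inner inner_diff_left inner_diff_right inner_commute)
  then have "(norm (f - proj N f))\<^sup>2 \<le> (norm f)\<^sup>2"
    using zero_le_power2[of "norm (proj N f)"] by linarith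
  then show ?thesis by (rule power2_le_imp_le) (rule norm_ge_zero)
qed

lemma proj_span_eventually:
  assumes "g \<in> span (range e)"
  shows "\<exists>M. \<forall>N\<ge>M. proj N g = g"
  using assms
proof (induction rule: span_induct)
  case base
  interpret linear "proj N" for N by (rule linear_proj)
  show ?case
    unfolding subspace_def
  proof (intro conjI ballI allI)
    show "0 \<in> {g. \<exists>M. \<forall>N\<ge>M. proj N g = g}" using zero by auto
    fix x y c assume x: "x \<in> {g. \<exists>M. \<forall>N\<ge>M. proj N g = g}"
    then show "c *\<^sub>R x \<in> {g. \<exists>M. \<forall>N\<ge>M. proj N g = g}" by (auto simp: scale)
    assume "y \<in> {g. \<exists>M. \<forall>N\<ge>M. proj N g = g}"
    with x obtain M1 M2 where "\<forall>N\<ge>M1. proj N x = x" "\<forall>N\<ge>M2. proj N y = y" by auto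
    then have "\<forall>N\<ge>max M1 M2. proj N (x + y) = x + y" by (auto simp: add)
    then show "x + y \<in> {g. \<exists>M. \<forall>N\<ge>M. proj N g = g}" by blast
  qed
next
  case (step x)
  then obtain n where x: "x = e n" by auto
  have "proj N (e n) = e n" if "Suc n \<le> N" for N
    using that by (simp add: proj_def inner_basis if_distrib[of "\<lambda>c. c *\<^sub>R _"] cong: if_cong)
  then show ?case unfolding x by blast
qed

text \<open>On the dense span the projections are eventually the identity, and
  \<open>f - proj N f\<close> depends on \<open>f\<close> with norm at most 1 uniformly in
  \<open>N\<close>, so convergence passes to the closure.\<close>

lemma proj_tendsto: "(\<lambda>N. proj N f) \<longlonglongrightarrow> f"
proof (rule LIMSEQ_I)
  fix r :: real assume "0 < r"
  then obtain g where g: "g \<in> span (range e)" "dist g f < r"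
    using closure_span_basis closure_approachable[of f "span (range e)"] by auto
  obtain M where M: "\<And>N. N \<ge> M \<Longrightarrow> proj N g = g" using proj_span_eventually[OF g(1)] by auto
  have "norm (proj N f - f) < r" if "N \<ge> M" for N
  proof -
    interpret linear "proj N" by (rule linear_proj)
    have "proj N f - f = - ((f - g) - proj N (f - g))"
      using M[OF that] by (simp add: diff)
    then have "norm (proj N f - f) = norm ((f - g) - proj N (f - g))" by (metis norm_minus_cancel)
    then have "norm (proj N f - f) \<le> norm (f - g)"
      using norm_diff_proj_le[of "f - g" N] by simp
    then show ?thesis using g(2) by (simp add: dist_norm norm_minus_commute)
  qed
  then show "\<exists>M. \<forall>N\<ge>M. norm (proj N f - f) < r" by blast
qed

lemma parseval: "(\<lambda>N. \<Sum>n<N. inner f (e n) * inner g (e n)) \<longlonglongrightarrow> inner f g"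
  unfolding inner_proj[symmetric] by (intro tendsto_inner proj_tendsto tendsto_const)

lemma vector_eq_iff_coeff: "f = g \<longleftrightarrow> (\<forall>n. inner f (e n) = inner g (e n))"
proof
  assume "\<forall>n. inner f (e n) = inner g (e n)"
  then have "proj N f = proj N g" for N by (simp add: proj_def)
  then show "f = g" using proj_tendsto[of f] proj_tendsto[of g] LIMSEQ_unique by auto
qed simp

lemma inner_eq_if_coeff:
  assumes "\<And>n. inner f (e n) * inner g (e n) = inner f' (e n) * inner g' (e n)"
  shows "inner f g = inner f' g'"
  using parseval[of f g] parseval[of f' g'] LIMSEQ_unique by (auto simp: assms)

lemma diagonal_coeff:
  assumes "diagonal_op W B b"
  shows "inner (B f) (e n) = b n * inner f (e n)"
proof -
  interpret bounded_linear B using assms by (simp add: diagonal_op_def)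
  have B: "B (e n) = b n *\<^sub>R e n" for n using assms by (simp add: diagonal_op_def)
  have "(\<lambda>N. inner (B (proj N f)) (e n)) \<longlonglongrightarrow> inner (B f) (e n)"
    by (intro tendsto_inner tendsto_const tendsto proj_tendsto)
  moreover have "inner (B (proj N f)) (e n) = b n * inner f (e n)" if "n < N" for N
    using that inner_sum_basis[of "{..<N}" "\<lambda>k. inner f (e k) * b k" n]
    by (simp add: proj_def sum scale B mult_ac)
  then have "(\<lambda>N. inner (B (proj N f)) (e n)) \<longlonglongrightarrow> b n * inner f (e n)"
    by (intro tendsto_eventually eventually_sequentiallyI[of "Suc n"]) auto
  ultimately show ?thesis by (rule LIMSEQ_unique)
qed

text \<open>Supplies the square root of \<open>T\<close> and the projection onto its kernel, which
  are given by eigenvalues only. The partial sums are Cauchy because blocks of them are dominated by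
  \<open>K\<close> times the corresponding blocks of the expansion of \<open>f\<close>.\<close>

lemma diagonal_op_exists:
  assumes b: "\<And>n. \<bar>b n\<bar> \<le> K"
  shows "\<exists>B. diagonal_op W B b"
proof -
  define S where "S f N = (\<Sum>n<N. (b n * inner f (e n)) *\<^sub>R e n)" for f N
  have K: "0 \<le> K" using b[of 0] by simp
  have le: "norm (\<Sum>k\<in>I. (b k * c k) *\<^sub>R e k) \<le> K * norm (\<Sum>k\<in>I. c k *\<^sub>R e k)" if "finite I" for I c
  proof (rule power2_le_imp_le)
    have "(\<Sum>k\<in>I. (b k * c k)\<^sup>2) \<le> (\<Sum>k\<in>I. K\<^sup>2 * (c k)\<^sup>2)"
      using b by (intro sum_mono) (auto simp: power_mult_distrib abs_le_square_iff[symmetric] K intro!: mult_right_mono)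
    then show "(norm (\<Sum>k\<in>I. (b k * c k) *\<^sub>R e k))\<^sup>2 \<le> (K * norm (\<Sum>k\<in>I. c k *\<^sub>R e k))\<^sup>2"
      using that by (simp add: norm_sum_basis power_mult_distrib sum_distrib_left)
  qed (use K in simp)
  have conv: "convergent (S f)" for f
  proof (rule Cauchy_convergent, rule CauchyI')
    fix r :: real assume r: "0 < r"
    have "Cauchy (\<lambda>N. proj N f)" using proj_tendsto LIMSEQ_imp_Cauchy by blast
    \<comment> \<open>\<open>K + 1\<close> instead of \<open>K\<close> keeps the divisor positive
      when \<open>K = 0\<close>.\<close>
    then obtain M where M: "\<And>m n. m \<ge> M \<Longrightarrow> n \<ge> M \<Longrightarrow> norm (proj m f - proj n f) < r / (K + 1)"
      using r K by (meson CauchyD add_nonneg_pos divide_pos_pos zero_less_one)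
    have "dist (S f m) (S f n) < r" if "m \<ge> M" "n > m" for m n
    proof -
      have split: "(\<Sum>k<n. h k) - (\<Sum>k<m. h k) = (\<Sum>k\<in>{m..<n}. h k)" for h :: "nat \<Rightarrow> 'e"
        using that by (simp add: sum_diff_nat_ivl lessThan_atLeast0)
      have "dist (S f m) (S f n) = norm (\<Sum>k\<in>{m..<n}. (b k * inner f (e k)) *\<^sub>R e k)"
        unfolding S_def dist_norm by (subst norm_minus_commute) (simp add: split)
      also have "\<dots> \<le> K * norm (\<Sum>k\<in>{m..<n}. inner f (e k) *\<^sub>R e k)" by (rule le) simp
      also have "\<dots> = K * norm (proj n f - proj m f)" by (simp add: proj_def split)
      also have "\<dots> \<le> K * (r / (K + 1))"
        using M[of n m] that K by (intro mult_left_mono) auto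
      also have "\<dots> < r" using r K by (simp add: field_simps)
      finally show ?thesis .
    qed
    then show "\<exists>M. \<forall>m\<ge>M. \<forall>n>m. dist (S f m) (S f n) < r" by blast
  qed
  define B where "B f = lim (S f)" for f
  have lim: "S f \<longlonglongrightarrow> B f" for f using conv by (simp add: B_def convergent_LIMSEQ_iff)
  have "bounded_linear B"
  proof (rule bounded_linear_intro)
    fix f g :: 'e and c :: real
    have "S (f + g) = (\<lambda>N. S f N + S g N)"
      by (simp add: fun_eq_iff S_def inner_add_left scaleR_add_left distrib_left sum.distrib)
    then show "B (f + g) = B f + B g"
      using tendsto_add[OF lim[of f] lim[of g]] lim[of "f + g"] LIMSEQ_unique by auto
    have "S (c *\<^sub>R f) = (\<lambda>N. c *\<^sub>R S f N)"
      by (simp add: fun_eq_iff S_def scaleR_sum_right mult_ac)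
    then show "B (c *\<^sub>R f) = c *\<^sub>R B f"
      using tendsto_scaleR[OF tendsto_const lim[of f], of c] lim[of "c *\<^sub>R f"] LIMSEQ_unique by auto
    have "norm (S f N) \<le> K * norm (proj N f)" for N
      unfolding S_def proj_def by (rule le) simp
    then show "norm (B f) \<le> norm f * K"
      using LIMSEQ_le[OF tendsto_norm[OF lim[of f]] tendsto_mult[OF tendsto_const tendsto_norm[OF proj_tendsto[of f]]]]
      by (auto simp: mult.commute)
  qed
  moreover have "B (e n) = b n *\<^sub>R e n" for n
  proof -
    have "S (e n) N = b n *\<^sub>R e n" if "n < N" for N
      using that by (simp add: S_def inner_basis if_distrib[of "\<lambda>c. (_ * c) *\<^sub>R _"] cong: if_cong)
    then have "S (e n) \<longlonglongrightarrow> b n *\<^sub>R e n"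
      by (intro tendsto_eventually eventually_sequentiallyI[of "Suc n"]) auto
    then show ?thesis using lim[of "e n"] LIMSEQ_unique by auto
  qed
  ultimately show ?thesis by (auto simp: diagonal_op_def)
qed

section \<open>Powers of \<open>A\<close> and the test space in coordinates\<close>

lemma self_adjoint_A: "self_adjoint D A"
  using white_noise by (simp add: white_noise_space_def)

lemma basis_in_D: "e n \<in> D" and A_basis: "A (e n) = lev n *\<^sub>R e n"
  using white_noise by (simp_all add: white_noise_space_def)

lemma A_graph: "(\<forall>f\<in>D. inner (A f) g = inner f h) \<longleftrightarrow> g \<in> D \<and> A g = h"
  using self_adjoint_A by (simp add: self_adjoint_def)

lemma A_coeff: "f \<in> D \<Longrightarrow> inner (A f) (e n) = lev n * inner f (e n)"
  using A_graph[of "e n" "lev n *\<^sub>R e n"] basis_in_D A_basis by auto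

text \<open>Here self-adjointness enters beyond symmetry: a vector with the right coefficients
  satisfies the graph condition of the adjoint, and this puts \<open>g\<close> into the domain of
  \<open>A\<close>.\<close>

lemma A_graph_coeff:
  assumes "\<And>n. inner h (e n) = lev n * inner g (e n)"
  shows "g \<in> D \<and> A g = h"
  unfolding A_graph[symmetric]
  by (intro ballI inner_eq_if_coeff) (simp add: A_coeff assms)

text \<open>Domain conditions on iterates of \<open>A\<close> become the existence of vectors with
  prescribed coefficients. Stability under sums and diagonal operators follows by applying the same
  operation to the witnesses.\<close>

lemma test_space_iff: "f \<in> \<E> \<longleftrightarrow> (\<forall>k. \<exists>h. \<forall>n. inner h (e n) = lev n ^ k * inner f (e n))"
proof
  assume f: "f \<in> \<E>"
  have "inner ((A ^^ k) f) (e n) = lev n ^ k * inner f (e n)" for k n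
  proof (induction k)
    case (Suc k)
    have "(A ^^ k) f \<in> D" using f by (auto simp: test_space_def E_k_def)
    then show ?case by (simp add: A_coeff Suc)
  qed simp
  then show "\<forall>k. \<exists>h. \<forall>n. inner h (e n) = lev n ^ k * inner f (e n)" by blast
next
  assume "\<forall>k. \<exists>h. \<forall>n. inner h (e n) = lev n ^ k * inner f (e n)"
  then obtain h where h: "\<And>k n. inner (h k) (e n) = lev n ^ k * inner f (e n)" by metis
  have hD: "h k \<in> D \<and> A (h k) = h (Suc k)" for k
    by (rule A_graph_coeff) (simp add: h)
  have "(A ^^ k) f = h k" for k
  proof (induction k)
    case 0
    then show ?case by (simp add: vector_eq_iff_coeff h)
  qed (simp add: hD)
  then show "f \<in> \<E>" using hD by (simp add: test_space_def E_k_def)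
qed

lemma subspace_test_space: "subspace \<E>"
proof (rule subspaceI)
  show "0 \<in> \<E>" by (auto simp: test_space_iff intro: exI[of _ 0])
  show "f + g \<in> \<E>" if fg: "f \<in> \<E>" "g \<in> \<E>" for f g
    unfolding test_space_iff
  proof
    fix k
    obtain h1 where "\<forall>n. inner h1 (e n) = lev n ^ k * inner f (e n)"
      using fg(1) unfolding test_space_iff by meson
    moreover obtain h2 where "\<forall>n. inner h2 (e n) = lev n ^ k * inner g (e n)"
      using fg(2) unfolding test_space_iff by meson
    ultimately show "\<exists>h. \<forall>n. inner h (e n) = lev n ^ k * inner (f + g) (e n)"
      by (intro exI[of _ "h1 + h2"]) (simp add: inner_add_left distrib_left)
  qed
  show "c *\<^sub>R f \<in> \<E>" if f: "f \<in> \<E>" for c f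
    unfolding test_space_iff
  proof
    fix k
    obtain h where "\<forall>n. inner h (e n) = lev n ^ k * inner f (e n)"
      using f unfolding test_space_iff by meson
    then show "\<exists>h. \<forall>n. inner h (e n) = lev n ^ k * inner (c *\<^sub>R f) (e n)"
      by (intro exI[of _ "c *\<^sub>R h"]) simp
  qed
qed

lemma diagonal_test_space:
  assumes B: "diagonal_op W B b" and "f \<in> \<E>"
  shows "B f \<in> \<E>"
  unfolding test_space_iff
proof
  fix k
  obtain h where "\<forall>n. inner h (e n) = lev n ^ k * inner f (e n)"
    using assms(2) unfolding test_space_iff by meson
  then show "\<exists>h. \<forall>n. inner h (e n) = lev n ^ k * inner (B f) (e n)"
    by (intro exI[of _ "B h"]) (simp add: diagonal_coeff[OF B])
qed

lemma basis_test_space: "e n \<in> \<E>"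
  unfolding test_space_iff
  by (intro allI, rule_tac x = "lev n ^ k *\<^sub>R e n" in exI) (simp add: inner_basis)

lemmas test_space_add = subspace_add[OF subspace_test_space]
lemmas test_space_scaleR = subspace_scale[OF subspace_test_space]
lemmas test_space_0 = subspace_0[OF subspace_test_space]
lemmas test_space_diff = subspace_diff[OF subspace_test_space]
lemmas test_space_sum = subspace_sum[OF subspace_test_space]

lemma proj_test_space: "proj N f \<in> \<E>"
  unfolding proj_def by (intro test_space_sum test_space_scaleR basis_test_space)

section \<open>Complex coordinates and the bilinear pairing\<close>

definition cf :: "'e \<times> 'e \<Rightarrow> nat \<Rightarrow> complex" where
  "cf \<xi> n = Complex (inner (fst \<xi>) (e n)) (inner (snd \<xi>) (e n))"

lemma cf_add: "cf (\<xi> + \<eta>) n = cf \<xi> n + cf \<eta> n"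
  by (simp add: cf_def inner_add_left complex_eq_iff)

lemma cf_diagonal: "diagonal_op W B b \<Longrightarrow> cf (map_prod B B \<xi>) n = of_real (b n) * cf \<xi> n"
  by (simp add: cf_def diagonal_coeff complex_eq_iff)

lemma cf_proj: "cf (map_prod (proj N) (proj N) \<xi>) n = (if n < N then cf \<xi> n else 0)"
  by (simp add: cf_def inner_proj_basis complex_eq_iff)

lemma cf_eq_iff: "\<xi> = \<eta> \<longleftrightarrow> (\<forall>n. cf \<xi> n = cf \<eta> n)"
  by (auto simp: cf_def prod_eq_iff vector_eq_iff_coeff[of "fst \<xi>"] vector_eq_iff_coeff[of "snd \<xi>"])

lemma cbilinear_parseval: "(\<lambda>N. \<Sum>n<N. cf \<xi> n * cf \<eta> n) \<longlonglongrightarrow> cbilinear \<xi> \<eta>"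
proof -
  have "(\<lambda>N. of_real ((\<Sum>n<N. inner (fst \<xi>) (e n) * inner (fst \<eta>) (e n)) - (\<Sum>n<N. inner (snd \<xi>) (e n) * inner (snd \<eta>) (e n)))
    + \<i> * of_real ((\<Sum>n<N. inner (fst \<xi>) (e n) * inner (snd \<eta>) (e n)) + (\<Sum>n<N. inner (snd \<xi>) (e n) * inner (fst \<eta>) (e n))))
     \<longlonglongrightarrow> cbilinear \<xi> \<eta>"
    unfolding cbilinear_def by (intro tendsto_intros parseval)
  also have "(\<lambda>N. of_real ((\<Sum>n<N. inner (fst \<xi>) (e n) * inner (fst \<eta>) (e n)) - (\<Sum>n<N. inner (snd \<xi>) (e n) * inner (snd \<eta>) (e n)))
    + \<i> * of_real ((\<Sum>n<N. inner (fst \<xi>) (e n) * inner (snd \<eta>) (e n)) + (\<Sum>n<N. inner (snd \<xi>) (e n) * inner (fst \<eta>) (e n))))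
     = (\<lambda>N. \<Sum>n<N. cf \<xi> n * cf \<eta> n)"
    by (simp add: cf_def complex_eq_iff fun_eq_iff sum.distrib sum_subtractf)
  finally show ?thesis .
qed

text \<open>Only products of coordinates matter, so a real diagonal operator can be moved to the
  other argument or distributed over both as square roots.\<close>

lemma cbilinear_eq_if_coeff:
  assumes "\<And>n. cf \<xi> n * cf \<eta> n = cf \<xi>' n * cf \<eta>' n"
  shows "cbilinear \<xi> \<eta> = cbilinear \<xi>' \<eta>'"
  using cbilinear_parseval[of \<xi> \<eta>] cbilinear_parseval[of \<xi>' \<eta>'] LIMSEQ_unique by (auto simp: assms)

lemma cbilinear_proj: "cbilinear (map_prod (proj N) (proj N) \<xi>) \<eta> = (\<Sum>n<N. cf \<xi> n * cf \<eta> n)"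
proof (rule LIMSEQ_unique[OF cbilinear_parseval])
  have "(\<Sum>n<N'. cf (map_prod (proj N) (proj N) \<xi>) n * cf \<eta> n) = (\<Sum>n<N. cf \<xi> n * cf \<eta> n)" if "N \<le> N'" for N'
    using that by (intro sum.mono_neutral_cong_right) (auto simp: cf_proj)
  then show "(\<lambda>N'. \<Sum>n<N'. cf (map_prod (proj N) (proj N) \<xi>) n * cf \<eta> n) \<longlonglongrightarrow> (\<Sum>n<N. cf \<xi> n * cf \<eta> n)"
    by (intro tendsto_eventually eventually_sequentiallyI[of N]) auto
qed

end

lemma cbilinear_add: "cbilinear (\<xi> + \<eta>) \<zeta> = cbilinear \<xi> \<zeta> + cbilinear \<eta> \<zeta>"
  "cbilinear \<zeta> (\<xi> + \<eta>) = cbilinear \<zeta> \<xi> + cbilinear \<zeta> \<eta>"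
  by (simp_all add: cbilinear_def inner_add_left inner_add_right algebra_simps)

lemma cbilinear_commute: "cbilinear \<xi> \<eta> = cbilinear \<eta> \<xi>"
  by (simp add: cbilinear_def inner_commute)

section \<open>Gaussian integrals\<close>

lemma integrable_std_normal_exp_abs: "integrable std_normal_distribution (\<lambda>u. exp (c * \<bar>u\<bar>))"
proof -
  have i: "integrable lborel (\<lambda>u. std_normal_density u * exp (k * u))" for k :: real
  proof -
    \<comment> \<open>Completing the square: the exponential factor shifts the mean to
      \<open>k\<close>.\<close>
    have "std_normal_density u * exp (k * u) = exp (k\<^sup>2 / 2) * normal_density k 1 u" for u
      by (simp add: normal_density_def exp_add[symmetric] power2_eq_square field_simps)
    then show ?thesis by simp
  qed
  have "integrable lborel (\<lambda>u. std_normal_density u * exp (c * \<bar>u\<bar>))"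
  proof (rule Bochner_Integration.integrable_bound)
    show "integrable lborel (\<lambda>u. std_normal_density u * exp (c * u) + std_normal_density u * exp (- c * u))"
      by (intro Bochner_Integration.integrable_add i)
    have "std_normal_density u * exp (c * \<bar>u\<bar>) \<le> std_normal_density u * (exp (c * u) + exp (- c * u))" for u
      by (intro mult_left_mono normal_density_nonneg) (auto simp: abs_if)
    then show "AE u in lborel. norm (std_normal_density u * exp (c * \<bar>u\<bar>)) \<le>
      norm (std_normal_density u * exp (c * u) + std_normal_density u * exp (- c * u))"
      by (intro AE_I2) (simp add: distrib_left normal_density_nonneg)
  qed measurable
  then show ?thesis by (simp add: integrable_density normal_density_nonneg)
qed

text \<open>The sum is at most \<open>card I\<close> times its largest term, and the exponential of
  the latter is one of the summands on the right. The additional 1 covers empty \<open>I\<close>.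
  This reduces joint exponential moments to single ones without any independence.\<close>

lemma exp_sum_le:
  fixes a :: "'i \<Rightarrow> real"
  assumes "finite I" "0 \<le> k" "\<And>i. i \<in> I \<Longrightarrow> 0 \<le> a i"
  shows "exp (k * (\<Sum>i\<in>I. a i)) \<le> 1 + (\<Sum>i\<in>I. exp (k * card I * a i))"
proof (cases "I = {}")
  case False
  obtain j where j: "j \<in> I" "a j = Max (a ` I)"
    using Max_in[of "a ` I"] assms(1) False by (metis (no_types, lifting) finite_imageI imageE image_is_empty)
  have "(\<Sum>i\<in>I. a i) \<le> card I * a j"
    using sum_bounded_above[of I a "a j"] assms(1) j(2) by simp
  then have "k * (\<Sum>i\<in>I. a i) \<le> k * (card I * a j)" using assms(2) by (rule mult_left_mono)
  then have "exp (k * (\<Sum>i\<in>I. a i)) \<le> exp (k * card I * a j)" by (simp add: mult.assoc)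
  also have "\<dots> \<le> (\<Sum>i\<in>I. exp (k * card I * a i))"
    using assms(1) j(1) by (intro member_le_sum) auto
  finally show ?thesis by simp
qed simp

context white_noise_setup
begin

lemma prob_space_gauss: "prob_space \<mu>"
  using white_noise by (simp add: white_noise_space_def)

sublocale \<mu>: prob_space \<mu> by (rule prob_space_gauss)

lemma sets_gauss: "sets \<mu> = sets (cylinder_algebra W)"
  using white_noise by (simp add: white_noise_space_def)

lemma space_gauss: "space \<mu> = dual_space W"
  using sets_eq_imp_space_eq[OF sets_gauss] by (simp add: cylinder_algebra_def space_measure_of_conv)

lemma char_gauss: "f \<in> \<E> \<Longrightarrow> (\<integral>x. iexp (x f) \<partial>\<mu>) = of_real (exp (- (norm f)\<^sup>2 / 2))"
  using white_noise by (simp add: white_noise_space_def)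

lemma measurable_eval:
  assumes "f \<in> \<E>"
  shows "(\<lambda>x. x f) \<in> borel_measurable \<mu>"
proof (rule measurableI)
  fix B :: "real set" assume "B \<in> sets borel"
  then have "{x \<in> dual_space W. x f \<in> B} \<in> sets (cylinder_algebra W)"
    unfolding cylinder_algebra_def using assms by (subst sets_measure_of) auto
  moreover have "(\<lambda>x. x f) -` B \<inter> space \<mu> = {x \<in> dual_space W. x f \<in> B}"
    by (auto simp: space_gauss)
  ultimately show "(\<lambda>x. x f) -` B \<inter> space \<mu> \<in> sets \<mu>" by (simp add: sets_gauss)
qed simp

lemma eval_add: "x \<in> space \<mu> \<Longrightarrow> f \<in> \<E> \<Longrightarrow> g \<in> \<E> \<Longrightarrow> x (f + g) = x f + x g"
  by (simp add: space_gauss dual_space_def)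

lemma eval_scaleR: "x \<in> space \<mu> \<Longrightarrow> f \<in> \<E> \<Longrightarrow> x (c *\<^sub>R f) = c * x f"
  by (simp add: space_gauss dual_space_def)

lemma eval_0: "x \<in> space \<mu> \<Longrightarrow> x 0 = 0"
  using eval_scaleR[OF _ test_space_0, of x 0] by simp

lemma eval_minus: "x \<in> space \<mu> \<Longrightarrow> f \<in> \<E> \<Longrightarrow> x (- f) = - x f"
  using eval_scaleR[of x f "- 1"] by simp

lemma eval_diff: "x \<in> space \<mu> \<Longrightarrow> f \<in> \<E> \<Longrightarrow> g \<in> \<E> \<Longrightarrow> x (f - g) = x f - x g"
  using eval_add[of x f "- g"] eval_minus[of x g] test_space_scaleR[of g "- 1"] by simp

lemma eval_sum:
  "finite I \<Longrightarrow> x \<in> space \<mu> \<Longrightarrow> (\<And>i. i \<in> I \<Longrightarrow> g i \<in> \<E>) \<Longrightarrow> x (\<Sum>i\<in>I. g i) = (\<Sum>i\<in>I. x (g i))"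
  by (induction I rule: finite_induct) (auto simp: eval_0 eval_add test_space_sum)

lemma distr_eval_std_normal:
  assumes f: "f \<in> \<E>" "norm f = 1"
  shows "distr \<mu> borel (\<lambda>x. x f) = std_normal_distribution"
proof (rule Levy_uniqueness)
  note [measurable] = measurable_eval[OF f(1)]
  show "real_distribution (distr \<mu> borel (\<lambda>x. x f))"
    by (rule \<mu>.real_distribution_distr) measurable
  show "real_distribution std_normal_distribution" by (rule real_dist_normal_dist)
  show "char (distr \<mu> borel (\<lambda>x. x f)) = char std_normal_distribution"
  proof
    fix t
    have "char (distr \<mu> borel (\<lambda>x. x f)) t = (\<integral>x. iexp (t * x f) \<partial>\<mu>)"
      unfolding char_def by (subst integral_distr) measurable
    also have "\<dots> = (\<integral>x. iexp (x (t *\<^sub>R f)) \<partial>\<mu>)"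
      by (intro Bochner_Integration.integral_cong) (auto simp: eval_scaleR f)
    also have "\<dots> = char std_normal_distribution t"
      by (subst char_gauss) (auto simp: test_space_scaleR f char_std_normal_distribution)
    finally show "char (distr \<mu> borel (\<lambda>x. x f)) t = char std_normal_distribution t" .
  qed
qed

text \<open>The characteristic function does not yield integrability directly. It identifies the law
  of the pairing with a unit vector as standard normal, from which integrability is transported and
  rescaled.\<close>

lemma integrable_exp_abs:
  assumes f: "f \<in> \<E>"
  shows "integrable \<mu> (\<lambda>x. exp (c * \<bar>x f\<bar>))"
proof (cases "f = 0")
  case True
  have "integrable \<mu> (\<lambda>x. exp (c * \<bar>x f\<bar>)) \<longleftrightarrow> integrable \<mu> (\<lambda>x. 1 :: real)"
    by (intro Bochner_Integration.integrable_cong) (auto simp: True eval_0)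
  then show ?thesis by simp
next
  case False
  define g where "g = (1 / norm f) *\<^sub>R f"
  have g: "g \<in> \<E>" "norm g = 1" using f False by (auto simp: g_def intro!: test_space_scaleR)
  have fg: "f = norm f *\<^sub>R g" using False by (simp add: g_def)
  have "integrable \<mu> (\<lambda>x. exp ((c * norm f) * \<bar>x g\<bar>))"
    using integrable_std_normal_exp_abs[of "c * norm f"]
    unfolding distr_eval_std_normal[OF g, symmetric]
    by (subst (asm) integrable_distr_eq) (auto simp: measurable_eval g)
  moreover have "exp ((c * norm f) * \<bar>x g\<bar>) = exp (c * \<bar>x f\<bar>)" if "x \<in> space \<mu>" for x
  proof -
    have "x f = norm f * x g" using eval_scaleR[OF that g(1), of "norm f"] fg by simp
    then show ?thesis by (simp add: abs_mult)
  qed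
  then have "integrable \<mu> (\<lambda>x. exp ((c * norm f) * \<bar>x g\<bar>)) \<longleftrightarrow> integrable \<mu> (\<lambda>x. exp (c * \<bar>x f\<bar>))"
    by (intro Bochner_Integration.integrable_cong) auto
  ultimately show ?thesis by simp
qed

text \<open>The imaginary component stays in the weight \<open>iexp (x b)\<close>, and only the
  coefficient of \<open>x a\<close> is continued analytically, from the imaginary axis, where the
  characteristic function applies, to 1.\<close>

lemma integral_exp_cpairing:
  assumes "\<xi> \<in> \<E> \<times> \<E>"
  shows "(\<integral>x. exp (cpairing x \<xi>) \<partial>\<mu>) = exp (cbilinear \<xi> \<xi> / 2)"
proof -
  obtain a b where \<xi>: "\<xi> = (a, b)" and a: "a \<in> \<E>" and b: "b \<in> \<E>" using assms by auto
  note [measurable] = measurable_eval[OF a] measurable_eval[OF b]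
  \<comment> \<open>This is the characteristic function at \<open>b + t *\<^sub>R a\<close>, with
    its exponent written in \<open>z = \<i> * t\<close>.\<close>
  let ?F = "\<lambda>z. exp ((z\<^sup>2 * of_real ((norm a)\<^sup>2) + 2 * \<i> * z * of_real (inner a b) - of_real ((norm b)\<^sup>2)) / 2)"
  have "(\<integral>x. iexp (x b) * exp (1 * of_real (x a)) \<partial>\<mu>) = ?F 1"
  proof (rule integral_exp_of_char)
    show "(\<lambda>x. iexp (x b)) \<in> borel_measurable \<mu>" by measurable
    show "(\<lambda>x. x a) \<in> borel_measurable \<mu>" by measurable
    show "integrable \<mu> (\<lambda>x. norm (iexp (x b)) * exp (c * \<bar>x a\<bar>))" for c
      using integrable_exp_abs[OF a] by simp
    show "?F holomorphic_on UNIV" by (intro holomorphic_intros) auto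
    fix t
    have "(\<integral>x. iexp (x b) * iexp (t * x a) \<partial>\<mu>) = (\<integral>x. iexp (x (b + t *\<^sub>R a)) \<partial>\<mu>)"
      by (intro Bochner_Integration.integral_cong)
         (auto simp: eval_add eval_scaleR a b test_space_scaleR exp_add distrib_left)
    also have "\<dots> = of_real (exp (- (norm (b + t *\<^sub>R a))\<^sup>2 / 2))"
      using a b by (intro char_gauss test_space_add test_space_scaleR)
    also have "(norm (b + t *\<^sub>R a))\<^sup>2 = (norm b)\<^sup>2 + 2 * t * inner a b + t\<^sup>2 * (norm a)\<^sup>2"
      unfolding power2_norm_eq_inner
      by (simp add: inner_add_left inner_add_right inner_commute power2_eq_square)
    also have "complex_of_real (exp (- ((norm b)\<^sup>2 + 2 * t * inner a b + t\<^sup>2 * (norm a)\<^sup>2) / 2)) = ?F (\<i> * of_real t)"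
    proof -
      have "complex_of_real (- ((norm b)\<^sup>2 + 2 * t * inner a b + t\<^sup>2 * (norm a)\<^sup>2) / 2) =
        ((\<i> * of_real t)\<^sup>2 * of_real ((norm a)\<^sup>2) + 2 * \<i> * (\<i> * of_real t) * of_real (inner a b)
          - of_real ((norm b)\<^sup>2)) / 2"
        by (simp add: complex_eq_iff power2_eq_square)
      then show ?thesis by (simp only: exp_of_real[symmetric])
    qed
    finally show "(\<integral>x. iexp (x b) * iexp (t * x a) \<partial>\<mu>) = ?F (\<i> * of_real t)" .
  qed
  moreover have "?F 1 = exp (cbilinear \<xi> \<xi> / 2)"
    by (simp add: \<xi> cbilinear_def dot_square_norm inner_commute[of b a] algebra_simps)
  moreover have "exp (cpairing x \<xi>) = iexp (x b) * exp (1 * of_real (x a))" for x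
    by (simp add: \<xi> cpairing_def exp_add[symmetric] add.commute)
  ultimately show ?thesis by simp
qed

text \<open>The bound sees \<open>f\<close> only through a bound of its norm and is therefore
  uniform along a convergent sequence.\<close>

lemma integral_exp_abs_le:
  assumes f: "f \<in> \<E>" and c: "0 \<le> c" "norm f \<le> B"
  shows "(\<integral>x. exp (c * \<bar>x f\<bar>) \<partial>\<mu>) \<le> 2 * exp (c\<^sup>2 * B\<^sup>2 / 2)"
proof -
  note [measurable] = measurable_eval[OF f]
  have int: "integrable \<mu> (\<lambda>x. exp (k * x f))" for k
    by (rule Bochner_Integration.integrable_bound[OF integrable_exp_abs[OF f, of "\<bar>k\<bar>"]])
       (auto simp: abs_mult[symmetric])
  have val: "(\<integral>x. exp (k * x f) \<partial>\<mu>) = exp (k\<^sup>2 * (norm f)\<^sup>2 / 2)" for k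
  proof -
    have "complex_of_real (\<integral>x. exp (k * x f) \<partial>\<mu>) = (\<integral>x. exp (cpairing x (k *\<^sub>R f, 0)) \<partial>\<mu>)"
      unfolding integral_complex_of_real[symmetric]
      by (intro Bochner_Integration.integral_cong)
         (auto simp: cpairing_def eval_scaleR eval_0 f exp_of_real[symmetric])
    also have "\<dots> = of_real (exp (k\<^sup>2 * (norm f)\<^sup>2 / 2))"
    proof -
      have "cbilinear (k *\<^sub>R f, 0) (k *\<^sub>R f, 0) = of_real (k\<^sup>2 * (norm f)\<^sup>2)"
        by (simp add: cbilinear_def dot_square_norm[symmetric] power2_eq_square[of k] mult.assoc)
      then show ?thesis
        using f by (subst integral_exp_cpairing) (auto simp: test_space_scaleR test_space_0 exp_of_real[symmetric])
    qed
    finally show ?thesis by (simp only: of_real_eq_iff)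
  qed
  have "(\<integral>x. exp (c * \<bar>x f\<bar>) \<partial>\<mu>) \<le> (\<integral>x. exp (c * x f) + exp (- c * x f) \<partial>\<mu>)"
    by (intro integral_mono integrable_exp_abs f Bochner_Integration.integrable_add int)
       (auto simp: abs_if)
  also have "\<dots> = 2 * exp (c\<^sup>2 * (norm f)\<^sup>2 / 2)"
    using int[of c] int[of "- c"] val[of c] val[of "- c"] by simp
  also have "\<dots> \<le> 2 * exp (c\<^sup>2 * B\<^sup>2 / 2)"
    using c by (auto intro!: mult_left_mono power_mono)
  finally show ?thesis .
qed

lemma exp_sum_abs:
  fixes k B :: real
  assumes I: "finite I" and v: "\<And>i. i \<in> I \<Longrightarrow> v i \<in> \<E>" "\<And>i. i \<in> I \<Longrightarrow> norm (v i) \<le> B" and k: "0 \<le> k"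
  shows "integrable \<mu> (\<lambda>x. exp (k * (\<Sum>i\<in>I. \<bar>x (v i)\<bar>)))"
    and "(\<integral>x. exp (k * (\<Sum>i\<in>I. \<bar>x (v i)\<bar>)) \<partial>\<mu>) \<le> 1 + card I * (2 * exp ((k * card I)\<^sup>2 * B\<^sup>2 / 2))"
proof -
  have [measurable]: "(\<lambda>x. \<Sum>i\<in>I. \<bar>x (v i)\<bar>) \<in> borel_measurable \<mu>"
    using v measurable_eval by (intro borel_measurable_sum borel_measurable_abs) auto
  have int: "integrable \<mu> (\<lambda>x. 1 + (\<Sum>i\<in>I. exp (k * card I * \<bar>x (v i)\<bar>)))"
    using v by (intro Bochner_Integration.integrable_add Bochner_Integration.integrable_sum integrable_exp_abs) auto
  have le: "exp (k * (\<Sum>i\<in>I. \<bar>x (v i)\<bar>)) \<le> 1 + (\<Sum>i\<in>I. exp (k * card I * \<bar>x (v i)\<bar>))" for x :: "'e \<Rightarrow> real"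
    using exp_sum_le[OF I k, of "\<lambda>i. \<bar>x (v i)\<bar>"] by simp
  show i: "integrable \<mu> (\<lambda>x. exp (k * (\<Sum>i\<in>I. \<bar>x (v i)\<bar>)))"
    by (rule Bochner_Integration.integrable_bound[OF int])
       (use le in \<open>auto intro!: order_trans[OF _ abs_ge_self]\<close>)
  have "(\<integral>x. exp (k * (\<Sum>i\<in>I. \<bar>x (v i)\<bar>)) \<partial>\<mu>) \<le> (\<integral>x. 1 + (\<Sum>i\<in>I. exp (k * card I * \<bar>x (v i)\<bar>)) \<partial>\<mu>)"
    by (intro integral_mono i int le)
  also have "\<dots> = 1 + (\<Sum>i\<in>I. (\<integral>x. exp (k * card I * \<bar>x (v i)\<bar>) \<partial>\<mu>))"
    using v integrable_exp_abs by (simp add: \<mu>.prob_space)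
  also have "(\<Sum>i\<in>I. (\<integral>x. exp (k * card I * \<bar>x (v i)\<bar>) \<partial>\<mu>)) \<le> (\<Sum>i\<in>I. 2 * exp ((k * card I)\<^sup>2 * B\<^sup>2 / 2))"
    using v k by (intro sum_mono integral_exp_abs_le) auto
  finally show "(\<integral>x. exp (k * (\<Sum>i\<in>I. \<bar>x (v i)\<bar>)) \<partial>\<mu>) \<le> 1 + card I * (2 * exp ((k * card I)\<^sup>2 * B\<^sup>2 / 2))"
    by simp
qed

section \<open>Complex pairings and exponential functions\<close>

lemma cpairing_add:
  "x \<in> space \<mu> \<Longrightarrow> \<xi> \<in> \<E> \<times> \<E> \<Longrightarrow> \<eta> \<in> \<E> \<times> \<E> \<Longrightarrow> cpairing x (\<xi> + \<eta>) = cpairing x \<xi> + cpairing x \<eta>"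
  by (auto simp: cpairing_def eval_add algebra_simps)

lemma norm_cpairing_le: "norm (cpairing x \<xi>) \<le> \<bar>x (fst \<xi>)\<bar> + \<bar>x (snd \<xi>)\<bar>"
  unfolding cpairing_def by (rule norm_triangle_le) (simp add: norm_mult)

lemma measurable_cpairing:
  assumes "\<xi> \<in> \<E> \<times> \<E>"
  shows "(\<lambda>x. cpairing x \<xi>) \<in> borel_measurable \<mu>"
proof -
  have "fst \<xi> \<in> \<E>" "snd \<xi> \<in> \<E>" using assms by auto
  note [measurable] = this[THEN measurable_eval]
  show ?thesis unfolding cpairing_def by measurable
qed

lemma test_space_pair_add: "\<xi> \<in> \<E> \<times> \<E> \<Longrightarrow> \<eta> \<in> \<E> \<times> \<E> \<Longrightarrow> \<xi> + \<eta> \<in> \<E> \<times> \<E>"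
  by (auto intro: test_space_add)

lemma exp_fun_mult:
  assumes "x \<in> space \<mu>" "\<xi> \<in> \<E> \<times> \<E>" "\<eta> \<in> \<E> \<times> \<E>"
  shows "exp_fun \<xi> x * exp_fun \<eta> x = exp (cbilinear \<xi> \<eta>) * exp_fun (\<xi> + \<eta>) x"
proof -
  have "cpairing x \<xi> - cbilinear \<xi> \<xi> / 2 + (cpairing x \<eta> - cbilinear \<eta> \<eta> / 2) =
    cbilinear \<xi> \<eta> + (cpairing x (\<xi> + \<eta>) - cbilinear (\<xi> + \<eta>) (\<xi> + \<eta>) / 2)"
    by (simp add: cpairing_add[OF assms] cbilinear_add cbilinear_commute[of \<eta> \<xi>] add_divide_distrib)
  then show ?thesis by (simp only: exp_fun_def exp_add[symmetric])
qed

lemma integral_exp_fun_mult: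
  assumes "\<xi> \<in> \<E> \<times> \<E>" "\<eta> \<in> \<E> \<times> \<E>"
  shows "(\<integral>x. exp_fun \<xi> x * exp_fun \<eta> x \<partial>\<mu>) = exp (cbilinear \<xi> \<eta>)"
proof -
  have "(\<integral>x. exp_fun \<xi> x * exp_fun \<eta> x \<partial>\<mu>) =
    (\<integral>x. exp (cbilinear \<xi> \<eta>) * (exp (cpairing x (\<xi> + \<eta>)) / exp (cbilinear (\<xi> + \<eta>) (\<xi> + \<eta>) / 2)) \<partial>\<mu>)"
    using assms by (intro Bochner_Integration.integral_cong refl)
      (subst exp_fun_mult, auto simp: exp_fun_def exp_diff)
  also have "\<dots> = exp (cbilinear \<xi> \<eta>)"
    using integral_exp_cpairing[OF test_space_pair_add[OF assms]] by simp
  finally show ?thesis .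
qed

text \<open>\<open>F\<close> is locally Lipschitz with exponentially growing constants; the increment of the
  pairing is its norm times a pairing with a unit vector.\<close>

lemma Lp_tendsto_exp_Lipschitz:
  fixes F :: "complex \<Rightarrow> complex \<Rightarrow> complex"
  assumes p: "0 < p" and k: "0 \<le> k" and K: "0 \<le> K"
    and cont: "\<And>s. continuous_on UNIV (\<lambda>u. F u s)"
    and bound: "\<And>u s. norm (F u s) \<le> K * exp (k * (norm u + norm s))"
    and lip: "\<And>u v s s'. norm (F u s - F v s') \<le>
        K * (norm (u - v) + norm (s - s')) * exp (k * (norm u + norm v + norm s + norm s'))"
    and \<xi>: "\<And>N. \<xi> N \<in> \<E> \<times> \<E>" "\<zeta> \<in> \<E> \<times> \<E>" and lim: "\<xi> \<longlonglongrightarrow> \<zeta>"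
  shows "Lp_tendsto p \<mu> (\<lambda>N x. F (cpairing x (\<xi> N)) (cbilinear (\<xi> N) (\<xi> N)))
    (\<lambda>x. F (cpairing x \<zeta>) (cbilinear \<zeta> \<zeta>)) sequentially"
proof -
  have meas: "(\<lambda>x. F (cpairing x \<eta>) s) \<in> borel_measurable \<mu>" if "\<eta> \<in> \<E> \<times> \<E>" for \<eta> s
    using measurable_compose[OF measurable_cpairing[OF that] borel_measurable_continuous_onI[OF cont]] .
  have inLp: "in_Lp p \<mu> (\<lambda>x. F (cpairing x \<eta>) s)" if \<eta>: "\<eta> \<in> \<E> \<times> \<E>" for \<eta> s
    unfolding in_Lp_def
  proof (intro conjI meas \<eta>, rule Bochner_Integration.integrable_bound)
    \<comment> \<open>The two real components are indexed by a boolean, so that the estimate for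
      finite families applies with index set \<open>UNIV\<close>.\<close>
    let ?v = "\<lambda>b. if b then fst \<eta> else snd \<eta>"
    have v: "?v b \<in> \<E>" for b using \<eta> by auto
    have "norm (?v b) \<le> norm (fst \<eta>) + norm (snd \<eta>)" for b by simp
    then have "integrable \<mu> (\<lambda>x. exp (k * p * (\<Sum>b\<in>UNIV. \<bar>x (?v b)\<bar>)))"
      using p k by (intro exp_sum_abs(1)[where B = "norm (fst \<eta>) + norm (snd \<eta>)"] v) auto
    then show "integrable \<mu> (\<lambda>x. (K * exp (k * norm s)) powr p * exp (k * p * (\<bar>x (fst \<eta>)\<bar> + \<bar>x (snd \<eta>)\<bar>)))"
      by (simp add: UNIV_bool add.commute)
    have "norm (F (cpairing x \<eta>) s) powr p
        \<le> (K * exp (k * norm s)) powr p * exp (k * p * (\<bar>x (fst \<eta>)\<bar> + \<bar>x (snd \<eta>)\<bar>))" for x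
    proof -
      have "norm (F (cpairing x \<eta>) s) \<le> K * exp (k * (norm (cpairing x \<eta>) + norm s))" by (rule bound)
      also have "\<dots> \<le> K * exp (k * ((\<bar>x (fst \<eta>)\<bar> + \<bar>x (snd \<eta>)\<bar>) + norm s))"
        using norm_cpairing_le[of x \<eta>] K k by (auto intro!: mult_left_mono)
      also have "\<dots> = (K * exp (k * norm s)) * exp (k * (\<bar>x (fst \<eta>)\<bar> + \<bar>x (snd \<eta>)\<bar>))"
        by (simp add: distrib_left exp_add mult_ac)
      finally have "norm (F (cpairing x \<eta>) s) powr p \<le>
        ((K * exp (k * norm s)) * exp (k * (\<bar>x (fst \<eta>)\<bar> + \<bar>x (snd \<eta>)\<bar>))) powr p"
        using p by (intro powr_mono2) auto
      then show ?thesis using K by (simp add: powr_mult exp_powr_real mult_ac)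
    qed
    then show "AE x in \<mu>. norm (norm (F (cpairing x \<eta>) s) powr p)
        \<le> norm ((K * exp (k * norm s)) powr p * exp (k * p * (\<bar>x (fst \<eta>)\<bar> + \<bar>x (snd \<eta>)\<bar>)))"
      by (simp add: abs_mult)
  qed (use meas[OF \<eta>] in measurable)
  define s where "s N = cbilinear (\<xi> N) (\<xi> N)" for N
  define s0 where "s0 = cbilinear \<zeta> \<zeta>"
  have lim': "(\<lambda>N. fst (\<xi> N)) \<longlonglongrightarrow> fst \<zeta>" "(\<lambda>N. snd (\<xi> N)) \<longlonglongrightarrow> snd \<zeta>"
    using lim by (auto intro: tendsto_fst tendsto_snd)
  have s_lim: "s \<longlonglongrightarrow> s0"
    unfolding s_def s0_def cbilinear_def by (intro tendsto_intros lim')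
  define \<delta> where "\<delta> N = norm (fst (\<xi> N) - fst \<zeta>) + norm (snd (\<xi> N) - snd \<zeta>) + norm (s N - s0)" for N
  have \<delta>_lim: "\<delta> \<longlonglongrightarrow> 0 + 0 + 0"
    unfolding \<delta>_def by (intro tendsto_add tendsto_norm_zero LIM_zero lim' s_lim)
  have \<delta>_nonneg: "0 \<le> \<delta> N" for N by (simp add: \<delta>_def)
  obtain B1 where B1: "\<And>N. norm (\<xi> N) \<le> B1"
    using convergent_imp_Bseq[OF convergentI[OF lim]] by (auto simp: Bseq_def)
  obtain B2 where B2: "\<And>N. norm (s N) \<le> B2"
    using convergent_imp_Bseq[OF convergentI[OF s_lim]] by (auto simp: Bseq_def)
  \<comment> \<open>A common norm bound for the six vectors below; the 1 accounts for the normalised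
    increments.\<close>
  define B where "B = max 1 (max B1 (norm \<zeta>))"
  \<comment> \<open>A unit vector, or 0 for \<open>f = 0\<close> because \<open>1 / 0 = 0\<close>;
    in both cases \<open>f = norm f *\<^sub>R g f\<close>.\<close>
  define g where "g f = (1 / norm f) *\<^sub>R f" for f :: 'e
  \<comment> \<open>All functionals that occur in the estimate. The increments appear normalised, so
    their small norms remain outside the exponential and collect in
    \<open>\<delta> N\<close>.\<close>
  define v where "v N = (!) [fst (\<xi> N), snd (\<xi> N), fst \<zeta>, snd \<zeta>, g (fst (\<xi> N) - fst \<zeta>), g (snd (\<xi> N) - snd \<zeta>)]" for N
  have ns: "norm (fst \<eta>) \<le> norm \<eta>" "norm (snd \<eta>) \<le> norm \<eta>" for \<eta> :: "'e \<times> 'e"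
    by (cases \<eta>, simp add: norm_fst_le norm_snd_le)+
  have six: "i < (6::nat) \<longleftrightarrow> i = 0 \<or> i = 1 \<or> i = 2 \<or> i = 3 \<or> i = 4 \<or> i = 5" for i by auto
  have g1: "norm (g f) \<le> 1" for f by (simp add: g_def)
  have mem: "fst (\<xi> N) \<in> \<E>" "snd (\<xi> N) \<in> \<E>" "fst \<zeta> \<in> \<E>" "snd \<zeta> \<in> \<E>" for N
    using \<xi>(1)[of N] \<xi>(2) by auto
  have v_mem: "v N i \<in> \<E>" if "i \<in> {..<6}" for N i
    using that mem by (auto simp: v_def six g_def intro!: test_space_scaleR test_space_diff)
  have v_le: "norm (v N i) \<le> B" if "i \<in> {..<6}" for N i
    using that ns(1)[of "\<xi> N"] ns(2)[of "\<xi> N"] ns[of \<zeta>] B1[of N] g1[of "fst (\<xi> N) - fst \<zeta>"] g1[of "snd (\<xi> N) - snd \<zeta>"]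
    by (auto simp: v_def six B_def)
  define L where "L N x = (\<Sum>i\<in>{..<6}. \<bar>x (v N i)\<bar>)" for N and x :: "'e \<Rightarrow> real"
  have L_eq: "L N x = \<bar>x (fst (\<xi> N))\<bar> + \<bar>x (snd (\<xi> N))\<bar> + \<bar>x (fst \<zeta>)\<bar> + \<bar>x (snd \<zeta>)\<bar>
      + \<bar>x (g (fst (\<xi> N) - fst \<zeta>))\<bar> + \<bar>x (g (snd (\<xi> N) - snd \<zeta>))\<bar>" for N x
    by (simp add: L_def v_def eval_nat_numeral)
  \<comment> \<open>\<open>k\<close> comes from the Lipschitz bound, the extra 1 from estimating the
    increment by an exponential, and \<open>p\<close> from taking the power.\<close>
  define c where "c = p * (k + 1)"
  have c: "0 \<le> c" using p k by (simp add: c_def)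
  define Q where "Q = (K * exp (k * (B2 + norm s0))) powr p * (1 + real (card {..<6::nat}) * (2 * exp ((c * card {..<6::nat})\<^sup>2 * B\<^sup>2 / 2)))"
  \<comment> \<open>The linear factor is absorbed by
    \<open>\<bar>y\<bar> \<le> exp \<bar>y\<bar>\<close>; what remains is \<open>norm f\<close>, the
    quantity that tends to 0.\<close>
  have g_le: "\<bar>x f\<bar> \<le> norm f * exp \<bar>x (g f)\<bar>" if "x \<in> space \<mu>" "f \<in> \<E>" for x f
  proof -
    have "f = norm f *\<^sub>R g f" by (simp add: g_def)
    then have "x f = norm f * x (g f)"
      using eval_scaleR[OF that(1), of "g f" "norm f"] that(2) by (simp add: g_def test_space_scaleR)
    then have "\<bar>x f\<bar> = norm f * \<bar>x (g f)\<bar>" by (simp add: abs_mult)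
    also have "\<dots> \<le> norm f * exp \<bar>x (g f)\<bar>"
      using exp_ge_add_one_self[of "\<bar>x (g f)\<bar>"] by (intro mult_left_mono, linarith, simp)
    finally show ?thesis .
  qed
  have pointwise: "norm (F (cpairing x (\<xi> N)) (s N) - F (cpairing x \<zeta>) s0) powr p \<le>
      (K * exp (k * (B2 + norm s0))) powr p * \<delta> N powr p * exp (c * L N x)" if x: "x \<in> space \<mu>" for N x
  proof -
    have "cpairing x (\<xi> N) - cpairing x \<zeta> = cpairing x (\<xi> N - \<zeta>)"
      using mem by (simp add: cpairing_def eval_diff[OF x] algebra_simps)
    then have "norm (cpairing x (\<xi> N) - cpairing x \<zeta>) \<le> \<bar>x (fst (\<xi> N) - fst \<zeta>)\<bar> + \<bar>x (snd (\<xi> N) - snd \<zeta>)\<bar>"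
      using norm_cpairing_le[of x "\<xi> N - \<zeta>"] by simp
    also have "\<dots> \<le> norm (fst (\<xi> N) - fst \<zeta>) * exp \<bar>x (g (fst (\<xi> N) - fst \<zeta>))\<bar>
        + norm (snd (\<xi> N) - snd \<zeta>) * exp \<bar>x (g (snd (\<xi> N) - snd \<zeta>))\<bar>"
      using mem by (intro add_mono g_le x test_space_diff)
    also have "\<dots> \<le> norm (fst (\<xi> N) - fst \<zeta>) * exp (L N x) + norm (snd (\<xi> N) - snd \<zeta>) * exp (L N x)"
      by (intro add_mono mult_left_mono) (auto simp: L_eq)
    finally have 1: "norm (cpairing x (\<xi> N) - cpairing x \<zeta>) + norm (s N - s0) \<le> \<delta> N * exp (L N x)"
      using mult_left_mono[of 1 "exp (L N x)" "norm (s N - s0)"]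
      by (simp add: \<delta>_def distrib_right L_eq)
    have 2: "norm (cpairing x (\<xi> N)) + norm (cpairing x \<zeta>) + norm (s N) + norm s0 \<le> L N x + (B2 + norm s0)"
    proof -
      have "\<bar>x (fst (\<xi> N))\<bar> + \<bar>x (snd (\<xi> N))\<bar> + (\<bar>x (fst \<zeta>)\<bar> + \<bar>x (snd \<zeta>)\<bar>) \<le> L N x"
        by (simp add: L_eq)
      then show ?thesis
        using add_mono[OF add_mono[OF norm_cpairing_le[of x "\<xi> N"] norm_cpairing_le[of x \<zeta>]] B2[of N]]
        by linarith
    qed
    have "norm (F (cpairing x (\<xi> N)) (s N) - F (cpairing x \<zeta>) s0) \<le>
      K * (norm (cpairing x (\<xi> N) - cpairing x \<zeta>) + norm (s N - s0)) *
      exp (k * (norm (cpairing x (\<xi> N)) + norm (cpairing x \<zeta>) + norm (s N) + norm s0))" by (rule lip)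
    also have "\<dots> \<le> K * (\<delta> N * exp (L N x)) * exp (k * (L N x + (B2 + norm s0)))"
    proof -
      have "exp (k * (norm (cpairing x (\<xi> N)) + norm (cpairing x \<zeta>) + norm (s N) + norm s0)) \<le>
          exp (k * (L N x + (B2 + norm s0)))"
        unfolding exp_le_cancel_iff using 2 k by (rule mult_left_mono)
      then show ?thesis using 1 K \<delta>_nonneg by (intro mult_mono mult_left_mono) auto
    qed
    also have "\<dots> = (K * exp (k * (B2 + norm s0))) * \<delta> N * exp ((k + 1) * L N x)"
      by (simp add: distrib_left distrib_right exp_add mult_ac)
    finally have "norm (F (cpairing x (\<xi> N)) (s N) - F (cpairing x \<zeta>) s0) powr p \<le>
      ((K * exp (k * (B2 + norm s0))) * \<delta> N * exp ((k + 1) * L N x)) powr p"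
      using p by (intro powr_mono2) auto
    then show ?thesis
      using K \<delta>_nonneg by (simp add: powr_mult exp_powr_real c_def mult_ac)
  qed
  show ?thesis
    unfolding s_def[symmetric] s0_def[symmetric]
  proof (rule Lp_tendsto_boundedI)
    show "in_Lp p \<mu> (\<lambda>x. F (cpairing x \<zeta>) s0)" by (rule inLp[OF \<xi>(2)])
    show "\<forall>\<^sub>F N in sequentially. in_Lp p \<mu> (\<lambda>x. F (cpairing x (\<xi> N)) (s N))"
      using inLp[OF \<xi>(1)] by simp
    have "(\<integral>x. norm (F (cpairing x (\<xi> N)) (s N) - F (cpairing x \<zeta>) s0) powr p \<partial>\<mu>) \<le> Q * \<delta> N powr p" for N
    proof -
      have "(\<integral>x. norm (F (cpairing x (\<xi> N)) (s N) - F (cpairing x \<zeta>) s0) powr p \<partial>\<mu>) \<le>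
        (\<integral>x. (K * exp (k * (B2 + norm s0))) powr p * \<delta> N powr p * exp (c * L N x) \<partial>\<mu>)"
      proof (rule integral_mono)
        show "integrable \<mu> (\<lambda>x. norm (F (cpairing x (\<xi> N)) (s N) - F (cpairing x \<zeta>) s0) powr p)"
          using in_Lp_diff[OF p inLp[OF \<xi>(1)] inLp[OF \<xi>(2)]] by (simp add: in_Lp_def)
        show "integrable \<mu> (\<lambda>x. (K * exp (k * (B2 + norm s0))) powr p * \<delta> N powr p * exp (c * L N x))"
          unfolding L_def by (intro integrable_mult_right exp_sum_abs(1)[OF _ v_mem v_le c]) auto
      qed (rule pointwise)
      also have "\<dots> = (K * exp (k * (B2 + norm s0))) powr p * \<delta> N powr p * (\<integral>x. exp (c * L N x) \<partial>\<mu>)" by simp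
      also have "\<dots> \<le> (K * exp (k * (B2 + norm s0))) powr p * \<delta> N powr p *
          (1 + real (card {..<6::nat}) * (2 * exp ((c * card {..<6::nat})\<^sup>2 * B\<^sup>2 / 2)))"
        unfolding L_def by (intro mult_left_mono exp_sum_abs(2)[OF _ v_mem v_le c]) auto
      finally show ?thesis by (simp add: Q_def mult_ac)
    qed
    then show "\<forall>\<^sub>F N in sequentially. (\<integral>x. norm (F (cpairing x (\<xi> N)) (s N) - F (cpairing x \<zeta>) s0) powr p \<partial>\<mu>) \<le> Q * \<delta> N powr p"
      by simp
    have "(\<lambda>N. \<delta> N powr p) \<longlonglongrightarrow> 0"
      using tendsto_zero_powrI[OF \<delta>_lim[simplified] tendsto_const[of p]] p \<delta>_nonneg by simp
    then show "(\<lambda>N. Q * \<delta> N powr p) \<longlonglongrightarrow> 0" using tendsto_mult_right_zero by blast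
  qed
qed

end

section \<open>Hermite polynomials and Wick tensors\<close>

text \<open>The Hermite polynomials with variance parameter \<open>s\<close>. Over a general ring
  the same recursion serves the complex values and, with a negative parameter, their real
  majorants.\<close>

fun hermite :: "nat \<Rightarrow> 'a::comm_ring_1 \<Rightarrow> 'a \<Rightarrow> 'a" where
  "hermite 0 u s = 1"
| "hermite (Suc 0) u s = u"
| "hermite (Suc (Suc n)) u s = u * hermite (Suc n) u s - of_nat (Suc n) * s * hermite n u s"

text \<open>The generating function. The Cauchy product of the series of \<open>exp u\<close> and
  \<open>exp (- s / 2)\<close> has coefficients \<open>T n\<close> that satisfy the Hermite
  recursion divided by factorials.\<close>

lemma hermite_sums:
  fixes u s :: "'a::{real_normed_field, banach}"
  shows "(\<lambda>n. hermite n u s / fact n) sums exp (u - s / 2)"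
proof -
  define a where "a j = u ^ j / fact j" for j :: nat
  \<comment> \<open>The series of \<open>exp (- s / 2)\<close> spread over the even indices, because
    \<open>s\<close> counts with degree 2.\<close>
  define b where "b m = (if even m then (- s / 2) ^ (m div 2) / fact (m div 2) else 0)" for m :: nat
  define T where "T n = (\<Sum>i\<le>n. a i * b (n - i))" for n
  have exp_sums: "(\<lambda>n. w ^ n / fact n) sums exp w" for w :: 'a
    using exp_converges[of w] by (simp add: scaleR_conv_of_real field_simps)
  have exp_summ: "summable (\<lambda>n. norm (w ^ n / fact n))" for w :: 'a
    using summable_norm_exp[of w] by (simp add: norm_divide norm_mult norm_inverse divide_inverse mult.commute)
  have sm: "strict_mono (\<lambda>n::nat. 2 * n)" by (simp add: strict_mono_def)
  have b_out: "b n = 0" if "n \<notin> range (\<lambda>n. 2 * n)" for n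
    using that by (auto simp: b_def elim!: evenE)
  have "(\<lambda>n. b (2 * n)) sums exp (- s / 2)"
    using exp_sums[of "- s / 2"] by (simp add: b_def)
  then have b_sums: "b sums exp (- s / 2)"
    using sums_mono_reindex[OF sm, of b] b_out by blast
  have "summable (\<lambda>n. norm (b (2 * n)))"
    using exp_summ[of "- s / 2"] by (simp add: b_def)
  then have b_summ: "summable (\<lambda>n. norm (b n))"
    using summable_mono_reindex[OF sm, of "\<lambda>n. norm (b n)"] b_out by simp
  have "T sums (exp u * exp (- s / 2))"
  proof -
    have "a sums exp u" using exp_sums[of u] by (simp only: a_def[abs_def])
    then have "(\<Sum>k. a k) = exp u" by (simp add: sums_iff)
    moreover have "(\<Sum>k. b k) = exp (- s / 2)" using b_sums by (simp add: sums_iff)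
    moreover have "summable (\<lambda>k. norm (a k))" using exp_summ[of u] by (simp only: a_def)
    ultimately show ?thesis using Cauchy_product_sums[of a b] b_summ by (simp only: T_def[abs_def])
  qed
  then have T_sums: "T sums exp (u - s / 2)" by (simp add: exp_add[symmetric])
  have a_Suc: "of_nat (Suc i) * a (Suc i) = u * a i" for i
    by (simp add: a_def field_simps del: of_nat_Suc)
  have b_Suc: "of_nat (Suc (Suc m)) * b (Suc (Suc m)) = - s * b m" for m
  proof (cases "even m")
    case True
    then obtain k where k: "m = 2 * k" by (auto elim: evenE)
    have "of_nat (Suc (Suc m)) = (2 :: 'a) * of_nat (Suc k)" by (simp add: k)
    then show ?thesis
      by (simp add: b_def k del: of_nat_Suc)
  qed (simp add: b_def)
  \<comment> \<open>Comparing coefficients in the derivative of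
    \<open>exp (u * x) * exp (- s * x\<^sup>2 / 2)\<close> in a formal variable: the index
    \<open>n + 2\<close> splits as \<open>i + (n + 2 - i)\<close>, which is the product
    rule.\<close>
  have rec: "of_nat (Suc (Suc n)) * T (Suc (Suc n)) = u * T (Suc n) - s * T n" for n
  proof -
    have "of_nat (Suc (Suc n)) * T (Suc (Suc n)) =
      (\<Sum>i\<le>Suc (Suc n). of_nat i * a i * b (Suc (Suc n) - i)) +
      (\<Sum>i\<le>Suc (Suc n). a i * (of_nat (Suc (Suc n) - i) * b (Suc (Suc n) - i)))"
      unfolding T_def sum_distrib_left sum.distrib[symmetric]
    proof (intro sum.cong refl)
      fix i assume "i \<in> {..Suc (Suc n)}"
      then have e: "(of_nat (Suc (Suc n)) :: 'a) = of_nat i + of_nat (Suc (Suc n) - i)"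
        by (subst of_nat_add[symmetric]) simp
      show "of_nat (Suc (Suc n)) * (a i * b (Suc (Suc n) - i)) = of_nat i * a i * b (Suc (Suc n) - i) +
         a i * (of_nat (Suc (Suc n) - i) * b (Suc (Suc n) - i))"
        unfolding e by (simp add: algebra_simps)
    qed
    also have "(\<Sum>i\<le>Suc (Suc n). of_nat i * a i * b (Suc (Suc n) - i)) = u * T (Suc n)"
      by (subst sum.atMost_Suc_shift) (simp only: a_Suc T_def sum_distrib_left diff_Suc_Suc of_nat_0 mult_zero_left add_0_left mult.assoc)
    also have "(\<Sum>i\<le>Suc (Suc n). a i * (of_nat (Suc (Suc n) - i) * b (Suc (Suc n) - i))) = - s * T n"
    proof -
      \<comment> \<open>The two top terms vanish: for \<open>i = n + 2\<close> the weight is 0, for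
        \<open>i = n + 1\<close> the factor \<open>b 1\<close> is 0.\<close>
      have "(\<Sum>i\<le>Suc (Suc n). a i * (of_nat (Suc (Suc n) - i) * b (Suc (Suc n) - i))) =
        (\<Sum>i\<le>n. a i * (of_nat (Suc (Suc n) - i) * b (Suc (Suc n) - i)))"
        by (simp add: b_def)
      also have "\<dots> = (\<Sum>i\<le>n. - s * (a i * b (n - i)))"
      proof (intro sum.cong refl)
        fix i assume "i \<in> {..n}"
        then have i: "Suc (Suc n) - i = Suc (Suc (n - i))" by (simp add: Suc_diff_le)
        show "a i * (of_nat (Suc (Suc n) - i) * b (Suc (Suc n) - i)) = - s * (a i * b (n - i))"
          unfolding i b_Suc by (simp only: mult.left_commute)
      qed
      finally show ?thesis by (simp only: T_def sum_distrib_left)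
    qed
    finally show ?thesis by simp
  qed
  have "T n = hermite n u s / fact n" for n
  proof (induction n rule: induct_nat_012)
    case 0
    show ?case by (simp add: T_def a_def b_def)
  next
    case 1
    show ?case by (simp add: T_def a_def b_def)
  next
    case (ge2 n)
    have nz: "(of_nat (Suc (Suc n)) :: 'a) \<noteq> 0" "(of_nat (Suc n) :: 'a) \<noteq> 0" by (simp_all del: of_nat_Suc)
    have f: "fact (Suc (Suc n)) = of_nat (Suc (Suc n)) * (of_nat (Suc n) * (fact n :: 'a))"
      "fact (Suc n) = of_nat (Suc n) * (fact n :: 'a)"
      by (simp_all only: fact_Suc of_nat_mult)
    have "of_nat (Suc (Suc n)) * T (Suc (Suc n)) = of_nat (Suc (Suc n)) * (hermite (Suc (Suc n)) u s / fact (Suc (Suc n)))"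
      unfolding rec ge2 f using nz by (simp add: divide_simps del: of_nat_Suc)
    then show ?case using nz(1) by (simp only: mult_cancel_left) simp
  qed
  then show ?thesis using T_sums by (simp add: sums_def)
qed

text \<open>With the parameter \<open>- norm s\<close> the subtraction in the recursion becomes an
  addition, so the real polynomial dominates term by term. Its generating series then bounds all
  partial sums of the chaos expansion.\<close>

lemma norm_hermite_le: "norm (hermite n u s) \<le> hermite n (norm u) (- norm s)"
  for u s :: "'a::real_normed_field"
proof (induction n rule: induct_nat_012)
  case (ge2 n)
  have "norm (hermite (Suc (Suc n)) u s) \<le> norm (u * hermite (Suc n) u s) + norm (of_nat (Suc n) * s * hermite n u s)"
    unfolding hermite.simps by (rule norm_triangle_ineq4)
  also have "\<dots> \<le> norm u * hermite (Suc n) (norm u) (- norm s) + of_nat (Suc n) * norm s * hermite n (norm u) (- norm s)"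
    using ge2 by (intro add_mono) (auto simp: norm_mult norm_of_nat simp del: of_nat_Suc intro!: mult_left_mono)
  finally show ?case by (simp del: of_nat_Suc)
qed simp_all

text \<open>Growth and Lipschitz estimate are proved together because the second needs the first for
  the preceding degrees. A single bound \<open>M \<ge> 1\<close> for all four variables lets lower
  powers of \<open>M\<close> be absorbed.\<close>

lemma hermite_bound:
  "\<exists>C\<ge>0. \<forall>u v s s' :: complex. \<forall>M\<ge>1. norm u \<le> M \<longrightarrow> norm v \<le> M \<longrightarrow> norm s \<le> M \<longrightarrow> norm s' \<le> M \<longrightarrow>
     norm (hermite n v s') \<le> C * M ^ n \<and>
     norm (hermite n u s - hermite n v s') \<le> C * (norm (u - v) + norm (s - s')) * M ^ n"
proof (induction n rule: induct_nat_012)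
  case 0
  show ?case by (intro exI[of _ 1]) auto
next
  case 1
  show ?case
  proof (intro exI[of _ 1] conjI allI impI)
    fix u v s s' :: complex and M :: real assume "1 \<le> M" "norm v \<le> M"
    then show "norm (hermite (Suc 0) v s') \<le> 1 * M ^ Suc 0" by simp
    have "norm (u - v) * 1 \<le> (norm (u - v) + norm (s - s')) * M"
      using \<open>1 \<le> M\<close> by (intro mult_mono) auto
    then show "norm (hermite (Suc 0) u s - hermite (Suc 0) v s') \<le> 1 * (norm (u - v) + norm (s - s')) * M ^ Suc 0"
      by simp
  qed simp
next
  case (ge2 n)
  obtain C1 where C1: "0 \<le> C1" "\<And>u v s s' :: complex. \<And>M. 1 \<le> M \<Longrightarrow> norm u \<le> M \<Longrightarrow> norm v \<le> M \<Longrightarrow> norm s \<le> M \<Longrightarrow> norm s' \<le> M \<Longrightarrow>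
     norm (hermite n v s') \<le> C1 * M ^ n \<and>
     norm (hermite n u s - hermite n v s') \<le> C1 * (norm (u - v) + norm (s - s')) * M ^ n"
    using ge2(1) by blast
  obtain C2 where C2: "0 \<le> C2" "\<And>u v s s' :: complex. \<And>M. 1 \<le> M \<Longrightarrow> norm u \<le> M \<Longrightarrow> norm v \<le> M \<Longrightarrow> norm s \<le> M \<Longrightarrow> norm s' \<le> M \<Longrightarrow>
     norm (hermite (Suc n) v s') \<le> C2 * M ^ Suc n \<and>
     norm (hermite (Suc n) u s - hermite (Suc n) v s') \<le> C2 * (norm (u - v) + norm (s - s')) * M ^ Suc n"
    using ge2(2) by blast
  let ?k = "real (Suc n)"
  show ?case
  \<comment> \<open>Each of the two products in the recursion is split into an increment of either
    factor, hence the two factors 2; \<open>?k\<close> is the coefficient of the second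
    product.\<close>
  proof (intro exI[of _ "2 * C2 + ?k * (2 * C1)"] conjI allI impI)
    show "0 \<le> 2 * C2 + ?k * (2 * C1)" using C1(1) C2(1) by simp
    fix u v s s' :: complex and M :: real
    assume M: "1 \<le> M" "norm u \<le> M" "norm v \<le> M" "norm s \<le> M" "norm s' \<le> M"
    define d where "d = norm (u - v) + norm (s - s')"
    have d: "0 \<le> d" "norm (u - v) \<le> d" "norm (s - s') \<le> d" by (simp_all add: d_def)
    define P where "P = M ^ Suc (Suc n)"
    have P: "M ^ Suc n \<le> P" "M ^ n * M = M ^ Suc n" "M * M ^ Suc n = P" "0 \<le> M ^ Suc n" "0 \<le> M ^ n" "M ^ n \<le> M ^ Suc n"
      using M(1) by (auto simp: P_def intro!: power_increasing mult_right_mono)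
    have M0: "0 \<le> M" using M(1) by simp
    note b1 = C1(2)[OF M] note b2 = C2(2)[OF M]
    have t2: "norm (v * hermite (Suc n) v s') \<le> C2 * P"
    proof -
      have "norm (v * hermite (Suc n) v s') \<le> M * (C2 * M ^ Suc n)"
        unfolding norm_mult using M b2 M0 by (intro mult_mono) auto
      then show ?thesis using P(3) by (simp add: mult_ac)
    qed
    have t1: "norm (s' * hermite n v s') \<le> C1 * P"
    proof -
      have "norm (s' * hermite n v s') \<le> M * (C1 * M ^ n)"
        unfolding norm_mult using M b1 M0 by (intro mult_mono) auto
      also have "\<dots> = C1 * M ^ Suc n" by simp
      also have "\<dots> \<le> C1 * P" using P(1) C1(1) by (rule mult_left_mono)
      finally show ?thesis .
    qed
    have "norm (hermite (Suc (Suc n)) v s') \<le> norm (v * hermite (Suc n) v s') + norm (of_nat (Suc n) * (s' * hermite n v s'))"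
      unfolding hermite.simps mult.assoc by (rule norm_triangle_ineq4)
    also have "\<dots> \<le> C2 * P + ?k * (C1 * P)"
      unfolding norm_mult[of "of_nat (Suc n)"] norm_of_nat by (intro add_mono t2 mult_left_mono t1) auto
    also have "\<dots> \<le> (2 * C2 + ?k * (2 * C1)) * P"
    proof -
      have "0 \<le> C2 * P" "0 \<le> ?k * (C1 * P)" using C1(1) C2(1) P(1,4) by auto
      then show ?thesis by (simp only: distrib_right mult.assoc)
    qed
    finally show "norm (hermite (Suc (Suc n)) v s') \<le> (2 * C2 + ?k * (2 * C1)) * M ^ Suc (Suc n)"
      by (simp only: P_def)
    have e2: "norm (u * hermite (Suc n) u s - v * hermite (Suc n) v s') \<le> 2 * C2 * d * P"
    proof -
      have "u * hermite (Suc n) u s - v * hermite (Suc n) v s' =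
        u * (hermite (Suc n) u s - hermite (Suc n) v s') + (u - v) * hermite (Suc n) v s'"
        by (simp add: algebra_simps)
      also have "norm \<dots> \<le> M * (C2 * d * M ^ Suc n) + d * (C2 * M ^ Suc n)"
        using b2 M M0 d unfolding d_def[symmetric]
        by (intro norm_triangle_le add_mono) (auto simp only: norm_mult intro!: mult_mono norm_ge_zero)
      also have "\<dots> \<le> C2 * d * P + C2 * d * P"
      proof (rule add_mono)
        show "M * (C2 * d * M ^ Suc n) \<le> C2 * d * P" unfolding P(3)[symmetric] by (simp add: mult_ac)
        have "C2 * d * M ^ Suc n \<le> C2 * d * P" using P(1) C2(1) d(1) by (intro mult_left_mono) auto
        then show "d * (C2 * M ^ Suc n) \<le> C2 * d * P" by (simp add: mult_ac)
      qed
      finally show ?thesis by (simp add: mult_ac)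
    qed
    have e1: "norm (s * hermite n u s - s' * hermite n v s') \<le> 2 * C1 * d * P"
    proof -
      have "s * hermite n u s - s' * hermite n v s' =
        s * (hermite n u s - hermite n v s') + (s - s') * hermite n v s'"
        by (simp add: algebra_simps)
      also have "norm \<dots> \<le> M * (C1 * d * M ^ n) + d * (C1 * M ^ n)"
        using b1 M M0 d unfolding d_def[symmetric]
        by (intro norm_triangle_le add_mono) (auto simp only: norm_mult intro!: mult_mono norm_ge_zero)
      also have "\<dots> \<le> C1 * d * P + C1 * d * P"
      proof (rule add_mono)
        have le: "C1 * d * M ^ Suc n \<le> C1 * d * P" "C1 * d * M ^ n \<le> C1 * d * P"
          using P(1,6) C1(1) d(1) by (auto intro!: mult_left_mono simp del: power_Suc)
        show "M * (C1 * d * M ^ n) \<le> C1 * d * P" using le(1) by (simp add: mult_ac)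
        show "d * (C1 * M ^ n) \<le> C1 * d * P" using le(2) by (simp add: mult_ac)
      qed
      finally show ?thesis by (simp add: mult_ac)
    qed
    have "hermite (Suc (Suc n)) u s - hermite (Suc (Suc n)) v s' =
      (u * hermite (Suc n) u s - v * hermite (Suc n) v s') - of_nat (Suc n) * (s * hermite n u s - s' * hermite n v s')"
      by (simp add: algebra_simps)
    also have "norm \<dots> \<le> norm (u * hermite (Suc n) u s - v * hermite (Suc n) v s') + norm (of_nat (Suc n) * (s * hermite n u s - s' * hermite n v s'))"
      by (rule norm_triangle_ineq4)
    also have "\<dots> \<le> 2 * C2 * d * P + ?k * (2 * C1 * d * P)"
      unfolding norm_mult[of "of_nat (Suc n)"] norm_of_nat by (intro add_mono e2 mult_left_mono e1) auto
    also have "\<dots> = (2 * C2 + ?k * (2 * C1)) * d * P" by (simp only: distrib_right mult.assoc)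
    finally show "norm (hermite (Suc (Suc n)) u s - hermite (Suc (Suc n)) v s') \<le>
      (2 * C2 + ?k * (2 * C1)) * (norm (u - v) + norm (s - s')) * M ^ Suc (Suc n)"
      by (simp only: P_def d_def)
  qed
qed

lemma norm_exp_diff_le: "norm (exp a - exp b :: complex) \<le> norm (a - b) * exp (norm a + 2 * norm b)"
proof -
  have "exp a - exp b = exp b * (exp (a - b) - 1)" by (simp add: exp_diff field_simps)
  also have "norm \<dots> = norm (exp b) * norm (exp (a - b) - 1)" by (rule norm_mult)
  also have "\<dots> \<le> exp (norm b) * (norm (a - b) * exp (norm a + norm b))"
  proof (intro mult_mono norm_exp)
    have "norm (exp (a - b) - 1) \<le> exp \<bar>Re (a - b)\<bar> * norm (a - b)"
      using Taylor_exp[of "a - b" 0] by simp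
    also have "\<dots> \<le> exp (norm a + norm b) * norm (a - b)"
      using abs_Re_le_cmod[of "a - b"] norm_triangle_ineq4[of a b] by (intro mult_right_mono) auto
    finally show "norm (exp (a - b) - 1) \<le> norm (a - b) * exp (norm a + norm b)" by (simp add: mult.commute)
  qed auto
  also have "\<dots> = norm (a - b) * exp (norm a + 2 * norm b)"
  proof -
    have "norm a + 2 * norm b = norm b + (norm a + norm b)" by simp
    then show ?thesis by (simp only: exp_add mult_ac)
  qed
  finally show ?thesis .
qed

section \<open>Sums over lists of basis indices\<close>

lemma sum_swap3:
  "(\<Sum>i\<in>A. \<Sum>k\<in>B. \<Sum>j\<in>C. f i k j) = (\<Sum>j\<in>C. \<Sum>k\<in>B. \<Sum>i\<in>A. f i k j)"
proof -
  have "(\<Sum>i\<in>A. \<Sum>k\<in>B. \<Sum>j\<in>C. f i k j) = (\<Sum>k\<in>B. \<Sum>i\<in>A. \<Sum>j\<in>C. f i k j)" by (rule sum.swap)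
  also have "\<dots> = (\<Sum>k\<in>B. \<Sum>j\<in>C. \<Sum>i\<in>A. f i k j)" by (intro sum.cong refl sum.swap)
  also have "\<dots> = (\<Sum>j\<in>C. \<Sum>k\<in>B. \<Sum>i\<in>A. f i k j)" by (rule sum.swap)
  finally show ?thesis .
qed

lemma sum_lists_Suc:
  fixes g :: "nat list \<Rightarrow> 'b::comm_monoid_add"
  shows "(\<Sum>ks | length ks = Suc n \<and> set ks \<subseteq> {..<N}. g ks) =
    (\<Sum>i<N. \<Sum>ks | length ks = n \<and> set ks \<subseteq> {..<N}. g (i # ks))"
  unfolding sum.cartesian_product
  by (rule sum.reindex_bij_witness[where i = "\<lambda>(i, ks). i # ks" and j = "\<lambda>ks. (hd ks, tl ks)"])
     (auto simp: length_Suc_conv)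

text \<open>Taking out the entry at position \<open>j\<close> is a bijection onto pairs of an entry
  and a shorter list. This matches the contractions in \<open>wick\<close>, where the first vector
  is paired with the one at position \<open>j\<close>.\<close>

lemma sum_lists_insert:
  fixes g :: "nat \<Rightarrow> nat list \<Rightarrow> 'b::comm_monoid_add"
  assumes "j \<le> n"
  shows "(\<Sum>ks | length ks = Suc n \<and> set ks \<subseteq> {..<N}. g (ks ! j) (take j ks @ drop (Suc j) ks)) =
    (\<Sum>i<N. \<Sum>ks | length ks = n \<and> set ks \<subseteq> {..<N}. g i ks)"
  unfolding sum.cartesian_product
proof (rule sum.reindex_bij_witness[where i = "\<lambda>(i, ks). take j ks @ i # drop j ks"
      and j = "\<lambda>ks. (ks ! j, take j ks @ drop (Suc j) ks)"], goal_cases)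
  case (1 ks)
  then show ?case using assms by (simp add: id_take_nth_drop[symmetric] min_def)
next
  case (2 ks)
  then show ?case using assms set_take_subset[of j ks] set_drop_subset[of "Suc j" ks] nth_mem[of j ks] by (auto simp: subset_iff)
next
  case (3 p)
  then show ?case using assms by (cases p) (auto simp: nth_append min_def)
next
  case (4 p)
  then show ?case using assms set_take_subset[of j "snd p"] set_drop_subset[of j "snd p"] by (cases p) auto
next
  case (5 ks)
  then show ?case by simp
qed

context white_noise_setup
begin

text \<open>The sum runs over the tensor coefficients of \<open>\<Sum>i<N. z i e\<^sub>i\<close>, so this is the
  expression of the Wick power of one vector through the Hermite polynomial.\<close>

lemma sum_wick_hermite:
  "(\<Sum>ks | length ks = n \<and> set ks \<subseteq> {..<N}. (\<Prod>i\<leftarrow>ks. z i) * complex_of_real (wick x (map e ks))) =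
    hermite n (\<Sum>i<N. z i * of_real (x (e i))) (\<Sum>i<N. z i * z i)"
proof (induction n rule: induct_nat_012)
  case 0
  have "{ks. length ks = 0 \<and> set ks \<subseteq> {..<N}} = {[]}" by auto
  then show ?case by simp
next
  case 1
  have "{ks. ks = [] \<and> set ks \<subseteq> {..<N}} = {[]}" by auto
  then show ?case by (subst sum_lists_Suc) simp
next
  case (ge2 n)
  let ?V = "\<lambda>n. {ks. length ks = n \<and> set ks \<subseteq> {..<N}}"
  let ?P = "\<lambda>ks. \<Prod>i\<leftarrow>ks. z i"
  let ?w = "\<lambda>ks. complex_of_real (wick x (map e ks))"
  let ?del = "\<lambda>j ks. take j ks @ drop (Suc j) ks"
  \<comment> \<open>By orthonormality, a contraction contributes only if the two indices
    coincide.\<close>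
  have w: "?w (i # ks) = of_real (x (e i)) * ?w ks -
      (\<Sum>j\<le>n. (if i = ks ! j then 1 else 0) * ?w (?del j ks))" if "ks \<in> ?V (Suc n)" for i ks
  proof -
    have "{..<length ks} = {..n}" using that by auto
    then show ?thesis using that
      by (simp add: inner_basis take_map drop_map if_distrib[of complex_of_real] cong: if_cong)
  qed
  have P: "?P ks = z (ks ! j) * ?P (?del j ks)" if "ks \<in> ?V (Suc n)" "j \<le> n" for j ks
  proof -
    have "ks = take j ks @ ks ! j # drop (Suc j) ks" using that by (intro id_take_nth_drop) auto
    then have "?P ks = ?P (take j ks @ ks ! j # drop (Suc j) ks)" by simp
    then show ?thesis by simp
  qed
  have "(\<Sum>ks\<in>?V (Suc (Suc n)). ?P ks * ?w ks) = (\<Sum>i<N. \<Sum>ks\<in>?V (Suc n). z i * ?P ks * ?w (i # ks))"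
    by (subst sum_lists_Suc) simp
  also have "\<dots> = (\<Sum>i<N. \<Sum>ks\<in>?V (Suc n). (z i * of_real (x (e i))) * (?P ks * ?w ks) -
      (\<Sum>j\<le>n. z i * ?P ks * ((if i = ks ! j then 1 else 0) * ?w (?del j ks))))"
    by (intro sum.cong refl) (simp only: w sum_distrib_left right_diff_distrib mult_ac)
  also have "\<dots> = (\<Sum>i<N. \<Sum>ks\<in>?V (Suc n). (z i * of_real (x (e i))) * (?P ks * ?w ks)) -
      (\<Sum>i<N. \<Sum>ks\<in>?V (Suc n). \<Sum>j\<le>n. z i * ?P ks * ((if i = ks ! j then 1 else 0) * ?w (?del j ks)))"
    by (simp only: sum_subtractf)
  also have "(\<Sum>i<N. \<Sum>ks\<in>?V (Suc n). (z i * of_real (x (e i))) * (?P ks * ?w ks)) =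
      (\<Sum>i<N. z i * of_real (x (e i))) * hermite (Suc n) (\<Sum>i<N. z i * of_real (x (e i))) (\<Sum>i<N. z i * z i)"
    unfolding ge2(2)[symmetric] by (simp only: sum_product)
  also have "(\<Sum>i<N. \<Sum>ks\<in>?V (Suc n). \<Sum>j\<le>n. z i * ?P ks * ((if i = ks ! j then 1 else 0) * ?w (?del j ks))) =
      (\<Sum>j\<le>n. \<Sum>ks\<in>?V (Suc n). \<Sum>i<N. z i * ?P ks * ((if i = ks ! j then 1 else 0) * ?w (?del j ks)))"
    by (rule sum_swap3)
  \<comment> \<open>The Kronecker delta fixes \<open>i\<close> to \<open>ks ! j\<close>, and the
    factor \<open>z (ks ! j)\<close> of the product over \<open>ks\<close> supplies the second
    copy.\<close>
  also have "\<dots> = (\<Sum>j\<le>n. \<Sum>ks\<in>?V (Suc n). z (ks ! j) * z (ks ! j) * (?P (?del j ks) * ?w (?del j ks)))"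
  proof (intro sum.cong refl)
    fix j ks assume j: "j \<in> {..n}" and ks: "ks \<in> ?V (Suc n)"
    have "ks ! j \<in> set ks" using j ks by (intro nth_mem) auto
    then have "ks ! j \<in> {..<N}" using ks by auto
    then have "(\<Sum>i<N. z i * ?P ks * ((if i = ks ! j then 1 else 0) * ?w (?del j ks))) = z (ks ! j) * ?P ks * ?w (?del j ks)"
      by (simp add: if_distrib[of "\<lambda>c. c * _"] if_distrib[of "\<lambda>c. _ * c"] cong: if_cong)
    then show "(\<Sum>i<N. z i * ?P ks * ((if i = ks ! j then 1 else 0) * ?w (?del j ks))) =
        z (ks ! j) * z (ks ! j) * (?P (?del j ks) * ?w (?del j ks))"
      using P[OF ks, of j] j by (simp add: mult_ac)
  qed
  \<comment> \<open>The value no longer depends on \<open>j\<close>; the \<open>n + 1\<close>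
    positions give the factor \<open>Suc n\<close> of the Hermite recursion.\<close>
  also have "\<dots> = (\<Sum>j\<le>n. \<Sum>i<N. \<Sum>ks\<in>?V n. z i * z i * (?P ks * ?w ks))"
    by (intro sum.cong refl sum_lists_insert[of _ n "\<lambda>i ks. z i * z i * (?P ks * ?w ks)"]) simp
  also have "\<dots> = of_nat (Suc n) * ((\<Sum>i<N. z i * z i) * hermite n (\<Sum>i<N. z i * of_real (x (e i))) (\<Sum>i<N. z i * z i))"
    unfolding ge2(1)[symmetric] by (simp add: sum_product)
  finally show ?case by (simp only: hermite.simps mult.assoc)
qed

end

section \<open>Chaos expansion of exponential functions\<close>

context white_noise_setup
begin

abbreviation "cproj N \<equiv> map_prod (proj N) (proj N)"

lemma cproj_test_space: "cproj N \<xi> \<in> \<E> \<times> \<E>"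
  by (cases \<xi>) (simp add: proj_test_space)

lemma cproj_tendsto: "(\<lambda>N. cproj N \<xi>) \<longlonglongrightarrow> \<xi>"
  using tendsto_Pair[OF proj_tendsto proj_tendsto, of "fst \<xi>" "snd \<xi>"]
  by (simp add: map_prod_def case_prod_beta)

lemma eval_proj: "x \<in> space \<mu> \<Longrightarrow> x (proj N f) = (\<Sum>n<N. inner f (e n) * x (e n))"
  by (simp add: proj_def eval_sum eval_scaleR basis_test_space test_space_scaleR)

lemma cpairing_cproj: "x \<in> space \<mu> \<Longrightarrow> cpairing x (cproj N \<xi>) = (\<Sum>n<N. cf \<xi> n * of_real (x (e n)))"
  by (simp add: cpairing_def eval_proj cf_def complex_eq_iff)

lemma cbilinear_cproj: "cbilinear (cproj N \<xi>) (cproj N \<xi>) = (\<Sum>n<N. cf \<xi> n * cf \<xi> n)"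
  unfolding cbilinear_proj by (intro sum.cong refl) (simp add: cf_proj)

text \<open>The normalisation moves along with the vector, so the exponential is treated as a
  function of both the pairing and the square. The growth constant 2 stems from
  \<open>norm_exp_diff_le\<close>.\<close>

lemma exp_fun_tendsto:
  assumes p: "0 < p" and \<xi>: "\<And>N. \<xi> N \<in> \<E> \<times> \<E>" "\<zeta> \<in> \<E> \<times> \<E>" and lim: "\<xi> \<longlonglongrightarrow> \<zeta>"
  shows "Lp_tendsto p \<mu> (\<lambda>N. exp_fun (\<xi> N)) (exp_fun \<zeta>) sequentially"
proof -
  let ?F = "\<lambda>u s. exp (u - s / 2 :: complex)"
  have le: "norm (u - s / 2) \<le> norm u + norm s" for u s :: complex
  proof -
    have "norm (s / 2) = norm s / 2" by (simp add: norm_divide)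
    then show ?thesis using norm_triangle_ineq4[of u "s / 2"] norm_ge_zero[of s] by linarith
  qed
  have arith: "a + 2 * b \<le> 2 * (nu + nv + ns + ns')" if "a \<le> nu + ns" "b \<le> nv + ns'" "0 \<le> nu" "0 \<le> ns"
    for a b nu nv ns ns' :: real
    using that by simp
  have "Lp_tendsto p \<mu> (\<lambda>N x. ?F (cpairing x (\<xi> N)) (cbilinear (\<xi> N) (\<xi> N)))
    (\<lambda>x. ?F (cpairing x \<zeta>) (cbilinear \<zeta> \<zeta>)) sequentially"
  proof (rule Lp_tendsto_exp_Lipschitz[where F = ?F and k = 2 and K = 1, OF p _ _ _ _ _ \<xi> lim])
    show "continuous_on UNIV (\<lambda>u. ?F u s)" for s by (intro continuous_intros) auto
    show "norm (?F u s) \<le> 1 * exp (2 * (norm u + norm s))" for u s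
    proof -
      have "norm (?F u s) \<le> exp (norm (u - s / 2))" by (rule norm_exp)
      also have "\<dots> \<le> exp (2 * (norm u + norm s))"
      proof -
        have "norm (u - s / 2) \<le> 2 * (norm u + norm s)" by (rule order_trans[OF le]) simp
        then show ?thesis by simp
      qed
      finally show ?thesis by simp
    qed
    fix u v s s' :: complex
    have "norm (?F u s - ?F v s') \<le> norm ((u - s / 2) - (v - s' / 2)) * exp (norm (u - s / 2) + 2 * norm (v - s' / 2))"
      by (rule norm_exp_diff_le)
    also have "\<dots> \<le> (norm (u - v) + norm (s - s')) * exp (2 * (norm u + norm v + norm s + norm s'))"
    proof (intro mult_mono)
      have "(u - s / 2) - (v - s' / 2) = (u - v) - (s - s') / 2" by (simp add: diff_divide_distrib)
      then show "norm ((u - s / 2) - (v - s' / 2)) \<le> norm (u - v) + norm (s - s')" using le[of "u - v" "s - s'"] by (simp only:)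
      have "norm (u - s / 2) + 2 * norm (v - s' / 2) \<le> 2 * (norm u + norm v + norm s + norm s')"
        by (rule arith[OF le le]) auto
      then show "exp (norm (u - s / 2) + 2 * norm (v - s' / 2)) \<le> exp (2 * (norm u + norm v + norm s + norm s'))" by simp
    qed auto
    finally show "norm (?F u s - ?F v s') \<le> 1 * (norm (u - v) + norm (s - s')) * exp (2 * (norm u + norm v + norm s + norm s'))"
      by simp
  qed auto
  then show ?thesis by (simp add: exp_fun_def[abs_def])
qed

lemma in_Lp_exp_fun: "0 < p \<Longrightarrow> \<xi> \<in> \<E> \<times> \<E> \<Longrightarrow> in_Lp p \<mu> (exp_fun \<xi>)"
  using exp_fun_tendsto[of p "\<lambda>_. \<xi>" \<xi>] by (simp add: Lp_tendsto_def)

lemma hermite_tendsto: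
  assumes p: "0 < p" and \<xi>: "\<And>N. \<xi> N \<in> \<E> \<times> \<E>" "\<zeta> \<in> \<E> \<times> \<E>" and lim: "\<xi> \<longlonglongrightarrow> \<zeta>"
  shows "Lp_tendsto p \<mu> (\<lambda>N x. hermite n (cpairing x (\<xi> N)) (cbilinear (\<xi> N) (\<xi> N)))
    (\<lambda>x. hermite n (cpairing x \<zeta>) (cbilinear \<zeta> \<zeta>)) sequentially"
proof -
  obtain C where C: "0 \<le> C" "\<And>u v s s' :: complex. \<And>M. 1 \<le> M \<Longrightarrow> norm u \<le> M \<Longrightarrow> norm v \<le> M \<Longrightarrow> norm s \<le> M \<Longrightarrow> norm s' \<le> M \<Longrightarrow>
     norm (hermite n v s') \<le> C * M ^ n \<and>
     norm (hermite n u s - hermite n v s') \<le> C * (norm (u - v) + norm (s - s')) * M ^ n"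
    using hermite_bound[of n] by blast
  \<comment> \<open>Trades the polynomial growth of Hermite polynomials for the exponential growth
    that \<open>Lp_tendsto_exp_Lipschitz\<close> expects.\<close>
  have power_le: "(1 + a) ^ n \<le> exp n * exp (n * a)" if "0 \<le> a" for a :: real
  proof -
    have "(1 + a) ^ n \<le> exp (1 + a) ^ n"
      using that exp_ge_add_one_self[of "1 + a"] by (intro power_mono) linarith+
    also have "\<dots> = exp n * exp (n * a)"
      by (simp add: exp_of_nat_mult[symmetric] exp_add[symmetric] distrib_left)
    finally show ?thesis .
  qed
  show ?thesis
  proof (rule Lp_tendsto_exp_Lipschitz[where F = "hermite n" and k = n and K = "C * exp n", OF p _ _ _ _ _ \<xi> lim])
    show "continuous_on UNIV (\<lambda>u. hermite n u s)" for s :: complex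
      by (induction n rule: induct_nat_012) (auto intro!: continuous_intros simp del: of_nat_Suc)
    show "norm (hermite n u s) \<le> C * exp n * exp (n * (norm u + norm s))" for u s :: complex
    proof -
      have "norm (hermite n u s) \<le> C * (1 + (norm u + norm s)) ^ n"
        using C(2)[of "1 + (norm u + norm s)" u u s s] by simp
      also have "\<dots> \<le> C * (exp n * exp (n * (norm u + norm s)))"
        using C(1) by (intro mult_left_mono power_le) auto
      finally show ?thesis by (simp add: mult.assoc)
    qed
    show "norm (hermite n u s - hermite n v s') \<le> C * exp n * (norm (u - v) + norm (s - s')) *
        exp (n * (norm u + norm v + norm s + norm s'))" for u v s s' :: complex
    proof -
      let ?a = "norm u + norm v + norm s + norm s'"
      have "norm (hermite n u s - hermite n v s') \<le> C * (norm (u - v) + norm (s - s')) * (1 + ?a) ^ n"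
        using C(2)[of "1 + ?a" u v s s'] by simp
      also have "\<dots> \<le> C * (norm (u - v) + norm (s - s')) * (exp n * exp (n * ?a))"
        using C(1) by (intro mult_left_mono power_le) auto
      finally show ?thesis by (simp add: mult_ac)
    qed
  qed (use C(1) in auto)
qed

text \<open>The coefficients of the n-th tensor power of \<xi>, divided by \<open>fact n\<close>, in
  the basis of elementary tensors.\<close>

definition chaos :: "'e \<times> 'e \<Rightarrow> nat \<Rightarrow> nat list \<Rightarrow> complex" where
  "chaos \<xi> n ks = (\<Prod>i\<leftarrow>ks. cf \<xi> i) / fact n"

lemma sum_lists_prod:
  fixes g :: "nat \<Rightarrow> 'b::comm_semiring_1"
  shows
  "(\<Sum>ks | length ks = n \<and> set ks \<subseteq> {..<N}. \<Prod>i\<leftarrow>ks. g i) = (\<Sum>i<N. g i ) ^ n"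
proof (induction n)
  case 0
  have "{ks. length ks = 0 \<and> set ks \<subseteq> {..<N}} = {[]}" by auto
  then show ?case by simp
next
  case (Suc n)
  show ?case
    unfolding sum_lists_Suc
    by (simp add: sum_distrib_left[symmetric] sum_distrib_right[symmetric] Suc)
qed

lemma sum_cf_le: "(\<Sum>i<N. (norm (cf \<xi> i))\<^sup>2) \<le> (norm (fst \<xi>))\<^sup>2 + (norm (snd \<xi>))\<^sup>2"
proof -
  have "(\<Sum>i<N. (inner f (e i))\<^sup>2) \<le> (norm f)\<^sup>2" for f
  proof (rule incseq_le[where X = "\<lambda>N. \<Sum>i<N. (inner f (e i))\<^sup>2"])
    show "incseq (\<lambda>N. \<Sum>i<N. (inner f (e i))\<^sup>2)" by (intro incseq_SucI) simp
    show "(\<lambda>N. \<Sum>i<N. (inner f (e i))\<^sup>2) \<longlonglongrightarrow> (norm f)\<^sup>2"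
      using parseval[of f f] by (simp add: dot_square_norm power2_eq_square)
  qed
  from add_mono[OF this[of "fst \<xi>"] this[of "snd \<xi>"]] show ?thesis
    by (simp add: cf_def cmod_power2 sum.distrib)
qed

lemma sym_tensor_chaos: "sym_tensor n (chaos \<xi> n)"
  unfolding sym_tensor_def
proof (intro conjI allI impI)
  fix ks js :: "nat list" assume "length ks = n \<and> mset ks = mset js"
  then have "mset (map (cf \<xi>) ks) = mset (map (cf \<xi>) js)" by simp
  then show "chaos \<xi> n ks = chaos \<xi> n js" unfolding chaos_def by (metis prod_mset_prod_list)
next
  let ?S = "(norm (fst \<xi>))\<^sup>2 + (norm (snd \<xi>))\<^sup>2"
  show "(\<lambda>ks. (norm (chaos \<xi> n ks))\<^sup>2) summable_on {ks. length ks = n}"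
  proof (rule nonneg_bdd_above_summable_on)
    show "bdd_above (sum (\<lambda>ks. (norm (chaos \<xi> n ks))\<^sup>2) ` {F. F \<subseteq> {ks. length ks = n} \<and> finite F})"
    proof (rule bdd_aboveI2)
      fix F assume "F \<in> {F. F \<subseteq> {ks :: nat list. length ks = n} \<and> finite F}"
      then have F: "F \<subseteq> {ks. length ks = n}" "finite F" by auto
      \<comment> \<open>A finite family of lists uses finitely many indices and so lies in a full
        cube of lists below some \<open>N\<close>; over the cube the sum is an n-th power, bounded
        independently of \<open>N\<close> by Bessel's inequality.\<close>
      then have "finite (\<Union>ks\<in>F. set ks)" by simp
      then obtain N where N: "(\<Union>ks\<in>F. set ks) \<subseteq> {..<N}" using finite_nat_iff_bounded by blast
      have le: "(norm (chaos \<xi> n ks))\<^sup>2 \<le> (\<Prod>i\<leftarrow>ks. (norm (cf \<xi> i))\<^sup>2)" for ks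
      proof -
        have p: "(norm (\<Prod>i\<leftarrow>ks. cf \<xi> i))\<^sup>2 = (\<Prod>i\<leftarrow>ks. (norm (cf \<xi> i))\<^sup>2)"
          by (induction ks) (simp_all add: norm_mult power_mult_distrib)
        have "(norm (chaos \<xi> n ks))\<^sup>2 = (\<Prod>i\<leftarrow>ks. (norm (cf \<xi> i))\<^sup>2) / (fact n)\<^sup>2"
          by (simp add: chaos_def norm_divide power_divide p)
        also have "\<dots> \<le> (\<Prod>i\<leftarrow>ks. (norm (cf \<xi> i))\<^sup>2) / 1"
        proof (intro divide_left_mono)
          show "1 \<le> (fact n :: real)\<^sup>2" using fact_ge_1[of n] by (simp add: one_le_power)
          show "0 \<le> (\<Prod>i\<leftarrow>ks. (norm (cf \<xi> i))\<^sup>2)" using p[symmetric] by simp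
        qed simp
        finally show ?thesis by simp
      qed
      have "(\<Sum>ks\<in>F. (norm (chaos \<xi> n ks))\<^sup>2) \<le> (\<Sum>ks\<in>F. \<Prod>i\<leftarrow>ks. (norm (cf \<xi> i))\<^sup>2)"
        by (intro sum_mono le)
      also have "\<dots> \<le> (\<Sum>ks | length ks = n \<and> set ks \<subseteq> {..<N}. \<Prod>i\<leftarrow>ks. (norm (cf \<xi> i))\<^sup>2)"
      proof (intro sum_mono2)
        show "finite {ks. length ks = n \<and> set ks \<subseteq> {..<N}}"
          using finite_lists_length_eq[of "{..<N}" n] by (simp add: conj_commute)
        show "F \<subseteq> {ks. length ks = n \<and> set ks \<subseteq> {..<N}}" using F N by auto
        show "0 \<le> (\<Prod>i\<leftarrow>ks. (norm (cf \<xi> i))\<^sup>2)" for ks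
          by (induction ks) auto
      qed
      also have "\<dots> = (\<Sum>i<N. (norm (cf \<xi> i))\<^sup>2) ^ n" by (rule sum_lists_prod)
      also have "\<dots> \<le> ?S ^ n" by (intro power_mono sum_cf_le sum_nonneg) auto
      finally show "(\<Sum>ks\<in>F. (norm (chaos \<xi> n ks))\<^sup>2) \<le> ?S ^ n" .
    qed
  qed simp
qed

text \<open>Cutting the index lists at \<open>N\<close> amounts to replacing \<xi> by its
  projection, so the finite Wick sums are Hermite polynomials of projections and converge by
  \<open>hermite_tendsto\<close>. The sum over degrees converges pointwise by the generating
  function and in L2 by domination.\<close>

lemma wiener_ito_exp_fun:
  assumes \<xi>: "\<xi> \<in> \<E> \<times> \<E>"
  shows "wiener_ito W (exp_fun \<xi>) (chaos \<xi>)"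
  unfolding wiener_ito_def
proof (intro exI conjI allI)
  define X where "X n x = (1 / fact n) * hermite n (cpairing x \<xi>) (cbilinear \<xi> \<xi>)" for n x
  show "sym_tensor n (chaos \<xi> n)" for n by (rule sym_tensor_chaos)
  have X: "Lp_tendsto 2 \<mu> (\<lambda>N x. (1 / fact n) * hermite n (cpairing x (cproj N \<xi>)) (cbilinear (cproj N \<xi>) (cproj N \<xi>)))
      (X n) sequentially" for n
    unfolding X_def by (intro Lp_tendsto_mult_const hermite_tendsto cproj_test_space \<xi> cproj_tendsto) simp
  show "Lp_tendsto 2 \<mu> (\<lambda>N x. \<Sum>ks | length ks = n \<and> set ks \<subseteq> {..<N}.
      chaos \<xi> n ks * complex_of_real (wick x (map e ks))) (X n) sequentially" for n
  proof (rule Lp_tendsto_cong[THEN iffD1, OF _ refl X])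
    fix N x assume x: "x \<in> space \<mu>"
    have "(\<Sum>ks | length ks = n \<and> set ks \<subseteq> {..<N}. chaos \<xi> n ks * complex_of_real (wick x (map e ks))) =
      (1 / fact n) * (\<Sum>ks | length ks = n \<and> set ks \<subseteq> {..<N}. (\<Prod>i\<leftarrow>ks. cf \<xi> i) * complex_of_real (wick x (map e ks)))"
      by (simp add: chaos_def sum_divide_distrib)
    then show "1 / fact n * hermite n (cpairing x (cproj N \<xi>)) (cbilinear (cproj N \<xi>) (cproj N \<xi>)) =
      (\<Sum>ks | length ks = n \<and> set ks \<subseteq> {..<N}. chaos \<xi> n ks * complex_of_real (wick x (map e ks)))"
      by (simp only: sum_wick_hermite cpairing_cproj[OF x] cbilinear_cproj)
  qed
  have X_Lp: "in_Lp 2 \<mu> (X n)" for n using X[of n] by (simp add: Lp_tendsto_def)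
  have [measurable]: "X n \<in> borel_measurable \<mu>" for n using X_Lp[of n] by (simp add: in_Lp_def)
  have exp_Lp: "in_Lp 2 \<mu> (exp_fun \<xi>)" by (intro in_Lp_exp_fun \<xi>) simp
  have [measurable]: "exp_fun \<xi> \<in> borel_measurable \<mu>" using exp_Lp by (simp add: in_Lp_def)
  have sums: "(\<lambda>n. X n x) sums exp_fun \<xi> x" for x
    using hermite_sums[of "cpairing x \<xi>" "cbilinear \<xi> \<xi>"] by (simp add: X_def exp_fun_def)
  \<comment> \<open>The sum of the Hermite majorants over all degrees. It bounds the partial sums
    and hence their limit, so \<open>2 * Z x\<close> bounds the difference.\<close>
  define Z where "Z x = exp (norm (cpairing x \<xi>) + norm (cbilinear \<xi> \<xi>) / 2)" for x
  have partial: "norm (\<Sum>n<N. X n x) \<le> Z x" for N x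
  proof -
    let ?h = "\<lambda>n. hermite n (norm (cpairing x \<xi>)) (- norm (cbilinear \<xi> \<xi>)) / fact n"
    have h: "norm (X n x) \<le> ?h n" for n
      using norm_hermite_le[of n "cpairing x \<xi>" "cbilinear \<xi> \<xi>"]
      by (simp add: X_def norm_mult norm_divide divide_right_mono)
    have hs: "?h sums Z x"
      using hermite_sums[of "norm (cpairing x \<xi>)" "- norm (cbilinear \<xi> \<xi>)"] by (simp add: Z_def)
    have "norm (\<Sum>n<N. X n x) \<le> (\<Sum>n<N. ?h n)" by (intro sum_norm_le h)
    also have "\<dots> \<le> (\<Sum>n. ?h n)"
    proof (rule sum_le_suminf)
      show "summable ?h" using hs by (rule sums_summable)
      show "0 \<le> ?h n" for n using h[of n] norm_ge_zero order_trans by blast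
    qed simp
    also have "\<dots> = Z x" using hs by (simp add: sums_iff)
    finally show ?thesis .
  qed
  have [measurable]: "(\<lambda>x. cpairing x \<xi>) \<in> borel_measurable \<mu>" by (rule measurable_cpairing[OF \<xi>])
  have Z_int: "integrable \<mu> (\<lambda>x. (2 * Z x)\<^sup>2)"
  proof (rule Bochner_Integration.integrable_bound)
    let ?v = "\<lambda>b. if b then fst \<xi> else snd \<xi>"
    have v: "?v b \<in> \<E>" for b using \<xi> by auto
    have "integrable \<mu> (\<lambda>x. exp (2 * (\<Sum>b\<in>UNIV. \<bar>x (?v b)\<bar>)))"
      by (intro exp_sum_abs(1)[where B = "norm (fst \<xi>) + norm (snd \<xi>)"] v) auto
    then show "integrable \<mu> (\<lambda>x. 4 * exp (norm (cbilinear \<xi> \<xi>)) * exp (2 * (\<bar>x (fst \<xi>)\<bar> + \<bar>x (snd \<xi>)\<bar>)))"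
      by (simp add: UNIV_bool add.commute)
    show "(\<lambda>x. (2 * Z x)\<^sup>2) \<in> borel_measurable \<mu>" unfolding Z_def by measurable
    have "(2 * Z x)\<^sup>2 \<le> 4 * exp (norm (cbilinear \<xi> \<xi>)) * exp (2 * (\<bar>x (fst \<xi>)\<bar> + \<bar>x (snd \<xi>)\<bar>))" for x
    proof -
      have "(2 * Z x)\<^sup>2 = 4 * exp (norm (cbilinear \<xi> \<xi>)) * exp (2 * norm (cpairing x \<xi>))"
        by (simp add: Z_def power2_eq_square exp_add[symmetric])
      also have "\<dots> \<le> 4 * exp (norm (cbilinear \<xi> \<xi>)) * exp (2 * (\<bar>x (fst \<xi>)\<bar> + \<bar>x (snd \<xi>)\<bar>))"
        using norm_cpairing_le[of x \<xi>] by (intro mult_left_mono) auto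
      finally show ?thesis .
    qed
    then show "AE x in \<mu>. norm ((2 * Z x)\<^sup>2) \<le> norm (4 * exp (norm (cbilinear \<xi> \<xi>)) * exp (2 * (\<bar>x (fst \<xi>)\<bar> + \<bar>x (snd \<xi>)\<bar>)))"
      by (simp add: abs_mult)
  qed
  show "Lp_tendsto 2 \<mu> (\<lambda>N x. \<Sum>n<N. X n x) (exp_fun \<xi>) sequentially"
    unfolding Lp_tendsto_def
  proof (intro conjI exp_Lp)
    have "in_Lp 2 \<mu> (\<lambda>x. \<Sum>n<N. X n x)" for N
      by (induction N) (use X_Lp in_Lp_add[of 2] in \<open>auto simp: in_Lp_def[of _ _ "\<lambda>_. 0"]\<close>)
    then show "\<forall>\<^sub>F N in sequentially. in_Lp 2 \<mu> (\<lambda>x. \<Sum>n<N. X n x)" by simp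
    have "(\<lambda>N. \<integral>x. (norm ((\<Sum>n<N. X n x) - exp_fun \<xi> x))\<^sup>2 \<partial>\<mu>) \<longlonglongrightarrow> (\<integral>x. 0 \<partial>\<mu>)"
    proof (rule integral_dominated_convergence[OF _ _ Z_int])
      show "AE x in \<mu>. (\<lambda>N. (norm ((\<Sum>n<N. X n x) - exp_fun \<xi> x))\<^sup>2) \<longlonglongrightarrow> 0"
      proof (intro AE_I2)
        fix x
        have "(\<lambda>N. (\<Sum>n<N. X n x)) \<longlonglongrightarrow> exp_fun \<xi> x" using sums[of x] by (simp add: sums_def)
        then have "(\<lambda>N. (norm ((\<Sum>n<N. X n x) - exp_fun \<xi> x))\<^sup>2) \<longlonglongrightarrow> 0\<^sup>2"
          by (intro tendsto_power tendsto_norm_zero LIM_zero)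
        then show "(\<lambda>N. (norm ((\<Sum>n<N. X n x) - exp_fun \<xi> x))\<^sup>2) \<longlonglongrightarrow> 0" by simp
      qed
      have lim_le: "norm (exp_fun \<xi> x) \<le> Z x" for x
        using LIMSEQ_le_const2[OF tendsto_norm[OF sums[of x, unfolded sums_def]], of "Z x"] partial by blast
      have "norm ((\<Sum>n<N. X n x) - exp_fun \<xi> x) \<le> 2 * Z x" for N x
        using norm_triangle_ineq4[of "\<Sum>n<N. X n x" "exp_fun \<xi> x"] partial[of x N] lim_le[of x] by linarith
      then show "AE x in \<mu>. norm ((norm ((\<Sum>n<N. X n x) - exp_fun \<xi> x))\<^sup>2) \<le> (2 * Z x)\<^sup>2" for N
        by (intro AE_I2) (simp only: real_norm_def abs_power2, rule power_mono, auto)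
    qed measurable
    then show "(\<lambda>N. \<integral>x. norm ((\<Sum>n<N. X n x) - exp_fun \<xi> x) powr 2 \<partial>\<mu>) \<longlonglongrightarrow> 0"
      by (simp add: powr_numeral)
  qed
qed

end

section \<open>The S-transform\<close>

text \<open>The increments \<open>1 / (n + 1)\<close> turn the derivative into a limit of a
  sequence, as dominated convergence requires.\<close>

lemma difference_quotient_tendsto:
  assumes "(f has_real_derivative d) (at 0)"
  shows "(\<lambda>n. (f (1 / real (Suc n)) - f 0) * real (Suc n)) \<longlonglongrightarrow> d"
proof -
  have "((\<lambda>h. (f h - f 0) / h) \<longlongrightarrow> d) (at 0)"
    using assms by (simp add: DERIV_def)
  moreover have "filterlim (\<lambda>n. 1 / real (Suc n)) (at 0) sequentially"
    unfolding filterlim_at using LIMSEQ_inverse_real_of_nat by (simp add: inverse_eq_divide)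
  ultimately have "(\<lambda>n. (f (1 / real (Suc n)) - f 0) / (1 / real (Suc n))) \<longlonglongrightarrow> d"
    by (rule filterlim_compose)
  then show ?thesis by simp
qed

lemma abs_exp_minus_1_le: "\<bar>exp w - 1\<bar> \<le> \<bar>w\<bar> * exp \<bar>w\<bar>" for w :: real
proof (cases "0 \<le> w")
  case True
  have "(1 - w) * exp w \<le> exp (- w) * exp w"
    using exp_ge_add_one_self[of "- w"] by (intro mult_right_mono) auto
  then have "exp w - 1 \<le> w * exp w" by (simp add: exp_minus left_diff_distrib)
  then show ?thesis using True by simp
next
  case False
  have "1 - exp w \<le> - w * 1" using exp_ge_add_one_self[of w] by linarith
  also have "\<dots> \<le> - w * exp (- w)" using False by (intro mult_left_mono) auto
  finally show ?thesis using False by simp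
qed

lemma abs_le_exp_abs: "\<bar>y\<bar> \<le> exp \<bar>y\<bar>" for y :: real
  using exp_ge_add_one_self[of "\<bar>y\<bar>"] by linarith

text \<open>The product rule, with each factor removed by the same \<open>take\<close> and
  \<open>drop\<close> as in \<open>wick\<close>, so that its sum can cancel the contraction sum
  there.\<close>

lemma has_derivative_prod_list_inner:
  fixes a f :: "'a::real_inner"
  shows "((\<lambda>h. \<Prod>g\<leftarrow>fs. inner g (a + h *\<^sub>R f)) has_real_derivative
    (\<Sum>j<length fs. inner f (fs ! j) * (\<Prod>g\<leftarrow>take j fs @ drop (Suc j) fs. inner g a))) (at 0)"
proof (induction fs)
  case (Cons g fs)
  let ?d = "\<Sum>j<length fs. inner f (fs ! j) * (\<Prod>g\<leftarrow>take j fs @ drop (Suc j) fs. inner g a)"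
  have "((\<lambda>h. inner g (a + h *\<^sub>R f)) has_real_derivative inner g f) (at 0)"
    unfolding inner_add_right inner_scaleR_right by (auto intro!: derivative_eq_intros)
  from DERIV_mult[OF this Cons.IH]
  have "((\<lambda>h. \<Prod>g\<leftarrow>g # fs. inner g (a + h *\<^sub>R f)) has_real_derivative
      inner g f * (\<Prod>g\<leftarrow>fs. inner g a) + ?d * inner g a) (at 0)" by simp
  also have "inner g f * (\<Prod>g\<leftarrow>fs. inner g a) + ?d * inner g a =
    (\<Sum>j<length (g # fs). inner f ((g # fs) ! j) * (\<Prod>g\<leftarrow>take j (g # fs) @ drop (Suc j) (g # fs). inner g a))"
    unfolding length_Cons sum.lessThan_Suc_shift
    by (simp add: inner_commute[of f g] sum_distrib_left mult_ac)
  finally show ?case .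
qed simp

text \<open>Dedekind's argument. A nonempty set closed under addition suffices as domain, so
  inverses and a neutral element never enter.\<close>

lemma characters_independent:
  fixes ch :: "'i \<Rightarrow> 'g::ab_semigroup_add \<Rightarrow> complex" and c :: "'i \<Rightarrow> complex"
  assumes "finite I"
    and G: "\<And>a b. a \<in> G \<Longrightarrow> b \<in> G \<Longrightarrow> a + b \<in> G" "G \<noteq> {}"
    and mult: "\<And>i a b. a \<in> G \<Longrightarrow> b \<in> G \<Longrightarrow> ch i (a + b) = ch i a * ch i b"
    and nz: "\<And>i a. a \<in> G \<Longrightarrow> ch i a \<noteq> 0"
    and distinct: "\<And>i j. i \<in> I \<Longrightarrow> j \<in> I \<Longrightarrow> i \<noteq> j \<Longrightarrow> \<exists>a\<in>G. ch i a \<noteq> ch j a"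
    and zero: "\<And>a. a \<in> G \<Longrightarrow> (\<Sum>i\<in>I. c i * ch i a) = 0"
    and "i \<in> I"
  shows "c i = 0"
  using assms(1) distinct zero \<open>i \<in> I\<close>
proof (induction I arbitrary: c i rule: finite_induct)
  case (insert j F)
  have F: "c i = 0" if i: "i \<in> F" for i
  proof -
    obtain b where b: "b \<in> G" "ch i b \<noteq> ch j b"
      using insert.prems(1)[of i j] i insert.hyps by blast
    have "c i * (ch i b - ch j b) = 0"
    proof (rule insert.IH[of "\<lambda>i. c i * (ch i b - ch j b)"])
      show "\<exists>a\<in>G. ch k a \<noteq> ch l a" if "k \<in> F" "l \<in> F" "k \<noteq> l" for k l
        using insert.prems(1)[of k l] that by simp
      fix a assume a: "a \<in> G"
      \<comment> \<open>The relation at \<open>a + b\<close> minus \<open>ch j b\<close> times the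
        relation at \<open>a\<close>: the \<open>j\<close>-th term drops out, and the coefficient of
        \<open>i\<close> gets a nonzero factor.\<close>
      have "(\<Sum>k\<in>F. c k * (ch k b - ch j b) * ch k a) =
        (\<Sum>k\<in>insert j F. c k * ch k (a + b)) - ch j b * (\<Sum>k\<in>insert j F. c k * ch k a)"
        using insert.hyps mult[OF a b(1)]
        by (simp add: sum_distrib_left sum_subtractf[symmetric] algebra_simps)
      also have "\<dots> = 0" using insert.prems(2)[OF G(1)[OF a b(1)]] insert.prems(2)[OF a] by simp
      finally show "(\<Sum>k\<in>F. c k * (ch k b - ch j b) * ch k a) = 0" .
    qed (rule i)
    then show ?thesis using b(2) by simp
  qed
  have "c j = 0"
  proof -
    obtain a where a: "a \<in> G" using G(2) by auto
    have "(\<Sum>k\<in>F. c k * ch k a) = 0" by (intro sum.neutral) (simp add: F)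
    then have "c j * ch j a = 0" using insert.prems(2)[OF a] insert.hyps by simp
    then show ?thesis using nz[OF a] by simp
  qed
  then show ?case using F insert.prems(3) by auto
qed simp

context white_noise_setup
begin

section \<open>Differentiation under the Gaussian integral\<close>

lemma integral_exp_eval:
  assumes "a \<in> \<E>"
  shows "(\<integral>x. exp (x a) \<partial>\<mu>) = exp ((norm a)\<^sup>2 / 2)"
proof -
  have "complex_of_real (\<integral>x. exp (x a) \<partial>\<mu>) = (\<integral>x. exp (cpairing x (a, 0)) \<partial>\<mu>)"
    unfolding integral_complex_of_real[symmetric]
    by (intro Bochner_Integration.integral_cong) (auto simp: cpairing_def eval_0 exp_of_real[symmetric])
  also have "\<dots> = of_real (exp ((norm a)\<^sup>2 / 2))"
    using assms by (subst integral_exp_cpairing)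
      (auto simp: test_space_0 cbilinear_def dot_square_norm exp_of_real[symmetric])
  finally show ?thesis by (simp only: of_real_eq_iff)
qed

text \<open>A class that is stable under multiplication by pairings, so that it contains the Wick
  polynomials, and whose members allow differentiation of the exponential under the
  integral.\<close>

definition exp_integrable :: "(('e \<Rightarrow> real) \<Rightarrow> real) \<Rightarrow> bool" where
  "exp_integrable G \<longleftrightarrow> G \<in> borel_measurable \<mu> \<and> (\<forall>f\<in>\<E>. integrable \<mu> (\<lambda>x. G x * exp \<bar>x f\<bar>))"

lemma exp_integrable_1: "exp_integrable (\<lambda>x. 1)"
  using integrable_exp_abs[of _ 1] by (simp add: exp_integrable_def)

lemma exp_integrable_add: "exp_integrable G \<Longrightarrow> exp_integrable H \<Longrightarrow> exp_integrable (\<lambda>x. G x + H x)"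
  by (auto simp: exp_integrable_def distrib_right)

lemma exp_integrable_scale: "exp_integrable G \<Longrightarrow> exp_integrable (\<lambda>x. c * G x)"
  by (auto simp: exp_integrable_def mult.assoc)

lemma exp_integrable_sum:
  "finite I \<Longrightarrow> (\<And>i. i \<in> I \<Longrightarrow> exp_integrable (G i)) \<Longrightarrow> exp_integrable (\<lambda>x. \<Sum>i\<in>I. G i x)"
proof (induction I rule: finite_induct)
  case empty
  then show ?case using exp_integrable_scale[OF exp_integrable_1, of 0] by simp
qed (auto intro: exp_integrable_add)

text \<open>A product of two exponentials is at most the sum of their squares, so one test function
  at a time suffices. \<open>exp_integrable\<close> has no constant in the exponent; the factors
  \<open>2 * c\<close> and 2 are put into the test functions.\<close>

lemma exp_integrable_exp_exp:
  assumes G: "exp_integrable G" and g: "g \<in> \<E>" and f: "f \<in> \<E>" and c: "0 \<le> c"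
    and H: "H \<in> borel_measurable \<mu>" "\<And>x. \<bar>H x\<bar> \<le> exp (c * \<bar>x g\<bar>)"
  shows "integrable \<mu> (\<lambda>x. G x * H x * exp \<bar>x f\<bar>)"
proof (rule Bochner_Integration.integrable_bound)
  have g': "(2 * c) *\<^sub>R g \<in> \<E>" "2 *\<^sub>R f \<in> \<E>" using g f by (auto intro: test_space_scaleR)
  show "integrable \<mu> (\<lambda>x. \<bar>G x * exp \<bar>x ((2 * c) *\<^sub>R g)\<bar>\<bar> + \<bar>G x * exp \<bar>x (2 *\<^sub>R f)\<bar>\<bar>)"
    using G g' by (intro Bochner_Integration.integrable_add integrable_abs) (auto simp: exp_integrable_def)
  note [measurable] = measurable_eval[OF f] H(1)
  have [measurable]: "G \<in> borel_measurable \<mu>" using G by (simp add: exp_integrable_def)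
  show "(\<lambda>x. G x * H x * exp \<bar>x f\<bar>) \<in> borel_measurable \<mu>" by measurable
  show "AE x in \<mu>. norm (G x * H x * exp \<bar>x f\<bar>) \<le>
      norm (\<bar>G x * exp \<bar>x ((2 * c) *\<^sub>R g)\<bar>\<bar> + \<bar>G x * exp \<bar>x (2 *\<^sub>R f)\<bar>\<bar>)"
  proof (intro AE_I2)
    fix x assume x: "x \<in> space \<mu>"
    have e: "exp u * exp v \<le> exp (2 * u) + exp (2 * v)" for u v :: real
    proof -
      have "exp u * exp v = exp (u + v)" by (simp add: exp_add)
      also have "\<dots> \<le> exp (2 * u) + exp (2 * v)"
        by (cases "u \<le> v") (auto intro: order_trans[of _ "exp (2 * v)"] order_trans[of _ "exp (2 * u)"])
      finally show ?thesis .
    qed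
    have xg: "\<bar>x ((2 * c) *\<^sub>R g)\<bar> = 2 * (c * \<bar>x g\<bar>)" "\<bar>x (2 *\<^sub>R f)\<bar> = 2 * \<bar>x f\<bar>"
      using c by (simp_all only: eval_scaleR[OF x g] eval_scaleR[OF x f] abs_mult)
    have "\<bar>H x\<bar> * exp \<bar>x f\<bar> \<le> exp (c * \<bar>x g\<bar>) * exp \<bar>x f\<bar>" by (intro mult_right_mono H) auto
    also have "\<dots> \<le> exp (2 * (c * \<bar>x g\<bar>)) + exp (2 * \<bar>x f\<bar>)" by (rule e)
    finally have "\<bar>G x\<bar> * (\<bar>H x\<bar> * exp \<bar>x f\<bar>) \<le> \<bar>G x\<bar> * (exp (2 * (c * \<bar>x g\<bar>)) + exp (2 * \<bar>x f\<bar>))"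
      by (rule mult_left_mono) simp
    then show "norm (G x * H x * exp \<bar>x f\<bar>) \<le>
      norm (\<bar>G x * exp \<bar>x ((2 * c) *\<^sub>R g)\<bar>\<bar> + \<bar>G x * exp \<bar>x (2 *\<^sub>R f)\<bar>\<bar>)"
      unfolding xg by (simp add: abs_mult distrib_left)
  qed
qed

lemma exp_integrable_mult_eval:
  assumes G: "exp_integrable G" and g: "g \<in> \<E>"
  shows "exp_integrable (\<lambda>x. x g * G x)"
  unfolding exp_integrable_def
proof (intro conjI ballI)
  note [measurable] = measurable_eval[OF g]
  have [measurable]: "G \<in> borel_measurable \<mu>" using G by (simp add: exp_integrable_def)
  show "(\<lambda>x. x g * G x) \<in> borel_measurable \<mu>" by measurable
  fix f assume f: "f \<in> \<E>"
  have "\<bar>y\<bar> \<le> exp (1 * \<bar>y\<bar>)" for y :: real using abs_le_exp_abs by simp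
  from exp_integrable_exp_exp[OF G g f _ measurable_eval[OF g] this]
  show "integrable \<mu> (\<lambda>x. x g * G x * exp \<bar>x f\<bar>)" by (simp add: mult_ac)
qed

text \<open>Induction on the length, because the contracted lists in \<open>wick\<close> are shorter
  but need not be tails.\<close>

lemma exp_integrable_wick: "set fs \<subseteq> \<E> \<Longrightarrow> exp_integrable (\<lambda>x. wick x fs)"
proof (induction "length fs" arbitrary: fs rule: less_induct)
  case less
  show ?case
  proof (cases fs)
    case Nil
    then show ?thesis by (simp add: exp_integrable_1)
  next
    case (Cons f gs)
    have 1: "exp_integrable (\<lambda>x. x f * wick x gs)"
      using less Cons by (intro exp_integrable_mult_eval less.hyps) auto
    have "exp_integrable (\<lambda>x. \<Sum>j<length gs. inner f (gs ! j) * wick x (take j gs @ drop (Suc j) gs))"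
    proof (intro exp_integrable_sum exp_integrable_scale less.hyps)
      fix j assume "j \<in> {..<length gs}"
      then show "length (take j gs @ drop (Suc j) gs) < length fs" using Cons by simp
      show "set (take j gs @ drop (Suc j) gs) \<subseteq> \<E>"
        using less.prems Cons set_take_subset[of j gs] set_drop_subset[of "Suc j" gs] by auto
    qed simp
    from exp_integrable_add[OF 1 exp_integrable_scale[OF this, of "- 1"]]
    show ?thesis by (simp add: Cons)
  qed
qed

lemma exp_integrable_mult_exp:
  assumes G: "exp_integrable G" and a: "a \<in> \<E>"
  shows "integrable \<mu> (\<lambda>x. G x * exp (x a))"
proof (rule Bochner_Integration.integrable_bound)
  show "integrable \<mu> (\<lambda>x. G x * exp \<bar>x a\<bar>)" using assms by (simp add: exp_integrable_def)
  note [measurable] = measurable_eval[OF a]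
  have [measurable]: "G \<in> borel_measurable \<mu>" using G by (simp add: exp_integrable_def)
  show "(\<lambda>x. G x * exp (x a)) \<in> borel_measurable \<mu>" by measurable
  show "AE x in \<mu>. norm (G x * exp (x a)) \<le> norm (G x * exp \<bar>x a\<bar>)"
    by (intro AE_I2) (auto simp: abs_mult intro!: mult_left_mono)
qed

text \<open>Multiplication by \<open>x f\<close> is the derivative of the exponential in direction
  \<open>f\<close>. When the integrals along the line \<open>a + h *\<^sub>R f\<close> are known as
  \<open>R\<close>, the integral with the extra factor is the derivative of \<open>R\<close> at
  0.\<close>

lemma derivative_integral_exp:
  assumes G: "exp_integrable G" and a: "a \<in> \<E>" and f: "f \<in> \<E>"
    and R: "\<And>h. (\<integral>x. G x * exp (x (a + h *\<^sub>R f)) \<partial>\<mu>) = R h" and d: "(R has_real_derivative d) (at 0)"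
  shows "(\<integral>x. x f * G x * exp (x a) \<partial>\<mu>) = d"
proof -
  let ?s = "\<lambda>n x. G x * exp (x a) * ((exp (x f * (1 / real (Suc n))) - exp (x f * 0)) * real (Suc n))"
  note [measurable] = measurable_eval[OF a] measurable_eval[OF f]
  have [measurable]: "G \<in> borel_measurable \<mu>" using G by (simp add: exp_integrable_def)
  have "(\<lambda>n. \<integral>x. ?s n x \<partial>\<mu>) \<longlonglongrightarrow> (\<integral>x. x f * G x * exp (x a) \<partial>\<mu>)"
  proof (rule integral_dominated_convergence)
    \<comment> \<open>With \<open>w = x f / (n + 1)\<close>, the quotient is bounded by
      \<open>\<bar>x f\<bar> * exp \<bar>w\<bar>\<close>, hence by
      \<open>exp (2 * \<bar>x f\<bar>)\<close> for all \<open>n\<close>.\<close>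
    have "integrable \<mu> (\<lambda>x. G x * exp (2 * \<bar>x f\<bar>) * exp \<bar>x a\<bar>)"
      by (rule exp_integrable_exp_exp[OF G f a, where c = 2]) auto
    then show "integrable \<mu> (\<lambda>x. \<bar>G x * exp (2 * \<bar>x f\<bar>) * exp \<bar>x a\<bar>\<bar>)" by (rule integrable_abs)
    show "AE x in \<mu>. (\<lambda>n. ?s n x) \<longlonglongrightarrow> x f * G x * exp (x a)"
    proof (intro AE_I2)
      fix x :: "'e \<Rightarrow> real"
      have "((\<lambda>h. exp (x f * h)) has_real_derivative x f) (at 0)" by (auto intro!: derivative_eq_intros)
      from tendsto_mult_left[OF difference_quotient_tendsto[OF this], of "G x * exp (x a)"]
      show "(\<lambda>n. ?s n x) \<longlonglongrightarrow> x f * G x * exp (x a)" by (simp add: mult_ac)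
    qed
    show "AE x in \<mu>. norm (?s n x) \<le> \<bar>G x * exp (2 * \<bar>x f\<bar>) * exp \<bar>x a\<bar>\<bar>" for n
    proof (intro AE_I2)
      fix x :: "'e \<Rightarrow> real"
      define w where "w = x f * (1 / real (Suc n))"
      have w: "\<bar>w\<bar> * real (Suc n) = \<bar>x f\<bar>" by (simp add: w_def abs_mult del: of_nat_Suc)
      have w_le: "\<bar>w\<bar> \<le> \<bar>x f\<bar>"
      proof -
        have "\<bar>w\<bar> * 1 \<le> \<bar>w\<bar> * real (Suc n)" by (intro mult_left_mono) auto
        then show ?thesis using w by simp
      qed
      have "\<bar>(exp w - 1) * real (Suc n)\<bar> = \<bar>exp w - 1\<bar> * real (Suc n)" by (simp add: abs_mult del: of_nat_Suc)
      also have "\<dots> \<le> \<bar>w\<bar> * exp \<bar>w\<bar> * real (Suc n)"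
        by (intro mult_right_mono abs_exp_minus_1_le) simp
      also have "\<dots> = \<bar>x f\<bar> * exp \<bar>w\<bar>" using w by (simp add: mult_ac del: of_nat_Suc)
      also have "\<dots> \<le> exp \<bar>x f\<bar> * exp \<bar>x f\<bar>"
        using w_le by (intro mult_mono abs_le_exp_abs) auto
      also have "\<dots> = exp (2 * \<bar>x f\<bar>)" by (simp add: exp_add[symmetric])
      finally have "\<bar>(exp w - 1) * real (Suc n)\<bar> \<le> exp (2 * \<bar>x f\<bar>)" .
      then have "(\<bar>G x\<bar> * exp (x a)) * \<bar>(exp w - 1) * real (Suc n)\<bar> \<le> (\<bar>G x\<bar> * exp \<bar>x a\<bar>) * exp (2 * \<bar>x f\<bar>)"
        by (intro mult_mono mult_left_mono) auto
      then show "norm (?s n x) \<le> \<bar>G x * exp (2 * \<bar>x f\<bar>) * exp \<bar>x a\<bar>\<bar>"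
        unfolding w_def[symmetric] by (simp add: abs_mult mult_ac del: of_nat_Suc)
    qed
  qed measurable
  also have "(\<lambda>n. \<integral>x. ?s n x \<partial>\<mu>) = (\<lambda>n. (R (1 / real (Suc n)) - R 0) * real (Suc n))"
  proof
    fix n
    have int: "integrable \<mu> (\<lambda>x. G x * exp (x (a + h *\<^sub>R f)))" for h
      using a f by (intro exp_integrable_mult_exp G test_space_add test_space_scaleR)
    have "(\<integral>x. ?s n x \<partial>\<mu>) =
      (\<integral>x. (G x * exp (x (a + (1 / real (Suc n)) *\<^sub>R f)) - G x * exp (x (a + 0 *\<^sub>R f))) * real (Suc n) \<partial>\<mu>)"
      by (intro Bochner_Integration.integral_cong refl)
         (simp add: eval_add eval_scaleR test_space_scaleR a f exp_add algebra_simps del: of_nat_Suc scaleR_zero_left)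
    also have "\<dots> = (R (1 / real (Suc n)) - R 0) * real (Suc n)"
      unfolding R[symmetric] using int by (simp del: of_nat_Suc scaleR_zero_left)
    finally show "(\<integral>x. ?s n x \<partial>\<mu>) = (R (1 / real (Suc n)) - R 0) * real (Suc n)" .
  qed
  finally show ?thesis using difference_quotient_tendsto[OF d] LIMSEQ_unique by blast
qed

text \<open>Differentiating the formula for the tail in the direction of the first vector gives two
  terms: the derivative of the Gaussian factor is the new factor of the product, and the derivative
  of the product is exactly what the contractions in \<open>wick\<close> subtract.\<close>

lemma integral_wick_exp:
  "set fs \<subseteq> \<E> \<Longrightarrow> a \<in> \<E> \<Longrightarrow>
    (\<integral>x. wick x fs * exp (x a) \<partial>\<mu>) = exp ((norm a)\<^sup>2 / 2) * (\<Prod>f\<leftarrow>fs. inner f a)"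
proof (induction "length fs" arbitrary: fs a rule: less_induct)
  case less
  show ?case
  proof (cases fs)
    case Nil
    then show ?thesis using integral_exp_eval[OF less.prems(2)] by simp
  next
    case (Cons f gs)
    have f: "f \<in> \<E>" and gs: "set gs \<subseteq> \<E>" and a: "a \<in> \<E>" using less.prems Cons by auto
    let ?del = "\<lambda>j. take j gs @ drop (Suc j) gs"
    have del: "set (?del j) \<subseteq> \<E>" for j
      using gs set_take_subset[of j gs] set_drop_subset[of "Suc j" gs] by auto
    \<comment> \<open>The induction hypothesis at \<open>a + h *\<^sub>R f\<close>, with the squared
      norm expanded in \<open>h\<close>. For this, \<open>a\<close> is kept arbitrary in the
      induction.\<close>
    let ?R = "\<lambda>h. exp ((norm a)\<^sup>2 / 2 + h * inner a f + h\<^sup>2 * (norm f)\<^sup>2 / 2) * (\<Prod>g\<leftarrow>gs. inner g (a + h *\<^sub>R f))"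
    let ?d = "\<Sum>j<length gs. inner f (gs ! j) * (\<Prod>g\<leftarrow>?del j. inner g a)"
    have R: "(\<integral>x. wick x gs * exp (x (a + h *\<^sub>R f)) \<partial>\<mu>) = ?R h" for h
    proof -
      have "(norm (a + h *\<^sub>R f))\<^sup>2 / 2 = (norm a)\<^sup>2 / 2 + h * inner a f + h\<^sup>2 * (norm f)\<^sup>2 / 2"
        unfolding power2_norm_eq_inner
        by (simp add: inner_add_left inner_add_right inner_commute power2_eq_square field_simps)
      then show ?thesis
        using less.hyps[of gs "a + h *\<^sub>R f"] gs a f Cons by (simp add: test_space_add test_space_scaleR)
    qed
    have "(?R has_real_derivative
        exp ((norm a)\<^sup>2 / 2) * inner a f * (\<Prod>g\<leftarrow>gs. inner g a) + ?d * exp ((norm a)\<^sup>2 / 2)) (at 0)"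
    proof -
      have "((\<lambda>h. exp ((norm a)\<^sup>2 / 2 + h * inner a f + h\<^sup>2 * (norm f)\<^sup>2 / 2)) has_real_derivative
        exp ((norm a)\<^sup>2 / 2) * inner a f) (at 0)" by (auto intro!: derivative_eq_intros)
      from DERIV_mult[OF this has_derivative_prod_list_inner[where fs = gs and a = a and f = f]]
      show ?thesis by simp
    qed
    from derivative_integral_exp[OF exp_integrable_wick[OF gs] a f R this]
    have 1: "(\<integral>x. x f * wick x gs * exp (x a) \<partial>\<mu>) =
      exp ((norm a)\<^sup>2 / 2) * inner a f * (\<Prod>g\<leftarrow>gs. inner g a) + ?d * exp ((norm a)\<^sup>2 / 2)" .
    have i1: "integrable \<mu> (\<lambda>x. x f * wick x gs * exp (x a))"
      by (intro exp_integrable_mult_exp exp_integrable_mult_eval exp_integrable_wick gs a f)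
    have i2: "integrable \<mu> (\<lambda>x. wick x (?del j) * exp (x a))" for j
      by (intro exp_integrable_mult_exp exp_integrable_wick del a)
    have "(\<integral>x. wick x fs * exp (x a) \<partial>\<mu>) =
      (\<integral>x. x f * wick x gs * exp (x a) - (\<Sum>j<length gs. inner f (gs ! j) * (wick x (?del j) * exp (x a))) \<partial>\<mu>)"
      by (simp add: Cons left_diff_distrib sum_distrib_right mult.assoc)
    also have "\<dots> = (\<integral>x. x f * wick x gs * exp (x a) \<partial>\<mu>) -
        (\<Sum>j<length gs. inner f (gs ! j) * (\<integral>x. wick x (?del j) * exp (x a) \<partial>\<mu>))"
      using i1 i2 by (subst Bochner_Integration.integral_diff) (auto simp: integral_mult_right_zero)
    also have "(\<Sum>j<length gs. inner f (gs ! j) * (\<integral>x. wick x (?del j) * exp (x a) \<partial>\<mu>)) = ?d * exp ((norm a)\<^sup>2 / 2)"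
      unfolding sum_distrib_right
    proof (intro sum.cong refl)
      fix j assume "j \<in> {..<length gs}"
      then have "length (?del j) < length fs" using Cons by simp
      from less.hyps[OF this del a]
      show "inner f (gs ! j) * (\<integral>x. wick x (?del j) * exp (x a) \<partial>\<mu>) =
        inner f (gs ! j) * (\<Prod>g\<leftarrow>?del j. inner g a) * exp ((norm a)\<^sup>2 / 2)" by (simp only: mult_ac)
    qed
    finally show ?thesis unfolding 1 by (simp add: Cons inner_commute[of a f] mult_ac)
  qed
qed

section \<open>The S-transform at real arguments\<close>

definition S :: "(('e \<Rightarrow> real) \<Rightarrow> complex) \<Rightarrow> 'e \<Rightarrow> complex" where
  "S \<phi> a = (\<integral>x. \<phi> x * exp_fun (a, 0) x \<partial>\<mu>)"

lemma exp_fun_real: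
  "x \<in> space \<mu> \<Longrightarrow> exp_fun (a, 0) x = of_real (exp (x a) / exp ((norm a)\<^sup>2 / 2))"
  by (simp add: exp_fun_def cpairing_def cbilinear_def eval_0 dot_square_norm exp_diff exp_of_real[symmetric])

lemma S_wick:
  assumes "set fs \<subseteq> \<E>" "a \<in> \<E>"
  shows "S (\<lambda>x. of_real (wick x fs)) a = of_real (\<Prod>f\<leftarrow>fs. inner f a)"
    and "integrable \<mu> (\<lambda>x. of_real (wick x fs) * exp_fun (a, 0) x)"
proof -
  have eq: "of_real (wick x fs) * exp_fun (a, 0) x = of_real (wick x fs * exp (x a) / exp ((norm a)\<^sup>2 / 2))"
    if "x \<in> space \<mu>" for x using that by (simp add: exp_fun_real)
  have "S (\<lambda>x. of_real (wick x fs)) a = (\<integral>x. complex_of_real (wick x fs * exp (x a) / exp ((norm a)\<^sup>2 / 2)) \<partial>\<mu>)"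
    unfolding S_def by (intro Bochner_Integration.integral_cong eq) auto
  also have "\<dots> = of_real (\<Prod>f\<leftarrow>fs. inner f a)"
    unfolding integral_complex_of_real using integral_wick_exp[OF assms] by simp
  finally show "S (\<lambda>x. of_real (wick x fs)) a = of_real (\<Prod>f\<leftarrow>fs. inner f a)" .
  have "integrable \<mu> (\<lambda>x. complex_of_real (wick x fs * exp (x a) / exp ((norm a)\<^sup>2 / 2)))"
    using exp_integrable_mult_exp[OF exp_integrable_wick[OF assms(1)] assms(2)] by (simp del: of_real_mult of_real_divide)
  also have "?this \<longleftrightarrow> integrable \<mu> (\<lambda>x. of_real (wick x fs) * exp_fun (a, 0) x)"
    by (intro Bochner_Integration.integrable_cong) (auto simp: eq)
  finally show "integrable \<mu> (\<lambda>x. of_real (wick x fs) * exp_fun (a, 0) x)" .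
qed

lemma S_tendsto:
  assumes "Lp_tendsto 2 \<mu> F \<phi> flt" "a \<in> \<E>"
  shows "((\<lambda>i. S (F i) a) \<longlongrightarrow> S \<phi> a) flt"
  unfolding S_def using assms by (intro Lp_tendsto_integral_mult in_Lp_exp_fun) (auto simp: test_space_0)

text \<open>Since \<open>a\<close> has no coordinates from \<open>M\<close> on, lists with larger
  entries contribute 0 and the limits in \<open>N\<close> are eventually constant. The statement
  holds for every coefficient family that represents \<phi>, whichever one a choice
  provides.\<close>

lemma S_wiener_ito:
  assumes "wiener_ito W \<phi> f" and a: "proj M a = a"
  shows "(\<lambda>n. \<Sum>ks | length ks = n \<and> set ks \<subseteq> {..<M}. f n ks * of_real (\<Prod>i\<leftarrow>ks. inner (e i) a)) sums S \<phi> a"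
proof -
  let ?V = "\<lambda>N n. {ks :: nat list. length ks = n \<and> set ks \<subseteq> {..<N}}"
  have fin: "finite (?V N n)" for N n
    using finite_lists_length_eq[of "{..<N}" n] by (simp add: conj_commute)
  have aE: "a \<in> \<E>" using proj_test_space[of M a] a by simp
  have a0: "inner (e i) a = 0" if "\<not> i < M" for i
    using inner_proj_basis[of M a i] that by (simp add: a inner_commute)
  obtain X where X: "\<And>n. Lp_tendsto 2 \<mu> (\<lambda>N x. \<Sum>ks\<in>?V N n. f n ks * complex_of_real (wick x (map e ks))) (X n) sequentially"
    and X\<phi>: "Lp_tendsto 2 \<mu> (\<lambda>N x. \<Sum>n<N. X n x) \<phi> sequentially"
    using assms(1) unfolding wiener_ito_def by blast
  have W: "set (map e ks) \<subseteq> \<E>" for ks using basis_test_space by auto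
  have S_sum: "S (\<lambda>x. \<Sum>ks\<in>?V N n. f n ks * complex_of_real (wick x (map e ks))) a =
    (\<Sum>ks\<in>?V N n. f n ks * of_real (\<Prod>i\<leftarrow>ks. inner (e i) a))" for N n
  proof -
    have "S (\<lambda>x. \<Sum>ks\<in>?V N n. f n ks * complex_of_real (wick x (map e ks))) a =
      (\<Sum>ks\<in>?V N n. f n ks * S (\<lambda>x. of_real (wick x (map e ks))) a)"
      unfolding S_def sum_distrib_right mult.assoc
      using S_wick(2)[OF W aE] by (subst Bochner_Integration.integral_sum) auto
    then show ?thesis by (simp add: S_wick(1)[OF W aE] o_def)
  qed
  have S_X: "S (X n) a = (\<Sum>ks\<in>?V M n. f n ks * of_real (\<Prod>i\<leftarrow>ks. inner (e i) a))" for n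
  proof (rule LIMSEQ_unique)
    show "(\<lambda>N. \<Sum>ks\<in>?V N n. f n ks * of_real (\<Prod>i\<leftarrow>ks. inner (e i) a)) \<longlonglongrightarrow> S (X n) a"
      using S_tendsto[OF X aE, of n] by (simp only: S_sum)
    have "(\<Sum>ks\<in>?V N n. f n ks * of_real (\<Prod>i\<leftarrow>ks. inner (e i) a)) =
        (\<Sum>ks\<in>?V M n. f n ks * of_real (\<Prod>i\<leftarrow>ks. inner (e i) a))" if "M \<le> N" for N
    proof (rule sum.mono_neutral_right[OF fin])
      show "?V M n \<subseteq> ?V N n" using that by auto
      show "\<forall>ks\<in>?V N n - ?V M n. f n ks * of_real (\<Prod>i\<leftarrow>ks. inner (e i) a) = 0"
      proof
        fix ks assume "ks \<in> ?V N n - ?V M n"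
        then obtain i where "i \<in> set ks" "\<not> i < M" by auto
        then have "(\<Prod>i\<leftarrow>ks. inner (e i) a) = 0" using a0[of i] by (auto simp: prod_list_zero_iff image_iff)
        then show "f n ks * of_real (\<Prod>i\<leftarrow>ks. inner (e i) a) = 0" by simp
      qed
    qed
    then show "(\<lambda>N. \<Sum>ks\<in>?V N n. f n ks * of_real (\<Prod>i\<leftarrow>ks. inner (e i) a)) \<longlonglongrightarrow>
        (\<Sum>ks\<in>?V M n. f n ks * of_real (\<Prod>i\<leftarrow>ks. inner (e i) a))"
      by (intro tendsto_eventually eventually_sequentiallyI[of M])
  qed
  have "in_Lp 2 \<mu> (X n)" for n using X[of n] by (simp add: Lp_tendsto_def)
  then have "integrable \<mu> (\<lambda>x. X n x * exp_fun (a, 0) x)" for n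
    using aE by (intro integrable_mult_L2 in_Lp_exp_fun) (auto simp: test_space_0)
  then have "S (\<lambda>x. \<Sum>n<N. X n x) a = (\<Sum>n<N. S (X n) a)" for N
    unfolding S_def sum_distrib_right by (subst Bochner_Integration.integral_sum) auto
  then show ?thesis
    using S_tendsto[OF X\<phi> aE] unfolding sums_def S_X[symmetric] by simp
qed

text \<open>The eigenvalues in the coefficients are absorbed by the argument. The transformed vector
  is a finite sum, so it exists also for unbounded \<open>b\<close>. Hence the S-transform of \<psi>
  is determined by that of \<phi>.\<close>

lemma S_diagonal:
  assumes "wiener_ito W \<phi> f" "wiener_ito W \<psi> (\<lambda>n ks. complex_of_real (\<Prod>i\<leftarrow>ks. b i) * f n ks)"
    and a: "proj M a = a"
  shows "S \<psi> a = S \<phi> (\<Sum>i<M. (b i * inner a (e i)) *\<^sub>R e i)"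
proof -
  define v where "v = (\<Sum>i<M. (b i * inner a (e i)) *\<^sub>R e i)"
  have b: "inner (e i) v = (if i < M then b i * inner a (e i) else 0)" for i
    using inner_sum_basis[of "{..<M}" "\<lambda>i. b i * inner a (e i)" i] by (simp add: v_def inner_commute)
  have "proj M v = v"
    by (simp add: v_def vector_eq_iff_coeff inner_proj_basis inner_sum_basis)
  from S_wiener_ito[OF assms(1) this]
  have 1: "(\<lambda>n. \<Sum>ks | length ks = n \<and> set ks \<subseteq> {..<M}. f n ks * of_real (\<Prod>i\<leftarrow>ks. inner (e i) v)) sums S \<phi> v" .
  have eq: "f n ks * of_real (\<Prod>i\<leftarrow>ks. inner (e i) v) =
      complex_of_real (\<Prod>i\<leftarrow>ks. b i) * f n ks * of_real (\<Prod>i\<leftarrow>ks. inner (e i) a)" if "set ks \<subseteq> {..<M}" for n ks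
  proof -
    have "(\<Prod>i\<leftarrow>ks. inner (e i) v) = (\<Prod>i\<leftarrow>ks. b i) * (\<Prod>i\<leftarrow>ks. inner (e i) a)"
      using that by (induction ks) (auto simp: b inner_commute[of a])
    then show ?thesis by simp
  qed
  have eq2: "(\<lambda>n. \<Sum>ks | length ks = n \<and> set ks \<subseteq> {..<M}. f n ks * of_real (\<Prod>i\<leftarrow>ks. inner (e i) v)) =
    (\<lambda>n. \<Sum>ks | length ks = n \<and> set ks \<subseteq> {..<M}. complex_of_real (\<Prod>i\<leftarrow>ks. b i) * f n ks * of_real (\<Prod>i\<leftarrow>ks. inner (e i) a))"
    by (intro ext sum.cong refl eq) simp
  from sums_unique2[OF S_wiener_ito[OF assms(2) a] 1[unfolded eq2]] show ?thesis
    unfolding v_def .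
qed

lemma S_sum_exp_fun:
  assumes "finite I" "\<And>i. i \<in> I \<Longrightarrow> \<xi> i \<in> \<E> \<times> \<E>" "a \<in> \<E>"
  shows "S (\<lambda>x. \<Sum>i\<in>I. c i * exp_fun (\<xi> i) x) a = (\<Sum>i\<in>I. c i * exp (cbilinear (\<xi> i) (a, 0)))"
proof -
  have a: "(a, 0) \<in> \<E> \<times> \<E>" using assms(3) by (simp add: test_space_0)
  have "integrable \<mu> (\<lambda>x. exp_fun (\<xi> i) x * exp_fun (a, 0) x)" if "i \<in> I" for i
    using assms(2)[OF that] a by (intro integrable_mult_L2 in_Lp_exp_fun) auto
  then have "S (\<lambda>x. \<Sum>i\<in>I. c i * exp_fun (\<xi> i) x) a = (\<Sum>i\<in>I. c i * (\<integral>x. exp_fun (\<xi> i) x * exp_fun (a, 0) x \<partial>\<mu>))"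
    unfolding S_def sum_distrib_right mult.assoc by (subst Bochner_Integration.integral_sum) auto
  then show ?thesis using integral_exp_fun_mult[OF assms(2) a] by simp
qed

text \<open>The S-transforms of exponential functions are characters of the additive set of vectors
  with finitely many coordinates. Different frequencies differ in some coordinate \<open>k\<close>,
  and a small multiple of \<open>e k\<close> separates the characters.\<close>

lemma exp_fun_independent:
  assumes F: "finite F" "F \<subseteq> \<E> \<times> \<E>"
    and zero: "\<And>M a. proj M a = a \<Longrightarrow> (\<Sum>\<xi>\<in>F. c \<xi> * exp (cbilinear \<xi> (a, 0))) = 0"
    and "\<xi> \<in> F"
  shows "c \<xi> = 0"
proof (rule characters_independent[where G = "{a. \<exists>M. proj M a = a}" and ch = "\<lambda>\<xi> a. exp (cbilinear \<xi> (a, 0))", OF F(1)])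
  have mono: "proj N a = a" if "proj M a = a" "M \<le> N" for M N a
  proof -
    have "inner a (e n) = 0" if "\<not> n < M" for n
      using inner_proj_basis[of M a n] that by (simp add: \<open>proj M a = a\<close>)
    then show ?thesis using that(2) by (auto simp: vector_eq_iff_coeff inner_proj_basis)
  qed
  show "a + b \<in> {a. \<exists>M. proj M a = a}" if ab: "a \<in> {a. \<exists>M. proj M a = a}" "b \<in> {a. \<exists>M. proj M a = a}" for a b
  proof -
    from ab obtain M1 M2 where "proj M1 a = a" "proj M2 b = b" by auto
    then have "proj (max M1 M2) (a + b) = a + b"
      using mono[of M1 a "max M1 M2"] mono[of M2 b "max M1 M2"] linear_add[OF linear_proj] by simp
    then show ?thesis by blast
  qed
  show "{a. \<exists>M. proj M a = a} \<noteq> {}"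
    using linear_0[OF linear_proj, of 0] by auto
  show "exp (cbilinear i (a + b, 0)) = exp (cbilinear i (a, 0)) * exp (cbilinear i (b, 0))" for i and a b :: 'e
    using cbilinear_add(2)[of i "(a, 0)" "(b, 0)"] by (simp add: exp_add)
  show "\<exists>a\<in>{a. \<exists>M. proj M a = a}. exp (cbilinear i (a, 0)) \<noteq> exp (cbilinear j (a, 0))" if ij: "i \<noteq> j" for i j :: "'e \<times> 'e"
  proof -
    obtain k where k: "cf i k \<noteq> cf j k" using ij cf_eq_iff[of i j] by auto
    define z where "z = cf i k - cf j k"
    have z: "z \<noteq> 0" using k by (simp add: z_def)
    \<comment> \<open>This scaling gives the difference of the exponents modulus 1, too small for a
      nonzero multiple of 2 \<pi> i.\<close>
    define t where "t = 1 / norm z"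
    define a where "a = t *\<^sub>R e k"
    have cb: "cbilinear l (a, 0) = of_real t * cf l k" for l
      by (simp add: cbilinear_def a_def cf_def complex_eq_iff)
    have "exp (of_real t * z) \<noteq> 1"
    proof
      assume "exp (of_real t * z) = 1"
      then obtain n :: int where n: "Re (of_real t * z) = 0" "Im (of_real t * z) = of_int (2 * n) * pi"
        by (auto simp: exp_eq_1)
      have "norm (of_real t * z) = 1" using z by (simp add: t_def norm_mult norm_divide)
      then have "\<bar>of_int (2 * n) * pi\<bar> = 1" unfolding cmod_eq_Im[OF n(1)] n(2) .
      then have "\<bar>real_of_int (2 * n)\<bar> * pi = 1" by (simp add: abs_mult)
      moreover have "\<bar>real_of_int (2 * n)\<bar> = 0 \<or> 1 \<le> \<bar>real_of_int (2 * n)\<bar>" by (cases "n = 0") auto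
      ultimately show False using pi_gt3 mult_right_mono[of 1 "\<bar>real_of_int (2 * n)\<bar>" pi] by auto
    qed
    then have "exp (cbilinear i (a, 0)) \<noteq> exp (cbilinear j (a, 0))"
      unfolding cb by (auto simp: z_def right_diff_distrib exp_diff)
    moreover have "proj (Suc k) a = a"
      by (auto simp: vector_eq_iff_coeff inner_proj_basis a_def inner_basis)
    ultimately show ?thesis by blast
  qed
qed (use zero \<open>\<xi> \<in> F\<close> in auto)

text \<open>The equality holds at every point, not just almost everywhere: written over the union of
  their frequencies, both functions have the same coefficients.\<close>

lemma Exp_eqI:
  assumes "\<psi>1 \<in> Exp W" "\<psi>2 \<in> Exp W" and eq: "\<And>M a. proj M a = a \<Longrightarrow> S \<psi>1 a = S \<psi>2 a"
  shows "\<psi>1 = \<psi>2"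
proof -
  obtain F1 c1 where 1: "\<psi>1 = (\<lambda>x. \<Sum>\<xi>\<in>F1. c1 \<xi> * exp_fun \<xi> x)" "finite F1" "F1 \<subseteq> \<E> \<times> \<E>"
    using assms(1) unfolding Exp_def by blast
  obtain F2 c2 where 2: "\<psi>2 = (\<lambda>x. \<Sum>\<xi>\<in>F2. c2 \<xi> * exp_fun \<xi> x)" "finite F2" "F2 \<subseteq> \<E> \<times> \<E>"
    using assms(2) unfolding Exp_def by blast
  define F where "F = F1 \<union> F2"
  define d1 where "d1 \<xi> = (if \<xi> \<in> F1 then c1 \<xi> else 0)" for \<xi>
  define d2 where "d2 \<xi> = (if \<xi> \<in> F2 then c2 \<xi> else 0)" for \<xi>
  have F: "finite F" "F \<subseteq> \<E> \<times> \<E>" using 1 2 by (auto simp: F_def)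
  have e1: "\<psi>1 = (\<lambda>x. \<Sum>\<xi>\<in>F. d1 \<xi> * exp_fun \<xi> x)"
    unfolding 1(1) using F(1) by (intro ext sum.mono_neutral_cong_left) (auto simp: F_def d1_def)
  have e2: "\<psi>2 = (\<lambda>x. \<Sum>\<xi>\<in>F. d2 \<xi> * exp_fun \<xi> x)"
    unfolding 2(1) using F(1) by (intro ext sum.mono_neutral_cong_left) (auto simp: F_def d2_def)
  have "d1 \<xi> - d2 \<xi> = 0" if "\<xi> \<in> F" for \<xi>
  proof (rule exp_fun_independent[OF F _ that])
    fix M a assume a: "proj M a = a"
    then have "a \<in> \<E>" using proj_test_space[of M a] by simp
    then have "S \<psi>1 a = (\<Sum>\<xi>\<in>F. d1 \<xi> * exp (cbilinear \<xi> (a, 0)))" "S \<psi>2 a = (\<Sum>\<xi>\<in>F. d2 \<xi> * exp (cbilinear \<xi> (a, 0)))"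
      unfolding e1 e2 using F by (auto intro!: S_sum_exp_fun)
    then show "(\<Sum>\<xi>\<in>F. (d1 \<xi> - d2 \<xi>) * exp (cbilinear \<xi> (a, 0))) = 0"
      using eq[OF a] by (simp add: left_diff_distrib sum_subtractf)
  qed
  then show ?thesis unfolding e1 e2 by (intro ext sum.cong) auto
qed

end

section \<open>Second quantization and the \<open>T\<close>-Wick product\<close>

text \<open>The explicit form of the regularised product is available only for positive \<epsilon>,
  that is, eventually in the filter at the right of 0.\<close>

lemma Lp_tendsto_cong_eventually:
  assumes "\<forall>\<^sub>F i in flt. \<forall>x\<in>space M. F i x = G i x" and G: "Lp_tendsto p M G f flt"
  shows "Lp_tendsto p M F f flt"
proof (rule Lp_tendsto_boundedI)
  show "in_Lp p M f" using G by (simp add: Lp_tendsto_def)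
  have "\<forall>\<^sub>F i in flt. in_Lp p M (G i)" using G by (simp add: Lp_tendsto_def)
  with assms(1) show "\<forall>\<^sub>F i in flt. in_Lp p M (F i)"
    by eventually_elim (metis in_Lp_cong)
  show "((\<lambda>i. \<integral>x. norm (G i x - f x) powr p \<partial>M) \<longlongrightarrow> 0) flt"
    using G by (simp add: Lp_tendsto_def)
  from assms(1) show "\<forall>\<^sub>F i in flt. (\<integral>x. norm (F i x - f x) powr p \<partial>M) \<le> (\<integral>x. norm (G i x - f x) powr p \<partial>M)"
    by eventually_elim (intro eq_refl Bochner_Integration.integral_cong, auto)
qed

lemma sym_tensor_scale: "sym_tensor n f \<Longrightarrow> sym_tensor n (\<lambda>ks. c * f ks)"
  by (auto simp: sym_tensor_def norm_mult power_mult_distrib intro: summable_on_cmult_right)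

lemma sym_tensor_add:
  assumes "sym_tensor n f" "sym_tensor n g"
  shows "sym_tensor n (\<lambda>ks. f ks + g ks)"
proof -
  have "(\<lambda>ks. (norm (f ks + g ks))\<^sup>2) summable_on {ks. length ks = n}"
  proof (rule summable_on_comparison_test)
    show "(\<lambda>ks. 2 * (norm (f ks))\<^sup>2 + 2 * (norm (g ks))\<^sup>2) summable_on {ks. length ks = n}"
      using assms by (intro summable_on_add summable_on_cmult_right) (auto simp: sym_tensor_def)
    show "(norm (f ks + g ks))\<^sup>2 \<le> 2 * (norm (f ks))\<^sup>2 + 2 * (norm (g ks))\<^sup>2" for ks
    proof -
      have "(norm (f ks + g ks))\<^sup>2 \<le> (norm (f ks) + norm (g ks))\<^sup>2"
        by (intro power_mono norm_triangle_ineq) simp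
      also have "\<dots> \<le> 2 * (norm (f ks))\<^sup>2 + 2 * (norm (g ks))\<^sup>2"
        using sum_squares_bound[of "norm (f ks)" "norm (g ks)"] by (simp add: power2_sum)
      finally show ?thesis .
    qed
  qed simp
  moreover have "f ks + g ks = f js + g js" if "length ks = n" "mset ks = mset js" for ks js
    using assms that unfolding sym_tensor_def by metis
  ultimately show ?thesis unfolding sym_tensor_def by blast
qed

lemma sym_tensor_sum:
  "finite I \<Longrightarrow> (\<And>i. i \<in> I \<Longrightarrow> sym_tensor n (f i)) \<Longrightarrow> sym_tensor n (\<lambda>ks. \<Sum>i\<in>I. c i * f i ks)"
proof (induction I rule: finite_induct)
  case empty
  show ?case by (simp add: sym_tensor_def)
next
  case (insert j I)
  then show ?case by (simp add: sym_tensor_add sym_tensor_scale)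
qed

context white_noise_setup
begin

lemma wiener_ito_cong:
  assumes "\<And>x. x \<in> space \<mu> \<Longrightarrow> \<phi> x = \<psi> x"
  shows "wiener_ito W \<phi> f \<longleftrightarrow> wiener_ito W \<psi> f"
proof -
  have "Lp_tendsto 2 \<mu> F \<phi> sequentially \<longleftrightarrow> Lp_tendsto 2 \<mu> F \<psi> sequentially" for F :: "nat \<Rightarrow> _"
    using assms by (intro Lp_tendsto_cong) auto
  then show ?thesis unfolding wiener_ito_def by simp
qed

lemma wiener_ito_sum:
  assumes I: "finite I" and "\<And>i. i \<in> I \<Longrightarrow> wiener_ito W (\<phi> i) (f i)"
  shows "wiener_ito W (\<lambda>x. \<Sum>i\<in>I. c i * \<phi> i x) (\<lambda>n ks. \<Sum>i\<in>I. c i * f i n ks)"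
proof -
  have "\<exists>X. \<forall>i\<in>I. (\<forall>n. sym_tensor n (f i n) \<and>
      Lp_tendsto 2 \<mu> (\<lambda>N x. \<Sum>ks | length ks = n \<and> set ks \<subseteq> {..<N}. f i n ks * complex_of_real (wick x (map e ks)))
        (X i n) sequentially) \<and> Lp_tendsto 2 \<mu> (\<lambda>N x. \<Sum>n<N. X i n x) (\<phi> i) sequentially"
    using assms(2) unfolding wiener_ito_def by (intro bchoice) blast
  then obtain X where X: "\<And>i n. i \<in> I \<Longrightarrow> sym_tensor n (f i n)"
    "\<And>i n. i \<in> I \<Longrightarrow> Lp_tendsto 2 \<mu> (\<lambda>N x. \<Sum>ks | length ks = n \<and> set ks \<subseteq> {..<N}. f i n ks * complex_of_real (wick x (map e ks)))
        (X i n) sequentially" "\<And>i. i \<in> I \<Longrightarrow> Lp_tendsto 2 \<mu> (\<lambda>N x. \<Sum>n<N. X i n x) (\<phi> i) sequentially"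
    by blast
  show ?thesis
    unfolding wiener_ito_def
  proof (intro exI[of _ "\<lambda>n x. \<Sum>i\<in>I. c i * X i n x"] conjI allI)
    show "sym_tensor n (\<lambda>ks. \<Sum>i\<in>I. c i * f i n ks)" for n
      by (intro sym_tensor_sum I X)
    have "Lp_tendsto 2 \<mu> (\<lambda>N x. \<Sum>i\<in>I. c i * (\<Sum>ks | length ks = n \<and> set ks \<subseteq> {..<N}. f i n ks * complex_of_real (wick x (map e ks))))
        (\<lambda>x. \<Sum>i\<in>I. c i * X i n x) sequentially" for n
      by (intro Lp_tendsto_sum I Lp_tendsto_mult_const X) auto
    also have "(\<lambda>N x. \<Sum>i\<in>I. c i * (\<Sum>ks | length ks = n \<and> set ks \<subseteq> {..<N}. f i n ks * complex_of_real (wick x (map e ks)))) =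
      (\<lambda>N x. \<Sum>ks | length ks = n \<and> set ks \<subseteq> {..<N}. (\<Sum>i\<in>I. c i * f i n ks) * complex_of_real (wick x (map e ks)))" for n
      unfolding sum_distrib_left sum_distrib_right mult.assoc by (intro ext sum.swap)
    finally show "Lp_tendsto 2 \<mu> (\<lambda>N x. \<Sum>ks | length ks = n \<and> set ks \<subseteq> {..<N}. (\<Sum>i\<in>I. c i * f i n ks) * complex_of_real (wick x (map e ks)))
        (\<lambda>x. \<Sum>i\<in>I. c i * X i n x) sequentially" for n .
    have "Lp_tendsto 2 \<mu> (\<lambda>N x. \<Sum>i\<in>I. c i * (\<Sum>n<N. X i n x)) (\<lambda>x. \<Sum>i\<in>I. c i * \<phi> i x) sequentially"
      by (intro Lp_tendsto_sum I Lp_tendsto_mult_const X) auto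
    also have "(\<lambda>N x. \<Sum>i\<in>I. c i * (\<Sum>n<N. X i n x)) = (\<lambda>N x. \<Sum>n<N. \<Sum>i\<in>I. c i * X i n x)"
      unfolding sum_distrib_left by (intro ext sum.swap)
    finally show "Lp_tendsto 2 \<mu> (\<lambda>N x. \<Sum>n<N. \<Sum>i\<in>I. c i * X i n x) (\<lambda>x. \<Sum>i\<in>I. c i * \<phi> i x) sequentially" .
  qed
qed

text \<open>The frequencies may coincide for different indices, so the coefficients over each fibre
  of \<xi> are collected.\<close>

lemma sum_exp_fun_in_Exp:
  assumes "finite I" "\<And>i. i \<in> I \<Longrightarrow> \<xi> i \<in> \<E> \<times> \<E>"
  shows "(\<lambda>x. \<Sum>i\<in>I. c i * exp_fun (\<xi> i) x) \<in> Exp W"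
proof -
  have "(\<lambda>x. \<Sum>i\<in>I. c i * exp_fun (\<xi> i) x) =
    (\<lambda>x. \<Sum>\<zeta>\<in>\<xi> ` I. (\<Sum>i | i \<in> I \<and> \<xi> i = \<zeta>. c i) * exp_fun \<zeta> x)"
    by (subst sum.image_gen[OF assms(1), of _ \<xi>]) (auto simp: sum_distrib_right intro!: ext sum.cong)
  moreover have "\<xi> ` I \<subseteq> \<E> \<times> \<E>" using assms(2) by (rule image_subsetI)
  ultimately show ?thesis
    unfolding Exp_def mem_Collect_eq
    by (intro exI[of _ "\<xi> ` I"] exI[of _ "\<lambda>\<zeta>. \<Sum>i | i \<in> I \<and> \<xi> i = \<zeta>. c i"] conjI) (use assms(1) in simp_all)
qed

text \<open>As soon as one solution lies in \<open>Exp\<close>, the chosen representative lies in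
  \<open>Exp\<close> too, where it is unique.\<close>

lemma representative_eqI:
  assumes "\<psi> \<in> Exp W" "P \<psi>" "\<And>\<psi>'. \<psi>' \<in> Exp W \<Longrightarrow> P \<psi>' \<Longrightarrow> \<psi>' = \<psi>"
  shows "representative W P = \<psi>"
  unfolding representative_def
proof (rule some_equality)
  show "P \<psi> \<and> ((\<exists>\<psi>\<in>Exp W. P \<psi>) \<longrightarrow> \<psi> \<in> Exp W)" using assms(1,2) by blast
  show "\<phi> = \<psi>" if "P \<phi> \<and> ((\<exists>\<psi>\<in>Exp W. P \<psi>) \<longrightarrow> \<phi> \<in> Exp W)" for \<phi>
    using that assms by blast
qed

text \<open>The images \<open>\<eta> i\<close> are given by coordinates, because \<open>b\<close>
  may be unbounded and need not come from an operator on the whole space. The formula for \<phi> is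
  asked only on the dual space, since products of exponentials are again exponentials only for
  additive \<open>x\<close>.\<close>

lemma Gamma_op_sum_exp_fun:
  assumes I: "finite I" and \<xi>: "\<And>i. i \<in> I \<Longrightarrow> \<xi> i \<in> \<E> \<times> \<E>" and \<eta>: "\<And>i. i \<in> I \<Longrightarrow> \<eta> i \<in> \<E> \<times> \<E>"
    and b: "\<And>i n. i \<in> I \<Longrightarrow> cf (\<eta> i) n = of_real (b n) * cf (\<xi> i) n"
    and \<phi>: "\<And>x. x \<in> space \<mu> \<Longrightarrow> \<phi> x = (\<Sum>i\<in>I. c i * exp_fun (\<xi> i) x)"
  shows "Gamma_op W b \<phi> = (\<lambda>x. \<Sum>i\<in>I. c i * exp_fun (\<eta> i) x)"
  unfolding Gamma_op_def
proof (rule representative_eqI)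
  let ?f = "\<lambda>n ks. \<Sum>i\<in>I. c i * chaos (\<xi> i) n ks"
  let ?\<psi> = "\<lambda>x. \<Sum>i\<in>I. c i * exp_fun (\<eta> i) x"
  show in_Exp: "?\<psi> \<in> Exp W" by (intro sum_exp_fun_in_Exp I \<eta>)
  have 1: "wiener_ito W \<phi> ?f"
    using wiener_ito_sum[of I "\<lambda>i. exp_fun (\<xi> i)" "\<lambda>i. chaos (\<xi> i)" c] I \<xi> wiener_ito_exp_fun
    by (subst wiener_ito_cong[OF \<phi>]) auto
  have "chaos (\<eta> i) n ks = complex_of_real (\<Prod>i\<leftarrow>ks. b i) * chaos (\<xi> i) n ks" if "i \<in> I" for i n ks
  proof -
    have "(\<Prod>k\<leftarrow>ks. cf (\<eta> i) k) = complex_of_real (\<Prod>i\<leftarrow>ks. b i) * (\<Prod>k\<leftarrow>ks. cf (\<xi> i) k)"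
      by (induction ks) (simp_all add: b that mult_ac)
    then show ?thesis by (simp add: chaos_def)
  qed
  then have eq: "(\<lambda>n ks. complex_of_real (\<Prod>i\<leftarrow>ks. b i) * ?f n ks) = (\<lambda>n ks. \<Sum>i\<in>I. c i * chaos (\<eta> i) n ks)"
    by (auto simp: sum_distrib_left mult_ac intro!: ext sum.cong)
  have 2: "wiener_ito W ?\<psi> (\<lambda>n ks. complex_of_real (\<Prod>i\<leftarrow>ks. b i) * ?f n ks)"
    unfolding eq using I \<eta> by (intro wiener_ito_sum wiener_ito_exp_fun)
  show "\<exists>f. wiener_ito W \<phi> f \<and> wiener_ito W ?\<psi> (\<lambda>n ks. complex_of_real (\<Prod>i\<leftarrow>ks. b i) * f n ks)"
    using 1 2 by blast
  fix \<psi>' assume \<psi>': "\<psi>' \<in> Exp W"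
    "\<exists>f. wiener_ito W \<phi> f \<and> wiener_ito W \<psi>' (\<lambda>n ks. complex_of_real (\<Prod>i\<leftarrow>ks. b i) * f n ks)"
  then obtain f where f: "wiener_ito W \<phi> f" "wiener_ito W \<psi>' (\<lambda>n ks. complex_of_real (\<Prod>i\<leftarrow>ks. b i) * f n ks)"
    by blast
  show "\<psi>' = ?\<psi>"
  proof (rule Exp_eqI[OF \<psi>'(1) in_Exp])
    fix M a assume "proj M a = a"
    then show "S \<psi>' a = S ?\<psi> a" using S_diagonal[OF f] S_diagonal[OF 1 2] by simp
  qed
qed

lemma Gamma_op_diagonal:
  assumes B: "diagonal_op W B b" and I: "finite I" and \<xi>: "\<And>i. i \<in> I \<Longrightarrow> \<xi> i \<in> \<E> \<times> \<E>"
    and \<phi>: "\<And>x. x \<in> space \<mu> \<Longrightarrow> \<phi> x = (\<Sum>i\<in>I. c i * exp_fun (\<xi> i) x)"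
  shows "Gamma_op W b \<phi> = (\<lambda>x. \<Sum>i\<in>I. c i * exp_fun (map_prod B B (\<xi> i)) x)"
proof (rule Gamma_op_sum_exp_fun[OF I \<xi> _ _ \<phi>])
  show "map_prod B B (\<xi> i) \<in> \<E> \<times> \<E>" if "i \<in> I" for i
    using \<xi>[OF that] diagonal_test_space[OF B] by auto
qed (simp_all add: cf_diagonal[OF B])

text \<open>Multiplying the two functions after applying the square root of \<open>T\<close>
  produces the cross term with \<open>T\<close> itself. The inverse root then acts only on vectors
  in the range of the root and restores the sum of the frequencies.\<close>

lemma T_wick_pos_sum_exp_fun:
  assumes T: "diagonal_op W T t" and t: "\<And>n. 0 < t n" "\<And>n. t n \<le> K"
    and I: "finite I" and \<xi>: "\<And>i. i \<in> I \<Longrightarrow> \<xi> i \<in> \<E> \<times> \<E>"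
    and J: "finite J" and \<eta>: "\<And>j. j \<in> J \<Longrightarrow> \<eta> j \<in> \<E> \<times> \<E>"
    and \<phi>: "\<And>x. x \<in> space \<mu> \<Longrightarrow> \<phi> x = (\<Sum>i\<in>I. c i * exp_fun (\<xi> i) x)"
    and \<psi>: "\<And>x. x \<in> space \<mu> \<Longrightarrow> \<psi> x = (\<Sum>j\<in>J. d j * exp_fun (\<eta> j) x)"
  shows "T_wick_pos W t \<phi> \<psi> =
    (\<lambda>x. \<Sum>p\<in>I \<times> J. (c (fst p) * d (snd p) * exp (cbilinear (map_prod T T (\<xi> (fst p))) (\<eta> (snd p)))) *
      exp_fun (\<xi> (fst p) + \<eta> (snd p)) x)"
proof -
  have "\<bar>sqrt (t n)\<bar> \<le> sqrt K" for n using t(1)[of n] t(2)[of n] by simp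
  then have "\<exists>R. diagonal_op W R (\<lambda>n. sqrt (t n))" by (rule diagonal_op_exists)
  then obtain R where R: "diagonal_op W R (\<lambda>n. sqrt (t n))" ..
  let ?R = "map_prod R R"
  have R_mem: "?R \<zeta> \<in> \<E> \<times> \<E>" if "\<zeta> \<in> \<E> \<times> \<E>" for \<zeta>
    using that diagonal_test_space[OF R] by auto
  have cb: "cbilinear (?R \<zeta>) (?R \<theta>) = cbilinear (map_prod T T \<zeta>) \<theta>" for \<zeta> \<theta>
  proof (rule cbilinear_eq_if_coeff)
    fix n
    have "complex_of_real (sqrt (t n)) * complex_of_real (sqrt (t n)) = of_real (t n)"
      using t(1)[of n] by (simp flip: of_real_mult)
    then show "cf (?R \<zeta>) n * cf (?R \<theta>) n = cf (map_prod T T \<zeta>) n * cf \<theta> n"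
      by (simp add: cf_diagonal[OF R] cf_diagonal[OF T] mult_ac)
  qed
  let ?G = "\<lambda>x. Gamma_op W (\<lambda>n. sqrt (t n)) \<phi> x * Gamma_op W (\<lambda>n. sqrt (t n)) \<psi> x"
  let ?c = "\<lambda>p. c (fst p) * d (snd p) * exp (cbilinear (map_prod T T (\<xi> (fst p))) (\<eta> (snd p)))"
  have G: "?G x = (\<Sum>p\<in>I \<times> J. ?c p * exp_fun (?R (\<xi> (fst p)) + ?R (\<eta> (snd p))) x)" if x: "x \<in> space \<mu>" for x
  proof -
    have "?G x = (\<Sum>i\<in>I. \<Sum>j\<in>J. (c i * d j) * (exp_fun (?R (\<xi> i)) x * exp_fun (?R (\<eta> j)) x))"
    proof -
      have "Gamma_op W (\<lambda>n. sqrt (t n)) \<phi> = (\<lambda>x. \<Sum>i\<in>I. c i * exp_fun (?R (\<xi> i)) x)"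
        by (rule Gamma_op_diagonal[OF R I \<xi> \<phi>])
      moreover have "Gamma_op W (\<lambda>n. sqrt (t n)) \<psi> = (\<lambda>x. \<Sum>j\<in>J. d j * exp_fun (?R (\<eta> j)) x)"
        by (rule Gamma_op_diagonal[OF R J \<eta> \<psi>])
      ultimately show ?thesis by (simp only: sum_product mult_ac)
    qed
    also have "\<dots> = (\<Sum>i\<in>I. \<Sum>j\<in>J. (c i * d j) * (exp (cbilinear (map_prod T T (\<xi> i)) (\<eta> j)) * exp_fun (?R (\<xi> i) + ?R (\<eta> j)) x))"
      using R_mem \<xi> \<eta> by (intro sum.cong refl) (simp add: exp_fun_mult[OF x] cb)
    finally show ?thesis by (simp add: sum.cartesian_product case_prod_beta mult.assoc)
  qed
  show ?thesis
    unfolding T_wick_pos_def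
  proof (rule Gamma_op_sum_exp_fun[where \<xi> = "\<lambda>p. ?R (\<xi> (fst p)) + ?R (\<eta> (snd p))"])
    show "finite (I \<times> J)" using I J by simp
    show "?R (\<xi> (fst p)) + ?R (\<eta> (snd p)) \<in> \<E> \<times> \<E>" if "p \<in> I \<times> J" for p
      using that \<xi> \<eta> by (intro test_space_pair_add R_mem) auto
    show "\<xi> (fst p) + \<eta> (snd p) \<in> \<E> \<times> \<E>" if "p \<in> I \<times> J" for p
      using that \<xi> \<eta> by (intro test_space_pair_add) auto
    show "cf (\<xi> (fst p) + \<eta> (snd p)) n = of_real (1 / sqrt (t n)) * cf (?R (\<xi> (fst p)) + ?R (\<eta> (snd p))) n" for p n
    proof -
      have "complex_of_real (1 / sqrt (t n)) * of_real (sqrt (t n)) = 1"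
        using t(1)[of n] by (simp flip: of_real_mult)
      then show ?thesis
        by (simp only: cf_add cf_diagonal[OF R] distrib_left mult.assoc[symmetric] mult_1_left)
    qed
  qed (rule G)
qed

text \<open>In the regularised product only the scalar coefficients depend on \<epsilon>, and
  continuously; the exponential functions stay fixed. The limit is therefore taken term by term, and
  the S-transform, being continuous in L2, identifies the representative.\<close>

lemma T_wick_sum_exp_fun:
  assumes T: "diagonal_op W T t" and t: "\<And>n. 0 \<le> t n" "\<And>n. t n \<le> K"
    and I: "finite I" and \<xi>: "\<And>i. i \<in> I \<Longrightarrow> \<xi> i \<in> \<E> \<times> \<E>"
    and J: "finite J" and \<eta>: "\<And>j. j \<in> J \<Longrightarrow> \<eta> j \<in> \<E> \<times> \<E>"
    and \<phi>: "\<And>x. x \<in> space \<mu> \<Longrightarrow> \<phi> x = (\<Sum>i\<in>I. c i * exp_fun (\<xi> i) x)"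
    and \<psi>: "\<And>x. x \<in> space \<mu> \<Longrightarrow> \<psi> x = (\<Sum>j\<in>J. d j * exp_fun (\<eta> j) x)"
  shows "T_wick W t \<phi> \<psi> =
    (\<lambda>x. \<Sum>p\<in>I \<times> J. (c (fst p) * d (snd p) * exp (cbilinear (map_prod T T (\<xi> (fst p))) (\<eta> (snd p)))) *
      exp_fun (\<xi> (fst p) + \<eta> (snd p)) x)" (is "_ = ?\<rho>")
proof (cases "\<forall>n. 0 < t n")
  case True
  then show ?thesis using T_wick_pos_sum_exp_fun[OF T _ t(2) I \<xi> J \<eta> \<phi> \<psi>] by (simp add: T_wick_def)
next
  case False
  define \<kappa> where "\<kappa> n = (if t n = 0 then 1 else 0 :: real)" for n
  have "\<bar>\<kappa> n\<bar> \<le> 1" for n by (simp add: \<kappa>_def)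
  then have "\<exists>N. diagonal_op W N \<kappa>" by (rule diagonal_op_exists)
  then obtain N where N: "diagonal_op W N \<kappa>" ..
  have IJ: "finite (I \<times> J)" using I J by simp
  have mem: "\<xi> (fst p) + \<eta> (snd p) \<in> \<E> \<times> \<E>" if "p \<in> I \<times> J" for p
    using that \<xi> \<eta> by (intro test_space_pair_add) auto
  \<comment> \<open>The regularised operator is \<open>T\<close> plus \<epsilon> times the kernel
    projection, so its form splits additively in the exponent.\<close>
  define c' where "c' \<epsilon> p = c (fst p) * d (snd p) * exp (cbilinear (map_prod T T (\<xi> (fst p))) (\<eta> (snd p)) +
      of_real \<epsilon> * cbilinear (map_prod N N (\<xi> (fst p))) (\<eta> (snd p)))" for \<epsilon> p
  have pos: "T_wick_pos W (\<lambda>n. t n + \<epsilon> * \<kappa> n) \<phi> \<psi> = (\<lambda>x. \<Sum>p\<in>I \<times> J. c' \<epsilon> p * exp_fun (\<xi> (fst p) + \<eta> (snd p)) x)"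
    if \<epsilon>: "0 < \<epsilon>" for \<epsilon>
  proof -
    define T' where "T' f = T f + \<epsilon> *\<^sub>R N f" for f
    have T': "diagonal_op W T' (\<lambda>n. t n + \<epsilon> * \<kappa> n)"
      using T N unfolding diagonal_op_def T'_def
      by (auto intro!: bounded_linear_add bounded_linear_const_scaleR simp: scaleR_add_left)
    have "0 < t n + \<epsilon> * \<kappa> n" "t n + \<epsilon> * \<kappa> n \<le> K + \<epsilon>" for n
      using t(1)[of n] t(2)[of n] \<epsilon> by (auto simp: \<kappa>_def)
    then have eq: "T_wick_pos W (\<lambda>n. t n + \<epsilon> * \<kappa> n) \<phi> \<psi> =
      (\<lambda>x. \<Sum>p\<in>I \<times> J. (c (fst p) * d (snd p) * exp (cbilinear (map_prod T' T' (\<xi> (fst p))) (\<eta> (snd p)))) *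
        exp_fun (\<xi> (fst p) + \<eta> (snd p)) x)"
      by (rule T_wick_pos_sum_exp_fun[OF T' _ _ I \<xi> J \<eta> \<phi> \<psi>])
    have cb: "cbilinear (map_prod T' T' \<zeta>) \<theta> = cbilinear (map_prod T T \<zeta>) \<theta> + of_real \<epsilon> * cbilinear (map_prod N N \<zeta>) \<theta>" for \<zeta> \<theta>
      by (simp add: cbilinear_def T'_def inner_add_left complex_eq_iff algebra_simps)
    show ?thesis unfolding eq cb c'_def ..
  qed
  have lim: "Lp_tendsto 2 \<mu> (\<lambda>\<epsilon>. T_wick_pos W (\<lambda>n. t n + \<epsilon> * \<kappa> n) \<phi> \<psi>) ?\<rho> (at_right 0)"
  proof (rule Lp_tendsto_cong_eventually)
    show "\<forall>\<^sub>F \<epsilon> in at_right 0. \<forall>x\<in>space \<mu>. T_wick_pos W (\<lambda>n. t n + \<epsilon> * \<kappa> n) \<phi> \<psi> x =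
        (\<Sum>p\<in>I \<times> J. c' \<epsilon> p * exp_fun (\<xi> (fst p) + \<eta> (snd p)) x)"
      using pos by (auto simp: eventually_at_right_field intro!: exI[of _ 1])
    show "Lp_tendsto 2 \<mu> (\<lambda>\<epsilon> x. \<Sum>p\<in>I \<times> J. c' \<epsilon> p * exp_fun (\<xi> (fst p) + \<eta> (snd p)) x) ?\<rho> (at_right 0)"
    proof (rule Lp_tendsto_sum[OF _ IJ])
      fix p assume "p \<in> I \<times> J"
      show "Lp_tendsto 2 \<mu> (\<lambda>\<epsilon> x. c' \<epsilon> p * exp_fun (\<xi> (fst p) + \<eta> (snd p)) x)
         (\<lambda>x. c (fst p) * d (snd p) * exp (cbilinear (map_prod T T (\<xi> (fst p))) (\<eta> (snd p))) *
           exp_fun (\<xi> (fst p) + \<eta> (snd p)) x) (at_right 0)"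
      proof (rule Lp_tendsto_mult_coeff[OF _ Lp_tendsto_const[OF in_Lp_exp_fun[OF _ mem[OF \<open>p \<in> I \<times> J\<close>]]]])
        have "((\<lambda>\<epsilon>. c' \<epsilon> p) \<longlongrightarrow> c (fst p) * d (snd p) * exp (cbilinear (map_prod T T (\<xi> (fst p))) (\<eta> (snd p)) +
          of_real 0 * cbilinear (map_prod N N (\<xi> (fst p))) (\<eta> (snd p)))) (at_right 0)"
          unfolding c'_def by (intro tendsto_intros)
        then show "((\<lambda>\<epsilon>. c' \<epsilon> p) \<longlongrightarrow> c (fst p) * d (snd p) * exp (cbilinear (map_prod T T (\<xi> (fst p))) (\<eta> (snd p)))) (at_right 0)"
          by simp
      qed simp_all
    qed simp
  qed
  have in_Exp: "?\<rho> \<in> Exp W" by (intro sum_exp_fun_in_Exp IJ mem)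
  have "T_wick W t \<phi> \<psi> = representative W (\<lambda>\<rho>. Lp_tendsto 2 \<mu> (\<lambda>\<epsilon>. T_wick_pos W (\<lambda>n. t n + \<epsilon> * \<kappa> n) \<phi> \<psi>) \<rho> (at_right 0))"
    unfolding T_wick_def \<kappa>_def if_not_P[OF False] ..
  also have "\<dots> = ?\<rho>"
  proof (rule representative_eqI)
    show "?\<rho> \<in> Exp W" by (rule in_Exp)
    show "Lp_tendsto 2 \<mu> (\<lambda>\<epsilon>. T_wick_pos W (\<lambda>n. t n + \<epsilon> * \<kappa> n) \<phi> \<psi>) ?\<rho> (at_right 0)" by (rule lim)
    fix \<rho>' assume \<rho>': "\<rho>' \<in> Exp W" "Lp_tendsto 2 \<mu> (\<lambda>\<epsilon>. T_wick_pos W (\<lambda>n. t n + \<epsilon> * \<kappa> n) \<phi> \<psi>) \<rho>' (at_right 0)"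
    show "\<rho>' = ?\<rho>"
    proof (rule Exp_eqI[OF \<rho>'(1) in_Exp])
      fix M a assume "proj M a = a"
      then have "a \<in> \<E>" using proj_test_space[of M a] by simp
      then show "S \<rho>' a = S ?\<rho> a"
        using tendsto_unique[OF _ S_tendsto[OF \<rho>'(2)] S_tendsto[OF lim]] by simp
    qed
  qed
  finally show ?thesis .
qed

end

section \<open>Finite-dimensional Gaussian measures\<close>

lemma integral_exp_std_normal: "(\<integral>u. exp (z * of_real u) \<partial>std_normal_distribution) = exp (z\<^sup>2 / 2)"
  for z :: complex
proof -
  have "(\<integral>u. 1 * exp (z * of_real u) \<partial>std_normal_distribution) = exp (z\<^sup>2 / 2)"
  proof (rule integral_exp_of_char)
    show "integrable std_normal_distribution (\<lambda>u. norm (1 :: complex) * exp (c * \<bar>u\<bar>))" for c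
      using integrable_std_normal_exp_abs[of c] by simp
    show "(\<lambda>z. exp (z\<^sup>2 / 2)) holomorphic_on UNIV" by (intro holomorphic_intros) auto
    show "(\<integral>u. 1 * iexp (t * u) \<partial>std_normal_distribution) = exp ((\<i> * of_real t)\<^sup>2 / 2)" for t
    proof -
      have "(\<integral>u. 1 * iexp (t * u) \<partial>std_normal_distribution) = char std_normal_distribution t"
        by (simp add: char_def)
      then show ?thesis
        by (simp add: char_std_normal_distribution exp_of_real[symmetric] power_mult_distrib)
    qed
  qed auto
  then show ?thesis by simp
qed

lemma integrable_exp_std_normal: "integrable std_normal_distribution (\<lambda>u. exp (z * of_real u :: complex))"
proof (rule Bochner_Integration.integrable_bound[OF integrable_std_normal_exp_abs[of "norm z"]])
  show "(\<lambda>u. exp (z * of_real u)) \<in> borel_measurable std_normal_distribution" by measurable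
  have "norm (exp (z * of_real u)) \<le> exp (norm z * \<bar>u\<bar>)" for u
    using norm_exp[of "z * of_real u"] by (simp add: norm_mult)
  then show "AE u in std_normal_distribution. norm (exp (z * of_real u)) \<le> norm (exp (norm z * \<bar>u\<bar>))" by simp
qed

lemma exp_PiM_std_normal:
  fixes n :: nat
  shows "(\<integral>v. exp (\<Sum>k<n. z k * of_real (v k)) \<partial>(PiM {..<n} (\<lambda>_. std_normal_distribution))) = exp (\<Sum>k<n. (z k)\<^sup>2 / 2)"
    and "integrable (PiM {..<n} (\<lambda>_. std_normal_distribution)) (\<lambda>v. exp (\<Sum>k<n. z k * of_real (v k)) :: complex)"
proof -
  interpret std: prob_space std_normal_distribution by (rule prob_space_normal_density) simp
  interpret product_sigma_finite "\<lambda>_::nat. std_normal_distribution" ..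
  have eq: "exp (\<Sum>k<n. z k * of_real (v k)) = (\<Prod>k<n. exp (z k * of_real (v k)))" for v :: "nat \<Rightarrow> real"
    by (simp add: exp_sum)
  show "(\<integral>v. exp (\<Sum>k<n. z k * of_real (v k)) \<partial>(PiM {..<n} (\<lambda>_. std_normal_distribution))) = exp (\<Sum>k<n. (z k)\<^sup>2 / 2)"
    unfolding eq exp_sum[OF finite_lessThan] integral_exp_std_normal[symmetric]
    by (rule product_integral_prod) (auto intro: integrable_exp_std_normal)
  show "integrable (PiM {..<n} (\<lambda>_. std_normal_distribution)) (\<lambda>v. exp (\<Sum>k<n. z k * of_real (v k)) :: complex)"
    unfolding eq by (rule product_integrable_prod) (auto intro: integrable_exp_std_normal)
qed

lemma integral_pair_mult:
  fixes f :: "'a \<Rightarrow> complex" and g :: "'b \<Rightarrow> complex"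
  assumes "prob_space M1" "prob_space M2"
    and f: "f \<in> borel_measurable M1" "\<And>x. norm (f x) \<le> 1"
    and g: "g \<in> borel_measurable M2" "\<And>x. norm (g x) \<le> 1"
  shows "(\<integral>w. f (fst w) * g (snd w) \<partial>(M1 \<Otimes>\<^sub>M M2)) = (\<integral>x. f x \<partial>M1) * (\<integral>x. g x \<partial>M2)"
proof -
  interpret M1: prob_space M1 by fact
  interpret M2: prob_space M2 by fact
  interpret P: pair_prob_space M1 M2 ..
  note [measurable] = f(1) g(1)
  have "integrable (M1 \<Otimes>\<^sub>M M2) (\<lambda>w. f (fst w) * g (snd w))"
    using f(2) g(2) by (intro P.P.integrable_const_bound[where B = 1]) (auto simp: norm_mult mult_le_one)
  from P.integral_fst'[OF this] show ?thesis by simp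
qed

context white_noise_setup
begin

abbreviation "En n \<equiv> restrict_space borel (E_fin W n)"

lemma space_En: "space (En n) = E_fin W n"
  by (simp add: space_restrict_space)

lemma sum_basis_E_fin: "(\<Sum>k<n. c k *\<^sub>R e k) \<in> E_fin W n"
  unfolding E_fin_def by (intro span_sum span_scale span_base) auto

lemma proj_E_fin: "y \<in> E_fin W n \<Longrightarrow> proj n y = y"
  unfolding E_fin_def
proof (induction rule: span_induct)
  case base
  show ?case
    unfolding subspace_def
    using linear_0[OF linear_proj] linear_add[OF linear_proj] linear_cmul[OF linear_proj] by auto
next
  case (step x)
  then show ?case by (auto simp: vector_eq_iff_coeff inner_proj_basis inner_basis)
qed

lemma measurable_sum_basis:
  assumes "\<And>k. k < n \<Longrightarrow> Y k \<in> borel_measurable M"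
  shows "(\<lambda>x. \<Sum>k<n. Y k x *\<^sub>R e k) \<in> M \<rightarrow>\<^sub>M En n"
  using assms by (intro measurable_restrict_space2) (auto intro!: sum_basis_E_fin borel_measurable_sum borel_measurable_scaleR)

lemma measurable_inner_En: "(\<lambda>y. inner y f) \<in> borel_measurable (En n)"
  by (rule measurable_restrict_space1) measurable

lemma gauss_fin_eq:
  "gauss_fin W n = distr (PiM {..<n} (\<lambda>_. std_normal_distribution)) (En n) (\<lambda>v. \<Sum>k<n. v k *\<^sub>R e k)"
  by (simp add: gauss_fin_def)

lemma measurable_coord_sum: "(\<lambda>v. \<Sum>k<n. v k *\<^sub>R e k) \<in> PiM {..<n} (\<lambda>_. std_normal_distribution) \<rightarrow>\<^sub>M En n"
proof (rule measurable_sum_basis)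
  fix k assume "k < n"
  then have "(\<lambda>v. v k) \<in> PiM {..<n} (\<lambda>_. std_normal_distribution) \<rightarrow>\<^sub>M std_normal_distribution"
    by (intro measurable_component_singleton) simp
  then show "(\<lambda>v. v k) \<in> borel_measurable (PiM {..<n} (\<lambda>_. std_normal_distribution))" by simp
qed

lemma prob_space_PiM_std_normal: "prob_space (PiM {..<n::nat} (\<lambda>_. std_normal_distribution))"
  by (rule prob_space_PiM) (rule prob_space_normal_density, simp)

lemma prob_space_gauss_fin: "prob_space (gauss_fin W n)"
  unfolding gauss_fin_eq by (intro prob_space.prob_space_distr prob_space_PiM_std_normal measurable_coord_sum)

lemma sets_gauss_fin [measurable_cong]: "sets (gauss_fin W n) = sets (En n)"
  by (simp add: gauss_fin_eq)

lemma space_gauss_fin: "space (gauss_fin W n) = E_fin W n"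
  by (simp add: gauss_fin_eq space_En)

text \<open>The joint characteristic function decides the law. The criterion serves the coordinates
  of \<open>x\<close> under \<mu> and the linear combinations of three independent points.\<close>

lemma distr_eq_gauss_fin:
  assumes M: "prob_space M" and Y: "\<And>k. k < n \<Longrightarrow> Y k \<in> borel_measurable M"
    and char: "\<And>t. (\<integral>x. iexp (\<Sum>k<n. t k * Y k x) \<partial>M) = of_real (exp (- (\<Sum>k<n. (t k)\<^sup>2) / 2))"
  shows "distr M (En n) (\<lambda>x. \<Sum>k<n. Y k x *\<^sub>R e k) = gauss_fin W n"
proof -
  let ?N = "PiM {..<n} (\<lambda>_. std_normal_distribution)"
  let ?B = "PiM {..<n} (\<lambda>_. borel :: real measure)"
  let ?s = "\<lambda>v. \<Sum>k<n. v k *\<^sub>R e k"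
  have coord: "(\<lambda>v. v k) \<in> borel_measurable ?N" if "k < n" for k
  proof -
    have "(\<lambda>v. v k) \<in> ?N \<rightarrow>\<^sub>M std_normal_distribution" using that by (intro measurable_component_singleton) simp
    then show ?thesis by simp
  qed
  have s: "?s \<in> ?B \<rightarrow>\<^sub>M En n" by (intro measurable_sum_basis measurable_component_singleton) simp
  have eq: "distr M ?B (\<lambda>x. \<lambda>k\<in>{..<n}. Y k x) = distr ?N ?B (\<lambda>v. \<lambda>k\<in>{..<n}. v k)"
  proof (rule distr_PiM_eq_of_char[OF M prob_space_PiM_std_normal Y coord])
    fix t :: "nat \<Rightarrow> real"
    have "(\<integral>v. iexp (\<Sum>k<n. t k * v k) \<partial>?N) = (\<integral>v. exp (\<Sum>k<n. (\<i> * of_real (t k)) * of_real (v k)) \<partial>?N)"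
      by (simp add: sum_distrib_left mult.assoc)
    also have "\<dots> = of_real (exp (- (\<Sum>k<n. (t k)\<^sup>2) / 2))"
      unfolding exp_PiM_std_normal(1)
      by (simp add: power_mult_distrib exp_of_real[symmetric] sum_negf sum_divide_distrib)
    finally show "(\<integral>x. iexp (\<Sum>k<n. t k * Y k x) \<partial>M) = (\<integral>v. iexp (\<Sum>k<n. t k * v k) \<partial>?N)"
      using char by simp
  qed
  have "distr M (En n) (\<lambda>x. \<Sum>k<n. Y k x *\<^sub>R e k) = distr (distr M ?B (\<lambda>x. \<lambda>k\<in>{..<n}. Y k x)) (En n) ?s"
    using Y by (subst distr_distr[OF s]) (auto intro!: measurable_restrict simp: o_def)
  also have "\<dots> = distr ?N (En n) ?s"
    unfolding eq using coord by (subst distr_distr[OF s]) (auto intro!: measurable_restrict simp: o_def)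
  finally show ?thesis by (simp add: gauss_fin_eq)
qed

lemma exp_gauss_fin:
  shows "(\<integral>y. exp (\<Sum>k<n. z k * of_real (inner y (e k))) \<partial>gauss_fin W n) = exp (\<Sum>k<n. (z k)\<^sup>2 / 2)"
    and "integrable (gauss_fin W n) (\<lambda>y. exp (\<Sum>k<n. z k * of_real (inner y (e k))) :: complex)"
proof -
  note [measurable] = measurable_coord_sum measurable_inner_En
  have m: "(\<lambda>y. exp (\<Sum>k<n. z k * of_real (inner y (e k))) :: complex) \<in> borel_measurable (En n)" by measurable
  have eq: "exp (\<Sum>k<n. z k * of_real (inner (\<Sum>j<n. v j *\<^sub>R e j) (e k))) = exp (\<Sum>k<n. z k * of_real (v k))" for v
    by (simp add: inner_sum_basis)
  show "(\<integral>y. exp (\<Sum>k<n. z k * of_real (inner y (e k))) \<partial>gauss_fin W n) = exp (\<Sum>k<n. (z k)\<^sup>2 / 2)"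
    unfolding gauss_fin_eq by (subst integral_distr[OF measurable_coord_sum m]) (simp only: eq exp_PiM_std_normal(1))
  show "integrable (gauss_fin W n) (\<lambda>y. exp (\<Sum>k<n. z k * of_real (inner y (e k))) :: complex)"
    unfolding gauss_fin_eq by (subst integrable_distr_eq[OF measurable_coord_sum m]) (simp only: eq exp_PiM_std_normal(2))
qed

lemma proj_fin_eq: "proj_fin W n x = (\<Sum>k<n. x (e k) *\<^sub>R e k)"
  by (simp add: proj_fin_def)

lemma char_coordinates:
  "(\<integral>x. iexp (\<Sum>k<n. t k * x (e k)) \<partial>\<mu>) = of_real (exp (- (\<Sum>k<n. (t k)\<^sup>2) / 2))"
proof -
  have "(\<integral>x. iexp (\<Sum>k<n. t k * x (e k)) \<partial>\<mu>) = (\<integral>x. iexp (x (\<Sum>k<n. t k *\<^sub>R e k)) \<partial>\<mu>)"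
    by (intro Bochner_Integration.integral_cong refl)
       (simp add: eval_sum eval_scaleR basis_test_space test_space_scaleR)
  also have "\<dots> = of_real (exp (- (\<Sum>k<n. (t k)\<^sup>2) / 2))"
    by (subst char_gauss) (auto intro!: test_space_sum test_space_scaleR basis_test_space simp: norm_sum_basis)
  finally show ?thesis .
qed

lemma measurable_proj_fin: "proj_fin W n \<in> \<mu> \<rightarrow>\<^sub>M En n"
  unfolding proj_fin_eq[abs_def] by (intro measurable_sum_basis measurable_eval basis_test_space)

lemma distr_proj_fin: "distr \<mu> (En n) (proj_fin W n) = gauss_fin W n"
  unfolding proj_fin_eq[abs_def]
  by (intro distr_eq_gauss_fin prob_space_gauss measurable_eval basis_test_space char_coordinates)

lemma diagonal_E_fin:
  assumes B: "diagonal_op W B b"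
  shows "B (\<Sum>k<n. c k *\<^sub>R e k) = (\<Sum>k<n. (b k * c k) *\<^sub>R e k)"
  by (simp add: vector_eq_iff_coeff diagonal_coeff[OF B] inner_sum_basis)

lemma E_fin_expand: "y \<in> E_fin W n \<Longrightarrow> y = (\<Sum>k<n. inner y (e k) *\<^sub>R e k)"
  using proj_E_fin[of y n] by (simp add: proj_def)

lemma diagonal_comb_eq:
  assumes C: "diagonal_op W C \<alpha>" and P: "diagonal_op W P p" and Q: "diagonal_op W Q q"
    and "y \<in> E_fin W n" "z \<in> E_fin W n"
  shows "C (proj_fin W n x) + P y + Q z =
    (\<Sum>k<n. (\<alpha> k * x (e k) + p k * inner y (e k) + q k * inner z (e k)) *\<^sub>R e k)"
proof -
  have "C (proj_fin W n x) = (\<Sum>k<n. (\<alpha> k * x (e k)) *\<^sub>R e k)"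
    unfolding proj_fin_eq by (rule diagonal_E_fin[OF C])
  moreover have "P y = (\<Sum>k<n. (p k * inner y (e k)) *\<^sub>R e k)"
    by (subst E_fin_expand[OF assms(4)]) (rule diagonal_E_fin[OF P])
  moreover have "Q z = (\<Sum>k<n. (q k * inner z (e k)) *\<^sub>R e k)"
    by (subst E_fin_expand[OF assms(5)]) (rule diagonal_E_fin[OF Q])
  ultimately show ?thesis by (simp add: scaleR_add_left sum.distrib)
qed

section \<open>The law of Cx + Py + Qz\<close>

abbreviation "triple n \<equiv> \<mu> \<Otimes>\<^sub>M (gauss_fin W n \<Otimes>\<^sub>M gauss_fin W n)"

lemma measurable_comb:
  "(\<lambda>w. a * fst w (e k) + b * inner (fst (snd w)) (e k) + c * inner (snd (snd w)) (e k))
    \<in> borel_measurable (triple n)"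
proof -
  have [measurable]: "(\<lambda>w. fst w (e k)) \<in> borel_measurable (triple n)"
    by (rule measurable_compose[OF measurable_fst measurable_eval[OF basis_test_space]])
  have in': "(\<lambda>y. inner y (e k)) \<in> borel_measurable (gauss_fin W n)"
    using measurable_inner_En[of "e k" n] by (simp cong: measurable_cong_sets add: sets_gauss_fin)
  have [measurable]: "(\<lambda>w. inner (fst (snd w)) (e k)) \<in> borel_measurable (triple n)"
    "(\<lambda>w. inner (snd (snd w)) (e k)) \<in> borel_measurable (triple n)"
    by (auto intro!: measurable_compose[OF _ in'])
  show ?thesis by measurable
qed

text \<open>Independent standard Gaussians combined with weights whose squares sum to 1 are standard
  again. This will carry null sets on \<open>E_fin W n\<close>, where conditional expectations are
  undetermined, back to null sets of \<open>triple n\<close>.\<close>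

lemma distr_comb:
  assumes "\<And>k. (\<alpha> k)\<^sup>2 + (p k)\<^sup>2 + (q k)\<^sup>2 = 1"
  shows "distr (triple n) (En n)
    (\<lambda>w. \<Sum>k<n. (\<alpha> k * fst w (e k) + p k * inner (fst (snd w)) (e k) + q k * inner (snd (snd w)) (e k)) *\<^sub>R e k) =
    gauss_fin W n"
proof (rule distr_eq_gauss_fin)
  interpret G: prob_space "gauss_fin W n" by (rule prob_space_gauss_fin)
  interpret GG: pair_prob_space "gauss_fin W n" "gauss_fin W n" ..
  interpret P: pair_prob_space \<mu> "gauss_fin W n \<Otimes>\<^sub>M gauss_fin W n" ..
  show "prob_space (triple n)" by (rule P.P.prob_space_axioms)
  show "(\<lambda>w. \<alpha> k * fst w (e k) + p k * inner (fst (snd w)) (e k) + q k * inner (snd (snd w)) (e k))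
    \<in> borel_measurable (triple n)" for k by (rule measurable_comb)
  fix t :: "nat \<Rightarrow> real"
  have in': "(\<lambda>y. inner y (e k)) \<in> borel_measurable (gauss_fin W n)" for k
    using measurable_inner_En[of "e k" n] by (simp cong: measurable_cong_sets add: sets_gauss_fin)
  note [measurable] = in' measurable_eval[OF basis_test_space]
  let ?f = "\<lambda>x. iexp (\<Sum>k<n. (t k * \<alpha> k) * x (e k))"
  let ?g = "\<lambda>a y. iexp (\<Sum>k<n. (t k * a k) * inner y (e k))"
  have g_meas: "?g a \<in> borel_measurable (gauss_fin W n)" for a by measurable
  have g: "(\<integral>y. ?g a y \<partial>gauss_fin W n) = of_real (exp (- (\<Sum>k<n. (t k * a k)\<^sup>2) / 2))" for a
  proof -
    have "(\<integral>y. ?g a y \<partial>gauss_fin W n) = (\<integral>y. exp (\<Sum>k<n. (\<i> * of_real (t k * a k)) * of_real (inner y (e k))) \<partial>gauss_fin W n)"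
      by (simp add: sum_distrib_left mult.assoc)
    also have "\<dots> = of_real (exp (- (\<Sum>k<n. (t k * a k)\<^sup>2) / 2))"
      unfolding exp_gauss_fin(1)
      by (simp add: power_mult_distrib exp_of_real[symmetric] sum_negf sum_divide_distrib)
    finally show ?thesis .
  qed
  have "(\<integral>w. iexp (\<Sum>k<n. t k * (\<alpha> k * fst w (e k) + p k * inner (fst (snd w)) (e k) + q k * inner (snd (snd w)) (e k))) \<partial>triple n)
    = (\<integral>w. ?f (fst w) * (\<lambda>v. ?g p (fst v) * ?g q (snd v)) (snd w) \<partial>triple n)"
    by (intro Bochner_Integration.integral_cong refl)
       (simp only: exp_add[symmetric] distrib_left[symmetric] of_real_add[symmetric] sum.distrib[symmetric] mult.assoc add.assoc)
  also have "\<dots> = (\<integral>x. ?f x \<partial>\<mu>) * (\<integral>v. ?g p (fst v) * ?g q (snd v) \<partial>(gauss_fin W n \<Otimes>\<^sub>M gauss_fin W n))"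
    by (rule integral_pair_mult) (auto intro!: prob_space_gauss GG.P.prob_space_axioms simp: norm_mult simp del: of_real_sum)
  also have "(\<integral>v. ?g p (fst v) * ?g q (snd v) \<partial>(gauss_fin W n \<Otimes>\<^sub>M gauss_fin W n)) =
      (\<integral>y. ?g p y \<partial>gauss_fin W n) * (\<integral>y. ?g q y \<partial>gauss_fin W n)"
    by (rule integral_pair_mult[OF prob_space_gauss_fin prob_space_gauss_fin g_meas _ g_meas]) simp_all
  also have "(\<integral>x. ?f x \<partial>\<mu>) * ((\<integral>y. ?g p y \<partial>gauss_fin W n) * (\<integral>y. ?g q y \<partial>gauss_fin W n)) =
    of_real (exp (- (\<Sum>k<n. (t k * \<alpha> k)\<^sup>2) / 2) * (exp (- (\<Sum>k<n. (t k * p k)\<^sup>2) / 2) * exp (- (\<Sum>k<n. (t k * q k)\<^sup>2) / 2)))"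
    by (simp only: g char_coordinates of_real_mult)
  also have "exp (- (\<Sum>k<n. (t k * \<alpha> k)\<^sup>2) / 2) * (exp (- (\<Sum>k<n. (t k * p k)\<^sup>2) / 2) * exp (- (\<Sum>k<n. (t k * q k)\<^sup>2) / 2)) =
    exp (- (\<Sum>k<n. (t k)\<^sup>2) / 2)"
  proof -
    have "(\<Sum>k<n. (t k)\<^sup>2) = (\<Sum>k<n. (t k)\<^sup>2 * ((\<alpha> k)\<^sup>2 + (p k)\<^sup>2 + (q k)\<^sup>2))" by (simp add: assms)
    also have "\<dots> = (\<Sum>k<n. (t k * \<alpha> k)\<^sup>2) + (\<Sum>k<n. (t k * p k)\<^sup>2) + (\<Sum>k<n. (t k * q k)\<^sup>2)"
      by (simp add: power_mult_distrib distrib_left sum.distrib)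
    finally show ?thesis by (simp add: exp_add[symmetric] add_divide_distrib)
  qed
  finally show "(\<integral>w. iexp (\<Sum>k<n. t k * (\<alpha> k * fst w (e k) + p k * inner (fst (snd w)) (e k) + q k * inner (snd (snd w)) (e k))) \<partial>triple n)
    = of_real (exp (- (\<Sum>k<n. (t k)\<^sup>2) / 2))" .
qed

section \<open>Functions determined by the first coordinates\<close>

lemma space_filtration: "space (filtration W n) = dual_space W"
  by (simp add: filtration_def space_measure_of_conv)

lemma measurable_eval_filtration: "k < n \<Longrightarrow> (\<lambda>x. x (e k)) \<in> borel_measurable (filtration W n)"
proof (rule measurableI)
  fix B :: "real set" assume "k < n" "B \<in> sets borel"
  then have "{x \<in> dual_space W. x (e k) \<in> B} \<in> sets (filtration W n)"
    unfolding filtration_def by (subst sets_measure_of) auto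
  moreover have "(\<lambda>x. x (e k)) -` B \<inter> space (filtration W n) = {x \<in> dual_space W. x (e k) \<in> B}"
    by (auto simp: space_filtration)
  ultimately show "(\<lambda>x. x (e k)) -` B \<inter> space (filtration W n) \<in> sets (filtration W n)" by simp
qed simp

lemma subalgebra_filtration: "subalgebra \<mu> (filtration W n)"
  unfolding subalgebra_def
proof
  show "space (filtration W n) = space \<mu>" by (simp add: space_filtration space_gauss)
  have "{x \<in> dual_space W. x (e k) \<in> B} \<in> sets \<mu>" if "B \<in> sets borel" for k B
  proof -
    have "{x \<in> dual_space W. x (e k) \<in> B} = (\<lambda>x. x (e k)) -` B \<inter> space \<mu>" by (auto simp: space_gauss)
    then show ?thesis using measurable_sets[OF measurable_eval[OF basis_test_space] that] by simp
  qed
  then show "sets (filtration W n) \<subseteq> sets \<mu>"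
    unfolding filtration_def space_gauss[symmetric]
    by (subst sets_measure_of) (auto intro!: sets.sigma_sets_subset)
qed

text \<open>Vanishing against all characters of the first \<open>n\<close> coordinates gives
  vanishing on rectangles. These are stable under intersection and generate the filtration, so the
  argument on disjoint unions and complements extends the result.\<close>

lemma set_integral_filtration_eq_0:
  fixes h :: "('e \<Rightarrow> real) \<Rightarrow> complex"
  assumes h: "integrable \<mu> h"
    and z: "\<And>t. (\<integral>x. h x * iexp (\<Sum>k<n. t k * x (e k)) \<partial>\<mu>) = 0"
    and U: "U \<in> sets (filtration W n)"
  shows "(\<integral>x. indicator U x *\<^sub>R h x \<partial>\<mu>) = 0"
proof -
  let ?G = "{{x \<in> dual_space W. \<forall>k<n. x (e k) \<in> B k} | B. \<forall>k<n. B k \<in> sets borel}"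
  have G_sets: "a \<in> sets \<mu>" if "a \<in> ?G" for a
  proof -
    obtain B where B: "a = {x \<in> dual_space W. \<forall>k<n. x (e k) \<in> B k}" "\<forall>k<n. B k \<in> sets borel" using \<open>a \<in> ?G\<close> by blast
    have "a = {x \<in> space \<mu>. \<forall>k\<in>{..<n}. x (e k) \<in> B k}" by (auto simp: B space_gauss)
    also have "\<dots> \<in> sets \<mu>"
      using B(2) by (intro sets.sets_Collect_finite_All' sets.sets_Collect_finite_All measurable_sets_Collect[OF measurable_eval[OF basis_test_space]]) auto
    finally show ?thesis .
  qed
  have Int: "Int_stable ?G"
  proof (rule Int_stableI)
    fix a b assume "a \<in> ?G" "b \<in> ?G"
    then obtain B1 B2 where "a = {x \<in> dual_space W. \<forall>k<n. x (e k) \<in> B1 k}" "\<forall>k<n. B1 k \<in> sets borel"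
      "b = {x \<in> dual_space W. \<forall>k<n. x (e k) \<in> B2 k}" "\<forall>k<n. B2 k \<in> sets borel" by blast
    then show "a \<inter> b \<in> ?G"
      by (intro CollectI exI[of _ "\<lambda>k. B1 k \<inter> B2 k"]) auto
  qed
  have sub: "sigma_sets (dual_space W) ?G \<subseteq> sets \<mu>"
    using G_sets unfolding space_gauss[symmetric] by (intro sets.sigma_sets_subset) blast
  have "U \<in> sigma_sets (dual_space W) ?G"
  proof -
    let ?H = "{{x \<in> dual_space W. x (e k) \<in> B} | k B. k < n \<and> B \<in> sets borel}"
    have "?H \<subseteq> ?G"
    proof
      fix a assume "a \<in> ?H"
      then obtain k B where "a = {x \<in> dual_space W. x (e k) \<in> B}" "k < n" "B \<in> sets borel" by blast
      \<comment> \<open>A condition on one coordinate is a rectangle whose other sides are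
        \<open>UNIV\<close>.\<close>
      then show "a \<in> ?G"
        by (intro CollectI exI[of _ "\<lambda>j. if j = k then B else UNIV"]) auto
    qed
    then have "sigma_sets (dual_space W) ?H \<subseteq> sigma_sets (dual_space W) ?G" by (rule sigma_sets_mono')
    moreover have "U \<in> sigma_sets (dual_space W) ?H"
      using U unfolding filtration_def by (subst (asm) sets_measure_of) auto
    ultimately show ?thesis by blast
  qed
  note U' = this
  have closed: "?G \<subseteq> Pow (dual_space W)" by auto
  from Int closed U' show ?thesis
  proof (induct rule: sigma_sets_induct_disjoint)
    case (basic a)
    then obtain B where B: "a = {x \<in> dual_space W. \<forall>k<n. x (e k) \<in> B k}" "\<forall>k<n. B k \<in> sets borel" by blast
    have "(\<integral>x. indicator a x *\<^sub>R h x \<partial>\<mu>) = (\<integral>x. h x * (\<Prod>k<n. indicator (B k) (x (e k))) \<partial>\<mu>)"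
    proof (intro Bochner_Integration.integral_cong refl)
      fix x assume x: "x \<in> space \<mu>"
      have "(\<Prod>k<n. indicator (B k) (x (e k)) :: complex) = indicator a x"
      proof (cases "\<forall>k<n. x (e k) \<in> B k")
        case True
        then show ?thesis using x by (simp add: B space_gauss)
      next
        case False
        then obtain k where "k < n" "x (e k) \<notin> B k" by blast
        then have "(\<Prod>k<n. indicator (B k) (x (e k)) :: complex) = 0"
            by (intro prod_zero bexI[of _ k]) auto
        then show ?thesis using False by (auto simp: B indicator_def)
      qed
      then show "indicator a x *\<^sub>R h x = h x * (\<Prod>k<n. indicator (B k) (x (e k)))"
        by (simp add: indicator_def)
    qed
    also have "\<dots> = 0"
      using B(2) by (intro integral_rectangle_eq_0_of_char[OF h _ z] measurable_eval basis_test_space) auto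
    finally show ?case .
  next
    case empty
    show ?case by simp
  next
    case (compl a)
    have a: "a \<in> sets \<mu>" using compl(1) sub by blast
    have "(\<integral>x. indicator (dual_space W - a) x *\<^sub>R h x \<partial>\<mu>) = (\<integral>x. h x - indicator a x *\<^sub>R h x \<partial>\<mu>)"
      by (intro Bochner_Integration.integral_cong refl) (auto simp: indicator_def space_gauss)
    also have "\<dots> = (\<integral>x. h x \<partial>\<mu>) - 0"
      using h a compl(2) by (subst Bochner_Integration.integral_diff) (auto intro: integrable_mult_indicator)
    \<comment> \<open>The frequency 0 yields the integral over the whole space.\<close>
    also have "(\<integral>x. h x \<partial>\<mu>) = 0" using z[of "\<lambda>_. 0"] by simp
    finally show ?case by simp
  next
    case (union a)
    have a: "range a \<subseteq> sets \<mu>" using union(2) sub by blast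
    have "(\<integral>x\<in>(\<Union>i. a i). h x \<partial>\<mu>) = (\<Sum>i. (\<integral>x\<in>a i. h x \<partial>\<mu>))"
    proof (rule lebesgue_integral_countable_add)
      show "set_integrable \<mu> (\<Union>i. a i) h"
        unfolding set_integrable_def using a h by (intro integrable_mult_indicator) auto
    qed (use a union(1) in \<open>auto simp: disjoint_family_on_def\<close>)
    then show ?case using union(3) by (simp add: set_lebesgue_integral_def)
  qed
qed

end

section \<open>Conditional expectations of exponential functions\<close>

text \<open>The three hypotheses are the coefficients of \<open>X\<^sup>2\<close>,
  \<open>Y\<^sup>2\<close> and \<open>2 * X * Y\<close>, once \<open>a\<^sup>2\<close>,
  \<open>b\<^sup>2\<close> and \<open>a * b\<close> have been moved to the other side.\<close>

lemma quadratic_identity: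
  fixes X Y :: complex and p q r s a b t :: real
  assumes "p\<^sup>2 + q\<^sup>2 = 1 - a\<^sup>2" "r\<^sup>2 + s\<^sup>2 = 1 - b\<^sup>2" "p * r + q * s = (t - 1) * a * b"
  shows "(of_real p * X + of_real r * Y)\<^sup>2 + (of_real q * X + of_real s * Y)\<^sup>2 + (of_real a * X + of_real b * Y)\<^sup>2 =
    X\<^sup>2 + Y\<^sup>2 + 2 * (of_real t * (of_real a * X) * (of_real b * Y))"
proof -
  have "(of_real p * X + of_real r * Y)\<^sup>2 + (of_real q * X + of_real s * Y)\<^sup>2 + (of_real a * X + of_real b * Y)\<^sup>2 =
    of_real (p\<^sup>2 + q\<^sup>2 + a\<^sup>2) * X\<^sup>2 + of_real (r\<^sup>2 + s\<^sup>2 + b\<^sup>2) * Y\<^sup>2 + 2 * of_real (p * r + q * s + a * b) * X * Y"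
    by (simp add: power2_eq_square algebra_simps)
  also have "p\<^sup>2 + q\<^sup>2 + a\<^sup>2 = 1" using assms(1) by simp
  also have "r\<^sup>2 + s\<^sup>2 + b\<^sup>2 = 1" using assms(2) by simp
  also have "p * r + q * s + a * b = t * a * b" using assms(3) by (simp add: algebra_simps)
  finally show ?thesis by (simp add: algebra_simps)
qed

lemma Lp_tendsto_cong_AE:
  assumes F: "\<And>i. F i \<in> borel_measurable M" and AE: "\<And>i. AE x in M. F i x = G i x"
    and G: "Lp_tendsto p M G f flt"
  shows "Lp_tendsto p M F f flt"
proof (rule Lp_tendsto_boundedI)
  show f: "in_Lp p M f" using G by (simp add: Lp_tendsto_def)
  have ev: "\<forall>\<^sub>F i in flt. in_Lp p M (G i)" using G by (simp add: Lp_tendsto_def)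
  have [measurable]: "f \<in> borel_measurable M" using f by (simp add: in_Lp_def)
  note [measurable] = F
  from ev show "\<forall>\<^sub>F i in flt. in_Lp p M (F i)"
  proof eventually_elim
    case (elim i)
    then have [measurable]: "G i \<in> borel_measurable M" by (simp add: in_Lp_def)
    have "integrable M (\<lambda>x. norm (F i x) powr p) \<longleftrightarrow> integrable M (\<lambda>x. norm (G i x) powr p)"
      by (intro integrable_cong_AE) (use AE[of i] in auto)
    then show ?case using elim F by (simp add: in_Lp_def)
  qed
  show "((\<lambda>i. \<integral>x. norm (G i x - f x) powr p \<partial>M) \<longlongrightarrow> 0) flt"
    using G by (simp add: Lp_tendsto_def)
  from ev show "\<forall>\<^sub>F i in flt. (\<integral>x. norm (F i x - f x) powr p \<partial>M) \<le> (\<integral>x. norm (G i x - f x) powr p \<partial>M)"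
  proof eventually_elim
    case (elim i)
    then have [measurable]: "G i \<in> borel_measurable M" by (simp add: in_Lp_def)
    show ?case by (intro eq_refl integral_cong_AE) (use AE[of i] in auto)
  qed
qed

context white_noise_setup
begin

text \<open>The function on \<open>E_fin W n\<close> whose pullback along
  \<open>proj_fin W n\<close> is the exponential function of the projected frequency.\<close>

definition fin_exp :: "nat \<Rightarrow> 'e \<times> 'e \<Rightarrow> 'e \<Rightarrow> complex" where
  "fin_exp n \<xi> v = exp ((\<Sum>k<n. cf \<xi> k * of_real (inner v (e k))) - (\<Sum>k<n. (cf \<xi> k)\<^sup>2) / 2)"

lemma measurable_fin_exp: "fin_exp n \<xi> \<in> borel_measurable (En n)"
proof -
  note [measurable] = measurable_inner_En
  show ?thesis unfolding fin_exp_def by measurable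
qed

lemma exp_fun_cproj:
  assumes "x \<in> space \<mu>"
  shows "exp_fun (cproj n \<xi>) x = exp ((\<Sum>k<n. cf \<xi> k * of_real (x (e k))) - (\<Sum>k<n. (cf \<xi> k)\<^sup>2) / 2)"
  by (simp add: exp_fun_def cpairing_cproj[OF assms] cbilinear_cproj power2_eq_square)

lemma exp_fun_cproj_fin_exp:
  "x \<in> space \<mu> \<Longrightarrow> exp_fun (cproj n \<xi>) x = fin_exp n \<xi> (proj_fin W n x)"
  by (simp add: exp_fun_cproj fin_exp_def proj_fin_eq inner_sum_basis)

lemma integrable_exp_fun: "\<xi> \<in> \<E> \<times> \<E> \<Longrightarrow> integrable \<mu> (exp_fun \<xi>)"
  using in_Lp_exp_fun[of 1 \<xi>] integrable_norm_iff[of "exp_fun \<xi>" \<mu>] by (auto simp: in_Lp_def)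

text \<open>Testing against characters of the first coordinates suffices. Such a character is, up to
  a constant, the exponential function of a purely imaginary frequency, so the integrals reduce to
  \<open>integral_exp_fun_mult\<close>.\<close>

lemma cond_exp_Exp:
  assumes F: "finite F" "F \<subseteq> \<E> \<times> \<E>" and \<phi>: "\<phi> = (\<lambda>x. \<Sum>\<xi>\<in>F. c \<xi> * exp_fun \<xi> x)"
  shows "AE x in \<mu>. complex_cond_exp \<mu> (filtration W n) \<phi> x = (\<Sum>\<xi>\<in>F. c \<xi> * exp_fun (cproj n \<xi>) x)"
proof -
  interpret finite_measure_subalgebra \<mu> "filtration W n"
    by unfold_locales (rule subalgebra_filtration)
  define \<phi>n where "\<phi>n x = (\<Sum>\<xi>\<in>F. c \<xi> * exp_fun (cproj n \<xi>) x)" for x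
  have \<phi>_int: "integrable \<mu> \<phi>"
    unfolding \<phi> using F by (intro Bochner_Integration.integrable_sum integrable_mult_right integrable_exp_fun) auto
  have \<phi>n_int: "integrable \<mu> \<phi>n"
    unfolding \<phi>n_def by (intro Bochner_Integration.integrable_sum integrable_mult_right integrable_exp_fun cproj_test_space)
  have \<phi>n_meas: "\<phi>n \<in> borel_measurable (filtration W n)"
  proof -
    have "(\<lambda>x. \<Sum>\<xi>\<in>F. c \<xi> * exp ((\<Sum>k<n. cf \<xi> k * of_real (x (e k))) - (\<Sum>k<n. (cf \<xi> k)\<^sup>2) / 2))
      \<in> borel_measurable (filtration W n)"
    proof -
      have [measurable]: "(\<lambda>x. \<Sum>k<n. cf \<xi> k * of_real (x (e k))) \<in> borel_measurable (filtration W n)" for \<xi>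
      proof (intro borel_measurable_sum borel_measurable_times borel_measurable_const)
        fix k assume "k \<in> {..<n}"
        then have [measurable]: "(\<lambda>x. x (e k)) \<in> borel_measurable (filtration W n)"
          by (intro measurable_eval_filtration) simp
        show "(\<lambda>x. complex_of_real (x (e k))) \<in> borel_measurable (filtration W n)" by measurable
      qed
      show ?thesis by measurable
    qed
    then show ?thesis
      by (rule measurable_cong[THEN iffD1, rotated])
         (simp add: \<phi>n_def exp_fun_cproj space_filtration space_gauss)
  qed
  have zero: "(\<integral>x. (\<phi> x - \<phi>n x) * iexp (\<Sum>k<n. t k * x (e k)) \<partial>\<mu>) = 0" for t
  proof -
    define b where "b = (\<Sum>k<n. t k *\<^sub>R e k)"
    have b: "(0, b) \<in> \<E> \<times> \<E>"
      by (auto simp: b_def test_space_0 intro!: test_space_sum test_space_scaleR basis_test_space)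
    have iexp_eq: "iexp (\<Sum>k<n. t k * x (e k)) = exp (cbilinear (0, b) (0, b) / 2) * exp_fun (0, b) x"
      if x: "x \<in> space \<mu>" for x
    proof -
      have "x b = (\<Sum>k<n. t k * x (e k))"
        unfolding b_def using x by (simp add: eval_sum eval_scaleR basis_test_space test_space_scaleR)
      then show ?thesis
        using x by (simp add: exp_fun_def cpairing_def eval_0 exp_add[symmetric])
    qed
    \<comment> \<open>Since \<open>b\<close> has no coordinates from \<open>n\<close> on, it does
      not distinguish \<xi> from its projection.\<close>
    have cb: "cbilinear (cproj n \<xi>) (0, b) = cbilinear \<xi> (0, b)" for \<xi>
    proof (rule cbilinear_eq_if_coeff)
      fix k
      have "cf (0, b) k = 0" if "\<not> k < n" using that by (simp add: cf_def b_def inner_sum_basis complex_eq_iff)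
      then show "cf (cproj n \<xi>) k * cf (0, b) k = cf \<xi> k * cf (0, b) k" by (auto simp: cf_proj)
    qed
    have i: "integrable \<mu> (\<lambda>x. exp_fun \<xi> x * exp_fun (0, b) x)" if "\<xi> \<in> \<E> \<times> \<E>" for \<xi>
      using that b by (intro integrable_mult_L2 in_Lp_exp_fun) auto
    have S1: "(\<integral>x. (\<Sum>\<xi>\<in>F. c \<xi> * (exp_fun (g \<xi>) x * exp_fun (0, b) x)) \<partial>\<mu>) =
        (\<Sum>\<xi>\<in>F. c \<xi> * exp (cbilinear (g \<xi>) (0, b)))"
      "integrable \<mu> (\<lambda>x. \<Sum>\<xi>\<in>F. c \<xi> * (exp_fun (g \<xi>) x * exp_fun (0, b) x))"
      if "\<And>\<xi>. \<xi> \<in> F \<Longrightarrow> g \<xi> \<in> \<E> \<times> \<E>" for g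
    proof -
      show "integrable \<mu> (\<lambda>x. \<Sum>\<xi>\<in>F. c \<xi> * (exp_fun (g \<xi>) x * exp_fun (0, b) x))"
        by (intro Bochner_Integration.integrable_sum integrable_mult_right i that)
      have "(\<integral>x. (\<Sum>\<xi>\<in>F. c \<xi> * (exp_fun (g \<xi>) x * exp_fun (0, b) x)) \<partial>\<mu>) =
        (\<Sum>\<xi>\<in>F. c \<xi> * (\<integral>x. exp_fun (g \<xi>) x * exp_fun (0, b) x \<partial>\<mu>))"
        using i that by (subst Bochner_Integration.integral_sum) auto
      then show "(\<integral>x. (\<Sum>\<xi>\<in>F. c \<xi> * (exp_fun (g \<xi>) x * exp_fun (0, b) x)) \<partial>\<mu>) =
          (\<Sum>\<xi>\<in>F. c \<xi> * exp (cbilinear (g \<xi>) (0, b)))"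
        using integral_exp_fun_mult[OF that b] by simp
    qed
    have "(\<integral>x. (\<phi> x - \<phi>n x) * iexp (\<Sum>k<n. t k * x (e k)) \<partial>\<mu>) =
      (\<integral>x. exp (cbilinear (0, b) (0, b) / 2) *
        ((\<Sum>\<xi>\<in>F. c \<xi> * (exp_fun \<xi> x * exp_fun (0, b) x)) - (\<Sum>\<xi>\<in>F. c \<xi> * (exp_fun (cproj n \<xi>) x * exp_fun (0, b) x))) \<partial>\<mu>)"
      by (intro Bochner_Integration.integral_cong refl)
         (simp add: iexp_eq \<phi> \<phi>n_def left_diff_distrib right_diff_distrib sum_distrib_left sum_distrib_right mult_ac del: of_real_sum)
    also have "\<dots> = 0"
    proof -
      have Fm: "\<xi> \<in> \<E> \<times> \<E>" if "\<xi> \<in> F" for \<xi> using F(2) that by blast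
      show ?thesis
        using S1[of "\<lambda>\<xi>. \<xi>", OF Fm] S1[of "cproj n", OF cproj_test_space] by (simp add: cb)
    qed
    finally show ?thesis .
  qed
  have int_eq: "(\<integral>x. indicator U x *\<^sub>R \<phi> x \<partial>\<mu>) = (\<integral>x. indicator U x *\<^sub>R \<phi>n x \<partial>\<mu>)" if U: "U \<in> sets (filtration W n)" for U
  proof -
    have "U \<in> sets \<mu>" using U subalgebra_filtration by (auto simp: subalgebra_def)
    then have i: "integrable \<mu> (\<lambda>x. indicator U x *\<^sub>R \<phi> x)" "integrable \<mu> (\<lambda>x. indicator U x *\<^sub>R \<phi>n x)"
      by (auto intro!: integrable_mult_indicator \<phi>_int \<phi>n_int)
    have "(\<integral>x. indicator U x *\<^sub>R (\<phi> x - \<phi>n x) \<partial>\<mu>) = 0"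
      by (rule set_integral_filtration_eq_0[OF _ zero U]) (simp add: \<phi>_int \<phi>n_int)
    then show ?thesis using i by (simp add: scaleR_diff_right)
  qed
  have i2: "integrable \<mu> (\<lambda>x. indicator U x *\<^sub>R \<phi> x)" "integrable \<mu> (\<lambda>x. indicator U x *\<^sub>R \<phi>n x)"
    if U: "U \<in> sets (filtration W n)" for U
  proof -
    have "U \<in> sets \<mu>" using U subalgebra_filtration by (auto simp: subalgebra_def)
    then show "integrable \<mu> (\<lambda>x. indicator U x *\<^sub>R \<phi> x)" "integrable \<mu> (\<lambda>x. indicator U x *\<^sub>R \<phi>n x)"
      by (auto intro!: integrable_mult_indicator \<phi>_int \<phi>n_int)
  qed
  have re: "AE x in \<mu>. real_cond_exp \<mu> (filtration W n) (\<lambda>x. Re (\<phi> x)) x = Re (\<phi>n x)"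
  proof (rule real_cond_exp_charact)
    fix U assume U: "U \<in> sets (filtration W n)"
    have "Re (\<integral>x. indicator U x *\<^sub>R \<phi> x \<partial>\<mu>) = Re (\<integral>x. indicator U x *\<^sub>R \<phi>n x \<partial>\<mu>)" using int_eq[OF U] by simp
    then show "(\<integral>x\<in>U. Re (\<phi> x) \<partial>\<mu>) = (\<integral>x\<in>U. Re (\<phi>n x) \<partial>\<mu>)"
      unfolding set_lebesgue_integral_def integral_Re[OF i2(1)[OF U], symmetric] integral_Re[OF i2(2)[OF U], symmetric] by simp
  qed (use \<phi>_int \<phi>n_int \<phi>n_meas in auto)
  have im: "AE x in \<mu>. real_cond_exp \<mu> (filtration W n) (\<lambda>x. Im (\<phi> x)) x = Im (\<phi>n x)"
  proof (rule real_cond_exp_charact)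
    fix U assume U: "U \<in> sets (filtration W n)"
    have "Im (\<integral>x. indicator U x *\<^sub>R \<phi> x \<partial>\<mu>) = Im (\<integral>x. indicator U x *\<^sub>R \<phi>n x \<partial>\<mu>)" using int_eq[OF U] by simp
    then show "(\<integral>x\<in>U. Im (\<phi> x) \<partial>\<mu>) = (\<integral>x\<in>U. Im (\<phi>n x) \<partial>\<mu>)"
      unfolding set_lebesgue_integral_def integral_Im[OF i2(1)[OF U], symmetric] integral_Im[OF i2(2)[OF U], symmetric] by simp
  qed (use \<phi>_int \<phi>n_int \<phi>n_meas in auto)
  from re im show ?thesis
    by eventually_elim (simp add: complex_cond_exp_def \<phi>n_def complex_eq_iff)
qed

text \<open>The explicit sum shows that the condition behind the choice can be met. Any chosen
  version agrees with it almost everywhere after composition with \<open>proj_fin\<close>, hence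
  almost everywhere for the image measure.\<close>

lemma cond_exp_fin_Exp:
  assumes F: "finite F" "F \<subseteq> \<E> \<times> \<E>" and \<phi>: "\<phi> = (\<lambda>x. \<Sum>\<xi>\<in>F. c \<xi> * exp_fun \<xi> x)"
  shows "cond_exp_fin W n \<phi> \<in> borel_measurable (En n)"
    and "AE v in gauss_fin W n. cond_exp_fin W n \<phi> v = (\<Sum>\<xi>\<in>F. c \<xi> * fin_exp n \<xi> v)"
proof -
  let ?P = "\<lambda>g. g \<in> borel_measurable (En n) \<and>
    (AE x in \<mu>. g (proj_fin W n x) = complex_cond_exp \<mu> (filtration W n) \<phi> x)"
  let ?G = "\<lambda>v. \<Sum>\<xi>\<in>F. c \<xi> * fin_exp n \<xi> v"
  note ce = cond_exp_Exp[OF F \<phi>, of n]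
  have G_meas: "?G \<in> borel_measurable (En n)"
    by (intro borel_measurable_sum borel_measurable_times borel_measurable_const measurable_fin_exp)
  have "?P ?G"
  proof
    show "AE x in \<mu>. ?G (proj_fin W n x) = complex_cond_exp \<mu> (filtration W n) \<phi> x"
      using ce by (rule AE_mp) (intro AE_I2, simp add: exp_fun_cproj_fin_exp)
  qed (rule G_meas)
  then have P: "?P (cond_exp_fin W n \<phi>)" unfolding cond_exp_fin_def by (rule someI[where P = ?P])
  then show meas: "cond_exp_fin W n \<phi> \<in> borel_measurable (En n)" by blast
  have "AE x in \<mu>. cond_exp_fin W n \<phi> (proj_fin W n x) = ?G (proj_fin W n x)"
    using P[THEN conjunct2] \<open>?P ?G\<close>[THEN conjunct2] by eventually_elim simp
  moreover have "{v \<in> space (En n). cond_exp_fin W n \<phi> v = ?G v} \<in> sets (En n)"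
    using meas G_meas by measurable
  ultimately have "AE v in distr \<mu> (En n) (proj_fin W n). cond_exp_fin W n \<phi> v = ?G v"
    by (subst AE_distr_iff[OF measurable_proj_fin])
  then show "AE v in gauss_fin W n. cond_exp_fin W n \<phi> v = ?G v" unfolding distr_proj_fin .
qed

text \<open>By \<open>distr_comb\<close> the exceptional set has a null preimage in
  \<open>triple n\<close>; for almost every \<open>x\<close> and then almost every \<open>y\<close>
  its sections are null.\<close>

lemma AE_comb:
  assumes C: "diagonal_op W C \<alpha>" and P: "diagonal_op W P p" and Q: "diagonal_op W Q q"
    and sq: "\<And>k. (\<alpha> k)\<^sup>2 + (p k)\<^sup>2 + (q k)\<^sup>2 = 1"
    and AE: "AE v in gauss_fin W n. g v = (G v :: complex)"
  shows "AE x in \<mu>. AE y in gauss_fin W n. AE z in gauss_fin W n.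
    g (C (proj_fin W n x) + P y + Q z) = G (C (proj_fin W n x) + P y + Q z)"
proof -
  interpret G: prob_space "gauss_fin W n" by (rule prob_space_gauss_fin)
  interpret GG: pair_prob_space "gauss_fin W n" "gauss_fin W n" ..
  interpret T: pair_prob_space \<mu> "gauss_fin W n \<Otimes>\<^sub>M gauss_fin W n" ..
  let ?K = "\<lambda>w. \<Sum>k<n. (\<alpha> k * fst w (e k) + p k * inner (fst (snd w)) (e k) + q k * inner (snd (snd w)) (e k)) *\<^sub>R e k"
  have K: "?K \<in> triple n \<rightarrow>\<^sub>M En n" by (intro measurable_sum_basis measurable_comb)
  have "AE v in distr (triple n) (En n) ?K. g v = G v"
    using AE by (simp only: distr_comb[OF sq])
  then have "AE w in triple n. g (?K w) = G (?K w)" by (rule AE_distrD[OF K])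
  then have "AE x in \<mu>. AE v in gauss_fin W n \<Otimes>\<^sub>M gauss_fin W n. g (?K (x, v)) = G (?K (x, v))"
    by (rule T.AE_pair)
  then show ?thesis
  proof eventually_elim
    case (elim x)
    from GG.AE_pair[OF this] AE_space[of "gauss_fin W n"]
    show ?case
    proof eventually_elim
      case (elim y)
      from elim(1) AE_space[of "gauss_fin W n"]
      show ?case
        by eventually_elim (use elim(2) in \<open>simp add: diagonal_comb_eq[OF C P Q] space_gauss_fin\<close>)
    qed
  qed
qed

lemma measurable_diagonal_comb:
  assumes C: "diagonal_op W C \<alpha>" and P: "diagonal_op W P p" and Q: "diagonal_op W Q q"
  shows "(\<lambda>w. C (proj_fin W n (fst w)) + P (fst (snd w)) + Q (snd (snd w))) \<in> triple n \<rightarrow>\<^sub>M En n"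
proof -
  have "(\<lambda>w. \<Sum>k<n. (\<alpha> k * fst w (e k) + p k * inner (fst (snd w)) (e k) + q k * inner (snd (snd w)) (e k)) *\<^sub>R e k)
      \<in> triple n \<rightarrow>\<^sub>M En n" by (intro measurable_sum_basis measurable_comb)
  then show ?thesis
    by (rule measurable_cong[THEN iffD1, rotated])
       (auto simp: diagonal_comb_eq[OF C P Q] space_pair_measure space_gauss_fin)
qed

end

section \<open>The Gaussian integral formulas\<close>

lemma mult_rearrange:
  fixes c d :: "'a::comm_semiring_1"
  assumes "X * Y = E * U * V"
  shows "(c * X) * (d * Y) = c * d * E * U * V"
proof -
  have "(c * X) * (d * Y) = c * d * (X * Y)" by (simp only: mult_ac)
  then show ?thesis unfolding assms by (simp only: mult.assoc)
qed

context white_noise_setup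
begin

context
  fixes T C D' P Q R S' :: "'e \<Rightarrow> 'e" and t \<alpha> \<beta> p q r s :: "nat \<Rightarrow> real"
  assumes T: "diagonal_op W T t" and C: "diagonal_op W C \<alpha>" and D: "diagonal_op W D' \<beta>"
    and P: "diagonal_op W P p" and Q: "diagonal_op W Q q" and R: "diagonal_op W R r" and S': "diagonal_op W S' s"
    and pq: "\<And>k. (p k)\<^sup>2 + (q k)\<^sup>2 = 1 - (\<alpha> k)\<^sup>2"
    and rs: "\<And>k. (r k)\<^sup>2 + (s k)\<^sup>2 = 1 - (\<beta> k)\<^sup>2"
    and prqs: "\<And>k. p k * r k + q k * s k = (t k - 1) * \<alpha> k * \<beta> k"
begin

abbreviation "cC \<equiv> map_prod C C"
abbreviation "cD \<equiv> map_prod D' D'"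
abbreviation "cT \<equiv> map_prod T T"
abbreviation "cP \<equiv> map_prod P P"
abbreviation "cQ \<equiv> map_prod Q Q"
abbreviation "cR \<equiv> map_prod R R"
abbreviation "cS \<equiv> map_prod S' S'"

lemma mem_test_space:
  assumes "\<xi> \<in> \<E> \<times> \<E>"
  shows "cC \<xi> \<in> \<E> \<times> \<E>" "cD \<xi> \<in> \<E> \<times> \<E>" "cP \<xi> \<in> \<E> \<times> \<E>" "cQ \<xi> \<in> \<E> \<times> \<E>" "cR \<xi> \<in> \<E> \<times> \<E>" "cS \<xi> \<in> \<E> \<times> \<E>"
  using assms C D P Q R S' by (auto intro: diagonal_test_space)

lemma coeff_identity:
  "(of_real (p k) * X + of_real (r k) * Y)\<^sup>2 + (of_real (q k) * X + of_real (s k) * Y)\<^sup>2 + (of_real (\<alpha> k) * X + of_real (\<beta> k) * Y)\<^sup>2 =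
    X\<^sup>2 + Y\<^sup>2 + 2 * (of_real (t k) * (of_real (\<alpha> k) * X) * (of_real (\<beta> k) * Y))"
  for X Y :: complex
  by (rule quadratic_identity[OF pq rs prqs])

lemma cbilinear_identity:
  "cbilinear (cP \<xi> + cR \<eta>) (cP \<xi> + cR \<eta>) + cbilinear (cQ \<xi> + cS \<eta>) (cQ \<xi> + cS \<eta>) + cbilinear (cC \<xi> + cD \<eta>) (cC \<xi> + cD \<eta>) =
    cbilinear \<xi> \<xi> + cbilinear \<eta> \<eta> + 2 * cbilinear (cT (cC \<xi>)) (cD \<eta>)"
proof (rule LIMSEQ_unique)
  have eq: "(\<Sum>n<N. cf (cP \<xi> + cR \<eta>) n * cf (cP \<xi> + cR \<eta>) n) + (\<Sum>n<N. cf (cQ \<xi> + cS \<eta>) n * cf (cQ \<xi> + cS \<eta>) n) +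
      (\<Sum>n<N. cf (cC \<xi> + cD \<eta>) n * cf (cC \<xi> + cD \<eta>) n) =
    (\<Sum>n<N. cf \<xi> n * cf \<xi> n) + (\<Sum>n<N. cf \<eta> n * cf \<eta> n) + 2 * (\<Sum>n<N. cf (cT (cC \<xi>)) n * cf (cD \<eta>) n)" for N
    unfolding sum.distrib[symmetric] sum_distrib_left
    using coeff_identity[of _ "cf \<xi> _" "cf \<eta> _"]
    by (intro sum.cong refl)
       (simp add: cf_add cf_diagonal[OF C] cf_diagonal[OF D] cf_diagonal[OF P] cf_diagonal[OF Q]
          cf_diagonal[OF R] cf_diagonal[OF S'] cf_diagonal[OF T] power2_eq_square)
  show "(\<lambda>N. (\<Sum>n<N. cf (cP \<xi> + cR \<eta>) n * cf (cP \<xi> + cR \<eta>) n) + (\<Sum>n<N. cf (cQ \<xi> + cS \<eta>) n * cf (cQ \<xi> + cS \<eta>) n) +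
      (\<Sum>n<N. cf (cC \<xi> + cD \<eta>) n * cf (cC \<xi> + cD \<eta>) n)) \<longlonglongrightarrow>
    cbilinear (cP \<xi> + cR \<eta>) (cP \<xi> + cR \<eta>) + cbilinear (cQ \<xi> + cS \<eta>) (cQ \<xi> + cS \<eta>) + cbilinear (cC \<xi> + cD \<eta>) (cC \<xi> + cD \<eta>)"
    by (intro tendsto_intros cbilinear_parseval)
  show "(\<lambda>N. (\<Sum>n<N. cf (cP \<xi> + cR \<eta>) n * cf (cP \<xi> + cR \<eta>) n) + (\<Sum>n<N. cf (cQ \<xi> + cS \<eta>) n * cf (cQ \<xi> + cS \<eta>) n) +
      (\<Sum>n<N. cf (cC \<xi> + cD \<eta>) n * cf (cC \<xi> + cD \<eta>) n)) \<longlonglongrightarrow>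
    cbilinear \<xi> \<xi> + cbilinear \<eta> \<eta> + 2 * cbilinear (cT (cC \<xi>)) (cD \<eta>)"
    unfolding eq by (intro tendsto_intros cbilinear_parseval)
qed

lemma cpairing_dual_op:
  assumes "\<xi> \<in> \<E> \<times> \<E>"
  shows "cpairing (dual_op W A1 x + dual_op W A2 y + dual_op W A3 z) \<xi> =
    cpairing x (map_prod A1 A1 \<xi>) + cpairing y (map_prod A2 A2 \<xi>) + cpairing z (map_prod A3 A3 \<xi>)"
  using assms by (auto simp: cpairing_def dual_op_def algebra_simps)

text \<open>The product of two shifted exponentials factors into functions of \<open>x\<close>,
  \<open>y\<close> and \<open>z\<close>. The integrals over \<open>z\<close> and \<open>y\<close>
  contribute half squares, and by \<open>cbilinear_identity\<close> the total exponent is the cross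
  term with \<open>T\<close> plus the normalised exponent at the sum of the images under
  \<open>C\<close> and \<open>D'\<close>.\<close>

lemma integral_exp_fun_comb:
  assumes F: "finite F" "F \<subseteq> \<E> \<times> \<E>" and \<phi>: "\<phi> = (\<lambda>x. \<Sum>\<xi>\<in>F. c \<xi> * exp_fun \<xi> x)"
    and G: "finite G" "G \<subseteq> \<E> \<times> \<E>" and \<psi>: "\<psi> = (\<lambda>x. \<Sum>\<eta>\<in>G. d \<eta> * exp_fun \<eta> x)"
    and x: "x \<in> space \<mu>"
  shows "(\<integral>y. (\<integral>z. \<phi> (dual_op W C x + dual_op W P y + dual_op W Q z) *
      \<psi> (dual_op W D' x + dual_op W R y + dual_op W S' z) \<partial>\<mu>) \<partial>\<mu>) =
    (\<Sum>w\<in>F \<times> G. (c (fst w) * d (snd w) * exp (cbilinear (cT (cC (fst w))) (cD (snd w)))) *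
      exp_fun (cC (fst w) + cD (snd w)) x)"
proof -
  \<comment> \<open>Everything that depends neither on \<open>y\<close> nor on \<open>z\<close>,
    including both normalisations; \<open>a w\<close> and \<open>b w\<close> are the frequencies in
    \<open>y\<close> and \<open>z\<close>.\<close>
  define K where "K w = c (fst w) * d (snd w) * exp (cpairing x (cC (fst w) + cD (snd w)) -
    (cbilinear (fst w) (fst w) + cbilinear (snd w) (snd w)) / 2)" for w
  define a where "a w = cP (fst w) + cR (snd w)" for w
  define b where "b w = cQ (fst w) + cS (snd w)" for w
  have mem: "fst w \<in> \<E> \<times> \<E>" "snd w \<in> \<E> \<times> \<E>" if "w \<in> F \<times> G" for w using that F(2) G(2) by auto
  have ab: "a w \<in> \<E> \<times> \<E>" "b w \<in> \<E> \<times> \<E>" if "w \<in> F \<times> G" for w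
    unfolding a_def b_def by (intro test_space_pair_add mem_test_space mem[OF that])+
  have int: "integrable \<mu> (\<lambda>y. exp (cpairing y \<xi>))" if "\<xi> \<in> \<E> \<times> \<E>" for \<xi>
  proof -
    have "(\<lambda>y. exp (cpairing y \<xi>)) = (\<lambda>y. exp (cbilinear \<xi> \<xi> / 2) * exp_fun \<xi> y)"
      by (simp add: exp_fun_def exp_add[symmetric])
    then show ?thesis using integrable_exp_fun[OF that] by simp
  qed
  have prod: "\<phi> (dual_op W C x + dual_op W P y + dual_op W Q z) * \<psi> (dual_op W D' x + dual_op W R y + dual_op W S' z) =
    (\<Sum>w\<in>F \<times> G. K w * exp (cpairing y (a w)) * exp (cpairing z (b w)))" if y: "y \<in> space \<mu>" and z: "z \<in> space \<mu>" for y z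
  proof -
    have "exp_fun \<xi> (dual_op W C x + dual_op W P y + dual_op W Q z) * exp_fun \<eta> (dual_op W D' x + dual_op W R y + dual_op W S' z) =
      exp (cpairing x (cC \<xi> + cD \<eta>) - (cbilinear \<xi> \<xi> + cbilinear \<eta> \<eta>) / 2) * exp (cpairing y (cP \<xi> + cR \<eta>)) * exp (cpairing z (cQ \<xi> + cS \<eta>))"
      if "\<xi> \<in> F" "\<eta> \<in> G" for \<xi> \<eta>
    proof -
      have m: "\<xi> \<in> \<E> \<times> \<E>" "\<eta> \<in> \<E> \<times> \<E>" using that F(2) G(2) by auto
      have "(cpairing x (cC \<xi>) + cpairing y (cP \<xi>) + cpairing z (cQ \<xi>) - cbilinear \<xi> \<xi> / 2) +
          (cpairing x (cD \<eta>) + cpairing y (cR \<eta>) + cpairing z (cS \<eta>) - cbilinear \<eta> \<eta> / 2) =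
        cpairing x (cC \<xi> + cD \<eta>) - (cbilinear \<xi> \<xi> + cbilinear \<eta> \<eta>) / 2 + cpairing y (cP \<xi> + cR \<eta>) + cpairing z (cQ \<xi> + cS \<eta>)"
        using m by (simp add: cpairing_add[OF x] cpairing_add[OF y] cpairing_add[OF z] mem_test_space add_divide_distrib)
      then show ?thesis
        unfolding exp_fun_def cpairing_dual_op[OF m(1)] cpairing_dual_op[OF m(2)] by (simp only: exp_add[symmetric])
    qed
    then have "(c \<xi> * exp_fun \<xi> (dual_op W C x + dual_op W P y + dual_op W Q z)) * (d \<eta> * exp_fun \<eta> (dual_op W D' x + dual_op W R y + dual_op W S' z)) =
      K (\<xi>, \<eta>) * exp (cpairing y (a (\<xi>, \<eta>))) * exp (cpairing z (b (\<xi>, \<eta>)))" if "\<xi> \<in> F" "\<eta> \<in> G" for \<xi> \<eta>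
      unfolding K_def a_def b_def fst_conv snd_conv by (rule mult_rearrange) (use that in simp_all)
    then show ?thesis
      unfolding \<phi> \<psi> sum_product sum.cartesian_product by (intro sum.cong refl) auto
  qed
  have inner_int: "(\<integral>z. \<phi> (dual_op W C x + dual_op W P y + dual_op W Q z) * \<psi> (dual_op W D' x + dual_op W R y + dual_op W S' z) \<partial>\<mu>) =
    (\<Sum>w\<in>F \<times> G. K w * exp (cpairing y (a w)) * exp (cbilinear (b w) (b w) / 2))" if y: "y \<in> space \<mu>" for y
  proof -
    have "(\<integral>z. \<phi> (dual_op W C x + dual_op W P y + dual_op W Q z) * \<psi> (dual_op W D' x + dual_op W R y + dual_op W S' z) \<partial>\<mu>) =
      (\<integral>z. (\<Sum>w\<in>F \<times> G. K w * exp (cpairing y (a w)) * exp (cpairing z (b w))) \<partial>\<mu>)"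
      by (intro Bochner_Integration.integral_cong refl prod y)
    also have "\<dots> = (\<Sum>w\<in>F \<times> G. \<integral>z. K w * exp (cpairing y (a w)) * exp (cpairing z (b w)) \<partial>\<mu>)"
      by (intro Bochner_Integration.integral_sum integrable_mult_right int ab)
    also have "\<dots> = (\<Sum>w\<in>F \<times> G. K w * exp (cpairing y (a w)) * exp (cbilinear (b w) (b w) / 2))"
      by (intro sum.cong refl) (simp add: integral_exp_cpairing[OF ab(2)])
    finally show ?thesis .
  qed
  have "(\<integral>y. (\<integral>z. \<phi> (dual_op W C x + dual_op W P y + dual_op W Q z) *
      \<psi> (dual_op W D' x + dual_op W R y + dual_op W S' z) \<partial>\<mu>) \<partial>\<mu>) =
    (\<integral>y. (\<Sum>w\<in>F \<times> G. K w * exp (cbilinear (b w) (b w) / 2) * exp (cpairing y (a w))) \<partial>\<mu>)"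
    by (intro Bochner_Integration.integral_cong refl) (simp only: inner_int mult_ac)
  also have "\<dots> = (\<Sum>w\<in>F \<times> G. \<integral>y. K w * exp (cbilinear (b w) (b w) / 2) * exp (cpairing y (a w)) \<partial>\<mu>)"
    by (intro Bochner_Integration.integral_sum integrable_mult_right int ab)
  also have "\<dots> = (\<Sum>w\<in>F \<times> G. K w * exp (cbilinear (b w) (b w) / 2) * exp (cbilinear (a w) (a w) / 2))"
    by (intro sum.cong refl) (simp add: integral_exp_cpairing[OF ab(1)])
  also have "\<dots> = (\<Sum>w\<in>F \<times> G. (c (fst w) * d (snd w) * exp (cbilinear (cT (cC (fst w))) (cD (snd w)))) *
      exp_fun (cC (fst w) + cD (snd w)) x)"
  proof (intro sum.cong refl)
    fix w
    let ?X = "cbilinear (cC (fst w) + cD (snd w)) (cC (fst w) + cD (snd w))"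
    have id: "cbilinear (a w) (a w) = cbilinear (fst w) (fst w) + cbilinear (snd w) (snd w) + 2 * cbilinear (cT (cC (fst w))) (cD (snd w))
        - cbilinear (b w) (b w) - ?X"
      using cbilinear_identity[of "fst w" "snd w"] unfolding a_def b_def by (simp add: algebra_simps)
    have "cpairing x (cC (fst w) + cD (snd w)) - (cbilinear (fst w) (fst w) + cbilinear (snd w) (snd w)) / 2
        + cbilinear (b w) (b w) / 2 + cbilinear (a w) (a w) / 2 =
      cbilinear (cT (cC (fst w))) (cD (snd w)) + (cpairing x (cC (fst w) + cD (snd w)) - ?X / 2)"
      unfolding id by (simp add: add_divide_distrib diff_divide_distrib)
    then have "exp (cpairing x (cC (fst w) + cD (snd w)) - (cbilinear (fst w) (fst w) + cbilinear (snd w) (snd w)) / 2)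
        * exp (cbilinear (b w) (b w) / 2) * exp (cbilinear (a w) (a w) / 2) =
      exp (cbilinear (cT (cC (fst w))) (cD (snd w))) * exp_fun (cC (fst w) + cD (snd w)) x"
      unfolding exp_fun_def exp_add[symmetric] by (simp only:)
    then show "K w * exp (cbilinear (b w) (b w) / 2) * exp (cbilinear (a w) (a w) / 2) =
      (c (fst w) * d (snd w) * exp (cbilinear (cT (cC (fst w))) (cD (snd w)))) * exp_fun (cC (fst w) + cD (snd w)) x"
      unfolding K_def by (simp only: mult.assoc)
  qed
  finally show ?thesis .
qed

text \<open>The finite-dimensional counterpart: every bilinear form is replaced by its partial sum.
  The closed form for fixed \<open>n\<close> thus has the partial sum of the cross term and the
  projected frequency.\<close>

lemma integral_fin_exp_comb:
  assumes F: "finite F" and G: "finite G" and x: "x \<in> space \<mu>"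
  shows "(\<integral>y. (\<integral>z. (\<Sum>\<xi>\<in>F. c \<xi> * fin_exp n \<xi> (C (proj_fin W n x) + P y + Q z)) *
      (\<Sum>\<eta>\<in>G. d \<eta> * fin_exp n \<eta> (D' (proj_fin W n x) + R y + S' z)) \<partial>gauss_fin W n) \<partial>gauss_fin W n) =
    (\<Sum>w\<in>F \<times> G. (c (fst w) * d (snd w) * exp (\<Sum>k<n. cf (cT (cC (fst w))) k * cf (cD (snd w)) k)) *
      exp_fun (cproj n (cC (fst w) + cD (snd w))) x)"
proof -
  define u where "u w k = cf (cC (fst w) + cD (snd w)) k" for w k
  define a where "a w k = cf (cP (fst w) + cR (snd w)) k" for w k
  define b where "b w k = cf (cQ (fst w) + cS (snd w)) k" for w k
  define K where "K w = c (fst w) * d (snd w) * exp ((\<Sum>k<n. u w k * of_real (x (e k))) -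
    ((\<Sum>k<n. (cf (fst w) k)\<^sup>2) + (\<Sum>k<n. (cf (snd w) k)\<^sup>2)) / 2)" for w
  let ?L = "\<lambda>f y. exp (\<Sum>k<n. f k * of_real (inner y (e k)))"
  have prod: "(\<Sum>\<xi>\<in>F. c \<xi> * fin_exp n \<xi> (C (proj_fin W n x) + P y + Q z)) *
      (\<Sum>\<eta>\<in>G. d \<eta> * fin_exp n \<eta> (D' (proj_fin W n x) + R y + S' z)) =
    (\<Sum>w\<in>F \<times> G. K w * ?L (a w) y * ?L (b w) z)"
    if y: "y \<in> space (gauss_fin W n)" and z: "z \<in> space (gauss_fin W n)" for y z
  proof -
    have yz: "y \<in> E_fin W n" "z \<in> E_fin W n" using y z by (simp_all add: space_gauss_fin)
    have "fin_exp n \<xi> (C (proj_fin W n x) + P y + Q z) * fin_exp n \<eta> (D' (proj_fin W n x) + R y + S' z) =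
      exp ((\<Sum>k<n. u (\<xi>, \<eta>) k * of_real (x (e k))) - ((\<Sum>k<n. (cf \<xi> k)\<^sup>2) + (\<Sum>k<n. (cf \<eta> k)\<^sup>2)) / 2) *
        ?L (a (\<xi>, \<eta>)) y * ?L (b (\<xi>, \<eta>)) z" for \<xi> \<eta>
    proof -
      have i1: "inner (C (proj_fin W n x) + P y + Q z) (e k) = \<alpha> k * x (e k) + p k * inner y (e k) + q k * inner z (e k)" if "k < n" for k
        unfolding diagonal_comb_eq[OF C P Q yz] using that by (simp add: inner_sum_basis)
      have i2: "inner (D' (proj_fin W n x) + R y + S' z) (e k) = \<beta> k * x (e k) + r k * inner y (e k) + s k * inner z (e k)" if "k < n" for k
        unfolding diagonal_comb_eq[OF D R S' yz] using that by (simp add: inner_sum_basis)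
      have "(\<Sum>k<n. cf \<xi> k * of_real (inner (C (proj_fin W n x) + P y + Q z) (e k))) +
          (\<Sum>k<n. cf \<eta> k * of_real (inner (D' (proj_fin W n x) + R y + S' z) (e k))) =
        (\<Sum>k<n. u (\<xi>, \<eta>) k * of_real (x (e k))) + (\<Sum>k<n. a (\<xi>, \<eta>) k * of_real (inner y (e k))) +
          (\<Sum>k<n. b (\<xi>, \<eta>) k * of_real (inner z (e k)))"
        unfolding sum.distrib[symmetric]
      proof (intro sum.cong refl)
        fix k assume "k \<in> {..<n}"
        then have k: "k < n" by simp
        show "cf \<xi> k * of_real (inner (C (proj_fin W n x) + P y + Q z) (e k)) +
            cf \<eta> k * of_real (inner (D' (proj_fin W n x) + R y + S' z) (e k)) =
          u (\<xi>, \<eta>) k * of_real (x (e k)) + a (\<xi>, \<eta>) k * of_real (inner y (e k)) + b (\<xi>, \<eta>) k * of_real (inner z (e k))"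
          unfolding i1[OF k] i2[OF k]
          by (simp add: u_def a_def b_def cf_add cf_diagonal[OF C] cf_diagonal[OF D] cf_diagonal[OF P] cf_diagonal[OF Q]
              cf_diagonal[OF R] cf_diagonal[OF S'] algebra_simps)
      qed
      then have "((\<Sum>k<n. cf \<xi> k * of_real (inner (C (proj_fin W n x) + P y + Q z) (e k))) - (\<Sum>k<n. (cf \<xi> k)\<^sup>2) / 2) +
          ((\<Sum>k<n. cf \<eta> k * of_real (inner (D' (proj_fin W n x) + R y + S' z) (e k))) - (\<Sum>k<n. (cf \<eta> k)\<^sup>2) / 2) =
        (\<Sum>k<n. u (\<xi>, \<eta>) k * of_real (x (e k))) - ((\<Sum>k<n. (cf \<xi> k)\<^sup>2) + (\<Sum>k<n. (cf \<eta> k)\<^sup>2)) / 2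
          + (\<Sum>k<n. a (\<xi>, \<eta>) k * of_real (inner y (e k))) + (\<Sum>k<n. b (\<xi>, \<eta>) k * of_real (inner z (e k)))"
        by (simp add: add_divide_distrib algebra_simps)
      then show ?thesis unfolding fin_exp_def by (simp only: exp_add[symmetric])
    qed
    then have "(c \<xi> * fin_exp n \<xi> (C (proj_fin W n x) + P y + Q z)) * (d \<eta> * fin_exp n \<eta> (D' (proj_fin W n x) + R y + S' z)) =
      K (\<xi>, \<eta>) * ?L (a (\<xi>, \<eta>)) y * ?L (b (\<xi>, \<eta>)) z" for \<xi> \<eta>
      unfolding K_def fst_conv snd_conv by (rule mult_rearrange)
    then show ?thesis
      unfolding sum_product sum.cartesian_product by (intro sum.cong refl) auto
  qed
  have inner_int: "(\<integral>z. (\<Sum>\<xi>\<in>F. c \<xi> * fin_exp n \<xi> (C (proj_fin W n x) + P y + Q z)) *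
      (\<Sum>\<eta>\<in>G. d \<eta> * fin_exp n \<eta> (D' (proj_fin W n x) + R y + S' z)) \<partial>gauss_fin W n) =
    (\<Sum>w\<in>F \<times> G. K w * ?L (a w) y * exp (\<Sum>k<n. (b w k)\<^sup>2 / 2))" if y: "y \<in> space (gauss_fin W n)" for y
  proof -
    have "(\<integral>z. (\<Sum>\<xi>\<in>F. c \<xi> * fin_exp n \<xi> (C (proj_fin W n x) + P y + Q z)) *
      (\<Sum>\<eta>\<in>G. d \<eta> * fin_exp n \<eta> (D' (proj_fin W n x) + R y + S' z)) \<partial>gauss_fin W n) =
      (\<integral>z. (\<Sum>w\<in>F \<times> G. K w * ?L (a w) y * ?L (b w) z) \<partial>gauss_fin W n)"
      by (intro Bochner_Integration.integral_cong refl prod y)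
    also have "\<dots> = (\<Sum>w\<in>F \<times> G. \<integral>z. K w * ?L (a w) y * ?L (b w) z \<partial>gauss_fin W n)"
      by (intro Bochner_Integration.integral_sum integrable_mult_right exp_gauss_fin(2))
    also have "\<dots> = (\<Sum>w\<in>F \<times> G. K w * ?L (a w) y * exp (\<Sum>k<n. (b w k)\<^sup>2 / 2))"
      by (simp only: integral_mult_right_zero exp_gauss_fin(1))
    finally show ?thesis .
  qed
  have "(\<integral>y. (\<integral>z. (\<Sum>\<xi>\<in>F. c \<xi> * fin_exp n \<xi> (C (proj_fin W n x) + P y + Q z)) *
      (\<Sum>\<eta>\<in>G. d \<eta> * fin_exp n \<eta> (D' (proj_fin W n x) + R y + S' z)) \<partial>gauss_fin W n) \<partial>gauss_fin W n) =
    (\<integral>y. (\<Sum>w\<in>F \<times> G. K w * exp (\<Sum>k<n. (b w k)\<^sup>2 / 2) * ?L (a w) y) \<partial>gauss_fin W n)"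
    by (intro Bochner_Integration.integral_cong refl) (simp only: inner_int mult_ac)
  also have "\<dots> = (\<Sum>w\<in>F \<times> G. \<integral>y. K w * exp (\<Sum>k<n. (b w k)\<^sup>2 / 2) * ?L (a w) y \<partial>gauss_fin W n)"
    by (intro Bochner_Integration.integral_sum integrable_mult_right exp_gauss_fin(2))
  also have "\<dots> = (\<Sum>w\<in>F \<times> G. K w * exp (\<Sum>k<n. (b w k)\<^sup>2 / 2) * exp (\<Sum>k<n. (a w k)\<^sup>2 / 2))"
    by (simp only: integral_mult_right_zero exp_gauss_fin(1))
  also have "\<dots> = (\<Sum>w\<in>F \<times> G. (c (fst w) * d (snd w) * exp (\<Sum>k<n. cf (cT (cC (fst w))) k * cf (cD (snd w)) k)) *
      exp_fun (cproj n (cC (fst w) + cD (snd w))) x)"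
  proof (intro sum.cong refl)
    fix w
    \<comment> \<open>The scalar identity is summed over the coordinates below \<open>n\<close>; it
      holds in each coordinate, so truncation leaves no remainder.\<close>
    have id: "(\<Sum>k<n. (b w k)\<^sup>2 / 2) + (\<Sum>k<n. (a w k)\<^sup>2 / 2) + (\<Sum>k<n. (u w k)\<^sup>2 / 2) =
      (\<Sum>k<n. (cf (fst w) k)\<^sup>2 / 2) + (\<Sum>k<n. (cf (snd w) k)\<^sup>2 / 2) + (\<Sum>k<n. cf (cT (cC (fst w))) k * cf (cD (snd w)) k)"
      unfolding sum.distrib[symmetric]
    proof (intro sum.cong refl)
      fix k
      have "(b w k)\<^sup>2 + (a w k)\<^sup>2 + (u w k)\<^sup>2 = (cf (fst w) k)\<^sup>2 + (cf (snd w) k)\<^sup>2 + 2 * (cf (cT (cC (fst w))) k * cf (cD (snd w)) k)"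
        using coeff_identity[of k "cf (fst w) k" "cf (snd w) k"]
        by (simp add: u_def a_def b_def cf_add cf_diagonal[OF C] cf_diagonal[OF D] cf_diagonal[OF P] cf_diagonal[OF Q]
              cf_diagonal[OF R] cf_diagonal[OF S'] cf_diagonal[OF T] add.commute)
      then have "((b w k)\<^sup>2 + (a w k)\<^sup>2 + (u w k)\<^sup>2) / 2 = ((cf (fst w) k)\<^sup>2 + (cf (snd w) k)\<^sup>2 + 2 * (cf (cT (cC (fst w))) k * cf (cD (snd w)) k)) / 2"
        by (rule arg_cong)
      then show "(b w k)\<^sup>2 / 2 + (a w k)\<^sup>2 / 2 + (u w k)\<^sup>2 / 2 = (cf (fst w) k)\<^sup>2 / 2 + (cf (snd w) k)\<^sup>2 / 2 + cf (cT (cC (fst w))) k * cf (cD (snd w)) k"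
        by (simp add: add_divide_distrib)
    qed
    then have "(\<Sum>k<n. u w k * of_real (x (e k))) - ((\<Sum>k<n. (cf (fst w) k)\<^sup>2) + (\<Sum>k<n. (cf (snd w) k)\<^sup>2)) / 2
        + (\<Sum>k<n. (b w k)\<^sup>2 / 2) + (\<Sum>k<n. (a w k)\<^sup>2 / 2) =
      (\<Sum>k<n. cf (cT (cC (fst w))) k * cf (cD (snd w)) k) + ((\<Sum>k<n. u w k * of_real (x (e k))) - (\<Sum>k<n. (u w k)\<^sup>2) / 2)"
      by (simp add: sum_divide_distrib add_divide_distrib algebra_simps)
    then have "exp ((\<Sum>k<n. u w k * of_real (x (e k))) - ((\<Sum>k<n. (cf (fst w) k)\<^sup>2) + (\<Sum>k<n. (cf (snd w) k)\<^sup>2)) / 2)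
        * exp (\<Sum>k<n. (b w k)\<^sup>2 / 2) * exp (\<Sum>k<n. (a w k)\<^sup>2 / 2) =
      exp (\<Sum>k<n. cf (cT (cC (fst w))) k * cf (cD (snd w)) k) * exp_fun (cproj n (cC (fst w) + cD (snd w))) x"
      unfolding exp_fun_cproj[OF x] u_def[symmetric] exp_add[symmetric] by (simp only:)
    then show "K w * exp (\<Sum>k<n. (b w k)\<^sup>2 / 2) * exp (\<Sum>k<n. (a w k)\<^sup>2 / 2) =
      (c (fst w) * d (snd w) * exp (\<Sum>k<n. cf (cT (cC (fst w))) k * cf (cD (snd w)) k)) * exp_fun (cproj n (cC (fst w) + cD (snd w))) x"
      unfolding K_def by (simp only: mult.assoc)
  qed
  finally show ?thesis .
qed

end

end


section \<open>Passage to the limit and replacement of versions\<close>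

context white_noise_setup
begin

text \<open>The coefficients converge by Parseval, the exponential functions of projected
  frequencies converge in every Lp, and the sum over \<open>w\<close> is finite.\<close>

lemma Lp_tendsto_fin_dim:
  assumes p': "0 < p'" and F: "finite F" "F \<subseteq> \<E> \<times> \<E>" and G: "finite G" "G \<subseteq> \<E> \<times> \<E>"
    and C: "diagonal_op W C \<alpha>" and D: "diagonal_op W D' \<beta>" 
  shows "Lp_tendsto p' \<mu>
    (\<lambda>n x. \<Sum>w\<in>F \<times> G. (c (fst w) * d (snd w) * exp (\<Sum>k<n. cf (map_prod T T (map_prod C C (fst w))) k * cf (map_prod D' D' (snd w)) k)) *
      exp_fun (cproj n (map_prod C C (fst w) + map_prod D' D' (snd w))) x)
    (\<lambda>x. \<Sum>w\<in>F \<times> G. (c (fst w) * d (snd w) * exp (cbilinear (map_prod T T (map_prod C C (fst w))) (map_prod D' D' (snd w)))) *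
      exp_fun (map_prod C C (fst w) + map_prod D' D' (snd w)) x) sequentially"
proof (rule Lp_tendsto_sum[OF p'])
  show "finite (F \<times> G)" using F G by simp
  fix w assume "w \<in> F \<times> G"
  then have w: "fst w \<in> \<E> \<times> \<E>" "snd w \<in> \<E> \<times> \<E>" using F(2) G(2) by auto
  have mem: "map_prod C C (fst w) + map_prod D' D' (snd w) \<in> \<E> \<times> \<E>"
    using w C D by (intro test_space_pair_add) (auto intro: diagonal_test_space)
  show "Lp_tendsto p' \<mu>
    (\<lambda>n x. (c (fst w) * d (snd w) * exp (\<Sum>k<n. cf (map_prod T T (map_prod C C (fst w))) k * cf (map_prod D' D' (snd w)) k)) *
      exp_fun (cproj n (map_prod C C (fst w) + map_prod D' D' (snd w))) x)
    (\<lambda>x. (c (fst w) * d (snd w) * exp (cbilinear (map_prod T T (map_prod C C (fst w))) (map_prod D' D' (snd w)))) *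
      exp_fun (map_prod C C (fst w) + map_prod D' D' (snd w)) x) sequentially"
  proof (rule Lp_tendsto_mult_coeff[OF p'])
    show "Lp_tendsto p' \<mu> (\<lambda>n. exp_fun (cproj n (map_prod C C (fst w) + map_prod D' D' (snd w))))
        (exp_fun (map_prod C C (fst w) + map_prod D' D' (snd w))) sequentially"
      by (intro exp_fun_tendsto p' cproj_test_space mem cproj_tendsto)
    show "(\<lambda>n. c (fst w) * d (snd w) * exp (\<Sum>k<n. cf (map_prod T T (map_prod C C (fst w))) k * cf (map_prod D' D' (snd w)) k)) \<longlonglongrightarrow>
        c (fst w) * d (snd w) * exp (cbilinear (map_prod T T (map_prod C C (fst w))) (map_prod D' D' (snd w)))"
      by (intro tendsto_intros cbilinear_parseval)
  qed
qed

text \<open>Convergence in Lp includes measurability, which the chosen versions do not inherit from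
  an equality almost everywhere; it comes from integrating out \<open>z\<close> and then
  \<open>y\<close>.\<close>

lemma measurable_double_integral:
  assumes "(\<lambda>w. H (fst w) (fst (snd w)) (snd (snd w)) :: complex) \<in> borel_measurable (triple n)"
  shows "(\<lambda>x. \<integral>y. (\<integral>z. H x y z \<partial>gauss_fin W n) \<partial>gauss_fin W n) \<in> borel_measurable \<mu>"
proof -
  interpret G: prob_space "gauss_fin W n" by (rule prob_space_gauss_fin)
  have "(\<lambda>w. (fst (fst w), (snd (fst w), snd w))) \<in> (\<mu> \<Otimes>\<^sub>M gauss_fin W n) \<Otimes>\<^sub>M gauss_fin W n \<rightarrow>\<^sub>M triple n"
    by measurable
  from measurable_compose[OF this assms]
  have "(\<lambda>(v, z). H (fst v) (snd v) z) \<in> borel_measurable ((\<mu> \<Otimes>\<^sub>M gauss_fin W n) \<Otimes>\<^sub>M gauss_fin W n)"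
    by (simp add: case_prod_beta)
  from G.borel_measurable_lebesgue_integral[OF this]
  have "(\<lambda>(x, y). \<integral>z. H x y z \<partial>gauss_fin W n) \<in> borel_measurable (\<mu> \<Otimes>\<^sub>M gauss_fin W n)"
    by (simp add: case_prod_beta)
  from G.borel_measurable_lebesgue_integral[OF this] show ?thesis .
qed

text \<open>Joint measurability on \<open>triple n\<close> passes to all sections, so the nested
  almost-everywhere equality can be used in the inner and then in the outer integral.\<close>

lemma double_integral_cong_AE:
  assumes H1: "(\<lambda>w. H1 (fst w) (fst (snd w)) (snd (snd w)) :: complex) \<in> borel_measurable (triple n)"
    and H2: "(\<lambda>w. H2 (fst w) (fst (snd w)) (snd (snd w)) :: complex) \<in> borel_measurable (triple n)"
    and AE: "AE x in \<mu>. AE y in gauss_fin W n. AE z in gauss_fin W n. H1 x y z = H2 x y z"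
  shows "AE x in \<mu>. (\<integral>y. (\<integral>z. H1 x y z \<partial>gauss_fin W n) \<partial>gauss_fin W n) =
    (\<integral>y. (\<integral>z. H2 x y z \<partial>gauss_fin W n) \<partial>gauss_fin W n)"
  using AE AE_space
proof eventually_elim
  case (elim x)
  interpret G: prob_space "gauss_fin W n" by (rule prob_space_gauss_fin)
  have sec: "(\<lambda>v. H x (fst v) (snd v)) \<in> borel_measurable (gauss_fin W n \<Otimes>\<^sub>M gauss_fin W n)"
    if "(\<lambda>w. H (fst w) (fst (snd w)) (snd (snd w)) :: complex) \<in> borel_measurable (triple n)" for H
    using measurable_Pair2[OF that elim(2)] by simp
  have int_meas: "(\<lambda>y. \<integral>z. H x y z \<partial>gauss_fin W n) \<in> borel_measurable (gauss_fin W n)"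
    if "(\<lambda>w. H (fst w) (fst (snd w)) (snd (snd w)) :: complex) \<in> borel_measurable (triple n)" for H
    using G.borel_measurable_lebesgue_integral[of "\<lambda>y z. H x y z"] sec[OF that] by (simp add: case_prod_beta)
  have z_meas: "(\<lambda>z. H x y z) \<in> borel_measurable (gauss_fin W n)"
    if "(\<lambda>w. H (fst w) (fst (snd w)) (snd (snd w)) :: complex) \<in> borel_measurable (triple n)" "y \<in> space (gauss_fin W n)" for H y
    using measurable_Pair2[OF sec[OF that(1)] that(2)] by simp
  show ?case
  proof (rule integral_cong_AE[OF int_meas[OF H1] int_meas[OF H2]])
    from elim(1) AE_space[of "gauss_fin W n"]
    show "AE y in gauss_fin W n. (\<integral>z. H1 x y z \<partial>gauss_fin W n) = (\<integral>z. H2 x y z \<partial>gauss_fin W n)"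
    proof eventually_elim
      case (elim y)
      show ?case
        by (rule integral_cong_AE[OF z_meas[OF H1 elim(2)] z_meas[OF H2 elim(2)] elim(1)])
    qed
  qed
qed

end

theorem lemma4p1:
  fixes W :: "'e::{real_inner, polish_space} white_noise"
    and T C D P Q R S :: "'e \<Rightarrow> 'e"
    and t \<alpha> \<beta> p q r s :: "nat \<Rightarrow> real"
    and \<phi> \<psi> :: "('e \<Rightarrow> real) \<Rightarrow> complex"
  assumes W: "white_noise_space W"
    and T: "diagonal_op W T t" "\<And>n. 0 \<le> t n \<and> t n \<le> 2"
    and C: "diagonal_op W C \<alpha>" "\<And>n. - 1 \<le> \<alpha> n \<and> \<alpha> n \<le> 1"
    and D: "diagonal_op W D \<beta>" "\<And>n. - 1 \<le> \<beta> n \<and> \<beta> n \<le> 1"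
    and CD: "\<And>n. (1 - (\<alpha> n)\<^sup>2) * (1 - (\<beta> n)\<^sup>2) \<ge> (t n - 1)\<^sup>2 * (\<alpha> n)\<^sup>2 * (\<beta> n)\<^sup>2"
    and PQRS: "diagonal_op W P p" "diagonal_op W Q q" "diagonal_op W R r" "diagonal_op W S s"
    and PQ: "\<And>f. P (P f) + Q (Q f) = f - C (C f)"
    and RS: "\<And>f. R (R f) + S (S f) = f - D (D f)"
    and PR_QS: "\<And>f. P (R f) + Q (S f) = T (C (D f)) - C (D f)"
    and \<phi>: "\<phi> \<in> Exp W" and \<psi>: "\<psi> \<in> Exp W"
  shows "(\<forall>x\<in>dual_space W.
            T_wick W t (Gamma_op W \<alpha> \<phi>) (Gamma_op W \<beta> \<psi>) x =
            (\<integral>y. (\<integral>z. \<phi> (dual_op W C x + dual_op W P y + dual_op W Q z) *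
                      \<psi> (dual_op W D x + dual_op W R y + dual_op W S z)
                 \<partial>gauss W) \<partial>gauss W))
       \<and> (\<forall>p'\<ge>1. Lp_tendsto p' (gauss W)
            (\<lambda>n x. \<integral>y. (\<integral>z. cond_exp_fin W n \<phi> (C (proj_fin W n x) + P y + Q z) *
                             cond_exp_fin W n \<psi> (D (proj_fin W n x) + R y + S z)
                        \<partial>gauss_fin W n) \<partial>gauss_fin W n)
            (T_wick W t (Gamma_op W \<alpha> \<phi>) (Gamma_op W \<beta> \<psi>)) sequentially)"
proof -
  interpret white_noise_setup W by unfold_locales (rule W)
  have comp: "inner (A1 (A2 f)) (basis W k) = a1 k * (a2 k * inner f (basis W k))"
    if "diagonal_op W A1 a1" "diagonal_op W A2 a2" for A1 A2 a1 a2 f k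
    using that by (simp add: diagonal_coeff)
  \<comment> \<open>Each operator identity becomes an identity of eigenvalues when applied to a
    basis vector and paired with the same vector.\<close>
  have pq: "(p k)\<^sup>2 + (q k)\<^sup>2 = 1 - (\<alpha> k)\<^sup>2" for k
    using arg_cong[OF PQ[of "basis W k"], of "\<lambda>v. inner v (basis W k)"]
    by (simp add: inner_add_left inner_diff_left comp[OF PQRS(1) PQRS(1)] comp[OF PQRS(2) PQRS(2)] comp[OF C(1) C(1)]
        inner_basis power2_eq_square)
  have rs: "(r k)\<^sup>2 + (s k)\<^sup>2 = 1 - (\<beta> k)\<^sup>2" for k
    using arg_cong[OF RS[of "basis W k"], of "\<lambda>v. inner v (basis W k)"]
    by (simp add: inner_add_left inner_diff_left comp[OF PQRS(3) PQRS(3)] comp[OF PQRS(4) PQRS(4)] comp[OF D(1) D(1)]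
        inner_basis power2_eq_square)
  have prqs: "p k * r k + q k * s k = (t k - 1) * \<alpha> k * \<beta> k" for k
    using arg_cong[OF PR_QS[of "basis W k"], of "\<lambda>v. inner v (basis W k)"]
    by (simp add: inner_add_left inner_diff_left comp[OF PQRS(1) PQRS(3)] comp[OF PQRS(2) PQRS(4)] comp[OF C(1) D(1)]
        diagonal_coeff[OF T(1)] inner_basis algebra_simps)
  note comb = integral_exp_fun_comb[OF T(1) C(1) D(1) PQRS pq rs prqs]
    and fin_comb = integral_fin_exp_comb[OF T(1) C(1) D(1) PQRS pq rs prqs]
  obtain F c where \<phi>_eq: "\<phi> = (\<lambda>x. \<Sum>\<xi>\<in>F. c \<xi> * exp_fun \<xi> x)" and F: "finite F" "F \<subseteq> test_space W \<times> test_space W"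
    using \<phi> unfolding Exp_def by blast
  obtain G d where \<psi>_eq: "\<psi> = (\<lambda>x. \<Sum>\<eta>\<in>G. d \<eta> * exp_fun \<eta> x)" and G: "finite G" "G \<subseteq> test_space W \<times> test_space W"
    using \<psi> unfolding Exp_def by blast
  let ?cC = "map_prod C C" and ?cD = "map_prod D D" and ?cT = "map_prod T T"
  \<comment> \<open>The common closed form: the product evaluates to it by
    \<open>T_wick_sum_exp_fun\<close>, the double integral over \<mu> by \<open>comb\<close>, and it
    is the limit of the finite-dimensional integrals.\<close>
  define \<rho> where "\<rho> x = (\<Sum>w\<in>F \<times> G. (c (fst w) * d (snd w) * exp (cbilinear (?cT (?cC (fst w))) (?cD (snd w)))) *
      exp_fun (?cC (fst w) + ?cD (snd w)) x)" for x
  have mem: "?cC \<xi> \<in> test_space W \<times> test_space W" if "\<xi> \<in> F" for \<xi>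
    using that F(2) diagonal_test_space[OF C(1)] by auto
  have memD: "?cD \<eta> \<in> test_space W \<times> test_space W" if "\<eta> \<in> G" for \<eta>
    using that G(2) diagonal_test_space[OF D(1)] by auto
  have \<Gamma>: "Gamma_op W \<alpha> \<phi> = (\<lambda>x. \<Sum>\<xi>\<in>F. c \<xi> * exp_fun (?cC \<xi>) x)"
    "Gamma_op W \<beta> \<psi> = (\<lambda>x. \<Sum>\<eta>\<in>G. d \<eta> * exp_fun (?cD \<eta>) x)"
    using Gamma_op_diagonal[OF C(1) F(1), of "\<lambda>\<xi>. \<xi>" \<phi> c] Gamma_op_diagonal[OF D(1) G(1), of "\<lambda>\<eta>. \<eta>" \<psi> d] F(2) G(2)
    by (auto simp: \<phi>_eq \<psi>_eq)
  have t: "0 \<le> t n" "t n \<le> 2" for n using T(2)[of n] by auto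
  have wick: "T_wick W t (Gamma_op W \<alpha> \<phi>) (Gamma_op W \<beta> \<psi>) = \<rho>"
    unfolding \<rho>_def[abs_def]
    by (rule T_wick_sum_exp_fun[OF T(1) t F(1) mem G(1) memD]) (simp_all add: \<Gamma>)
  have "T_wick W t (Gamma_op W \<alpha> \<phi>) (Gamma_op W \<beta> \<psi>) x =
      (\<integral>y. (\<integral>z. \<phi> (dual_op W C x + dual_op W P y + dual_op W Q z) *
        \<psi> (dual_op W D x + dual_op W R y + dual_op W S z) \<partial>gauss W) \<partial>gauss W)" if "x \<in> dual_space W" for x
    unfolding wick \<rho>_def
    by (rule comb[OF F \<phi>_eq G \<psi>_eq, symmetric]) (simp add: that space_gauss)
  moreover have "Lp_tendsto p' (gauss W)
      (\<lambda>n x. \<integral>y. (\<integral>z. cond_exp_fin W n \<phi> (C (proj_fin W n x) + P y + Q z) *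
         cond_exp_fin W n \<psi> (D (proj_fin W n x) + R y + S z) \<partial>gauss_fin W n) \<partial>gauss_fin W n)
      (T_wick W t (Gamma_op W \<alpha> \<phi>) (Gamma_op W \<beta> \<psi>)) sequentially" if "1 \<le> p'" for p'
    unfolding wick
  proof (rule Lp_tendsto_cong_AE)
    have p': "0 < p'" using that by simp
    show "Lp_tendsto p' (gauss W)
      (\<lambda>n x. \<Sum>w\<in>F \<times> G. (c (fst w) * d (snd w) * exp (\<Sum>k<n. cf (?cT (?cC (fst w))) k * cf (?cD (snd w)) k)) *
        exp_fun (cproj n (?cC (fst w) + ?cD (snd w))) x) \<rho> sequentially"
      unfolding \<rho>_def[abs_def] by (rule Lp_tendsto_fin_dim[OF p' F G C(1) D(1)])
    fix n
    note mC = measurable_diagonal_comb[OF C(1) PQRS(1,2), of n]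
      and mD = measurable_diagonal_comb[OF D(1) PQRS(3,4), of n]
    note g\<phi> = cond_exp_fin_Exp[OF F \<phi>_eq, of n] and g\<psi> = cond_exp_fin_Exp[OF G \<psi>_eq, of n]
    have sqC: "(\<alpha> k)\<^sup>2 + (p k)\<^sup>2 + (q k)\<^sup>2 = 1" for k using pq[of k] by simp
    have sqD: "(\<beta> k)\<^sup>2 + (r k)\<^sup>2 + (s k)\<^sup>2 = 1" for k using rs[of k] by simp
    \<comment> \<open>\<open>?H1\<close> contains the chosen versions of the conditional
      expectations, \<open>?H2\<close> their explicit counterparts; the closed form is available for
      \<open>?H2\<close>, and the two integrands agree almost everywhere by
      \<open>AE_comb\<close>.\<close>
    let ?H1 = "\<lambda>x y z. cond_exp_fin W n \<phi> (C (proj_fin W n x) + P y + Q z) * cond_exp_fin W n \<psi> (D (proj_fin W n x) + R y + S z)"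
    let ?H2 = "\<lambda>x y z. (\<Sum>\<xi>\<in>F. c \<xi> * fin_exp n \<xi> (C (proj_fin W n x) + P y + Q z)) *
      (\<Sum>\<eta>\<in>G. d \<eta> * fin_exp n \<eta> (D (proj_fin W n x) + R y + S z))"
    have m1: "(\<lambda>w. ?H1 (fst w) (fst (snd w)) (snd (snd w))) \<in> borel_measurable (triple n)"
      by (intro borel_measurable_times measurable_compose[OF mC g\<phi>(1)] measurable_compose[OF mD g\<psi>(1)])
    have m2: "(\<lambda>w. ?H2 (fst w) (fst (snd w)) (snd (snd w))) \<in> borel_measurable (triple n)"
      by (intro borel_measurable_times borel_measurable_sum borel_measurable_const
          measurable_compose[OF mC measurable_fin_exp] measurable_compose[OF mD measurable_fin_exp])
    show "(\<lambda>x. \<integral>y. (\<integral>z. ?H1 x y z \<partial>gauss_fin W n) \<partial>gauss_fin W n) \<in> borel_measurable (gauss W)"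
      by (rule measurable_double_integral[OF m1])
    have "AE x in gauss W. AE y in gauss_fin W n. AE z in gauss_fin W n. ?H1 x y z = ?H2 x y z"
      using AE_comb[OF C(1) PQRS(1,2) sqC g\<phi>(2)] AE_comb[OF D(1) PQRS(3,4) sqD g\<psi>(2)]
    proof eventually_elim
      case (elim x)
      then show ?case
      proof eventually_elim
        case (elim y)
        then show ?case by eventually_elim simp
      qed
    qed
    \<comment> \<open>\<open>AE_space\<close> supplies \<open>x \<in> space (gauss W)\<close>, which
      the closed form presupposes.\<close>
    from double_integral_cong_AE[OF m1 m2 this] AE_space
    show "AE x in gauss W. (\<integral>y. (\<integral>z. ?H1 x y z \<partial>gauss_fin W n) \<partial>gauss_fin W n) =
      (\<Sum>w\<in>F \<times> G. (c (fst w) * d (snd w) * exp (\<Sum>k<n. cf (?cT (?cC (fst w))) k * cf (?cD (snd w)) k)) *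
        exp_fun (cproj n (?cC (fst w) + ?cD (snd w))) x)"
      by eventually_elim (simp only: fin_comb[OF F(1) G(1)])
  qed
  ultimately show ?thesis by blast
qed

end
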